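(* Any origin-symmetric convex body in $\mathbb{R}^3$ can be obtained from the Euclidean unit ball by means of three operations: linear transformations, multiplicative addition, and closure in the radial metric. That is, every origin-symmetric convex body in $\mathbb{R}^3$ belongs to the smallest class of origin-symmetric star bodies in $\mathbb{R}^3$ that contains the Euclidean unit ball and is closed under invertible linear transformations, under the multiplicative sum $(K,L)\mapsto K+_0L$, and under limits in the radial metric.
   Context: An origin-symmetric star body in $\mathbb{R}^n$ is a compact set $K$, symmetric about the origin, such that every straight line through the origin crosses the boundary of $K$ at exactly two points, the boundary is continuous (i.e. the radial function $\rho_K(x)=\|x\|_K^{-1}$ is continuous on $S^{n-1}$), and the origin is an interior point of $K$. Its Minkowski functional is $\|x\|_K=\min\{a\ge 0: x\in aK\}$. A convex body is a compact convex set with nonempty interior. The multiplicative sum $K+_0L$ of star bodies $K,L$ is the star body with $\|x\|_{K+_0L}=\sqrt{\|x\|_K\|x\|_L}$. The radial metric is $\rho(K,L)=\max_{x\in S^{n-1}}|\rho_K(x)-\rho_L(x)|$. *)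

theory Defs
  imports "HOL-Analysis.Analysis"
begin

definition origin_symmetric :: "'a::real_vector set \<Rightarrow> bool" where
  "origin_symmetric K \<longleftrightarrow> (\<forall>x\<in>K. - x \<in> K)"

text \<open>For a star body the infimum is attained, so it is the minimum of the usual definition
  (the scaled set for \<open>a = 0\<close> is \<open>{0}\<close>).\<close>

definition minkowski_functional :: "'a::real_vector set \<Rightarrow> 'a \<Rightarrow> real" where
  "minkowski_functional K x = Inf {a. 0 \<le> a \<and> x \<in> (\<lambda>y. a *\<^sub>R y) ` K}"

definition radial_function :: "'a::real_vector set \<Rightarrow> 'a \<Rightarrow> real" where
  "radial_function K x = inverse (minkowski_functional K x)"

text \<open>The straight lines through the origin are the sets \<open>span {u}\<close> with \<open>u \<noteq> 0\<close>.\<close>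

definition symmetric_star_body :: "'a::euclidean_space set \<Rightarrow> bool" where
  "symmetric_star_body K \<longleftrightarrow>
     compact K \<and> origin_symmetric K \<and> 0 \<in> interior K \<and>
     (\<forall>u. u \<noteq> 0 \<longrightarrow> card (span {u} \<inter> frontier K) = 2) \<and>
     continuous_on (sphere 0 1) (radial_function K)"

definition convex_body :: "'a::euclidean_space set \<Rightarrow> bool" where
  "convex_body K \<longleftrightarrow> compact K \<and> convex K \<and> interior K \<noteq> {}"

text \<open>The multiplicative sum is the star body whose Minkowski functional is the geometric mean of
  the two given ones, i.e. the unit ball of that functional; see
  \<open>symmetric_star_body_mult_sum\<close> and \<open>minkowski_functional_mult_sum\<close> below.\<close>

definition mult_sum :: "'a::euclidean_space set \<Rightarrow> 'a set \<Rightarrow> 'a set" where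
  "mult_sum K L = {x. sqrt (minkowski_functional K x * minkowski_functional L x) \<le> 1}"

text \<open>The supremum is a maximum for star bodies, whose radial functions are continuous on the
  compact unit sphere.\<close>

definition radial_dist :: "'a::euclidean_space set \<Rightarrow> 'a set \<Rightarrow> real" where
  "radial_dist K L = (SUP x\<in>sphere 0 1. \<bar>radial_function K x - radial_function L x\<bar>)"

text \<open>Limits are taken within the star bodies; the other rules preserve star bodies, so the class
  consists of star bodies only (\<open>generated_from_ball_imp_star_body\<close>).\<close>

inductive_set generated_from_ball :: "'a::euclidean_space set set" where
  ball: "cball 0 1 \<in> generated_from_ball"
| linear_image: "K \<in> generated_from_ball \<Longrightarrow> linear f \<Longrightarrow> bij f \<Longrightarrow> f ` K \<in> generated_from_ball"
| mult_sum: "K \<in> generated_from_ball \<Longrightarrow> L \<in> generated_from_ball \<Longrightarrow>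
    mult_sum K L \<in> generated_from_ball"
| limit: "(\<And>i::nat. Ks i \<in> generated_from_ball) \<Longrightarrow> symmetric_star_body K \<Longrightarrow>
    (\<lambda>i. radial_dist (Ks i) K) \<longlonglongrightarrow> 0 \<Longrightarrow> K \<in> generated_from_ball"


lemma symmetric_star_body_ray:
  fixes K :: "'a::euclidean_space set"
  assumes K: "symmetric_star_body K" and x: "x \<noteq> 0"
  obtains r where "r > 0" "\<And>t. t \<ge> 0 \<Longrightarrow> t *\<^sub>R x \<in> K \<longleftrightarrow> t \<le> r"
    "minkowski_functional K x = 1 / r"
proof -
  have comp: "compact K" and sym: "\<And>y. y \<in> K \<Longrightarrow> - y \<in> K" and int0: "0 \<in> interior K"
    and card2: "card (span {x} \<inter> frontier K) = 2"
    using K x by (auto simp: symmetric_star_body_def origin_symmetric_def)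
  have negK: "uminus ` K = K"
  proof
    show "uminus ` K \<subseteq> K" using sym by auto
    show "K \<subseteq> uminus ` K" using sym by (metis image_eqI minus_minus subsetI)
  qed
  have frK: "frontier K = K - interior K"
    using comp by (simp add: frontier_def compact_imp_closed)
  have "uminus ` interior K = interior K"
    using interior_negations[of K] negK by simp
  then have "- y \<in> interior K \<longleftrightarrow> y \<in> interior K" for y
    by (metis image_eqI minus_minus)
  then have frneg: "- y \<in> frontier K" if "y \<in> frontier K" for y
    using that sym by (simp add: frK)
  have "span {x} \<inter> frontier K \<noteq> {}" using card2 by auto
  then obtain s where s: "s *\<^sub>R x \<in> frontier K"
    by (auto simp: span_singleton)
  have "s \<noteq> 0" using s int0 by (auto simp: frontier_def)
  define r where "r = \<bar>s\<bar>"
  have r: "r > 0" using \<open>s \<noteq> 0\<close> by (simp add: r_def)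
  have rF: "r *\<^sub>R x \<in> frontier K" "(-r) *\<^sub>R x \<in> frontier K"
    using s frneg[OF s] by (auto simp: r_def abs_if)
  have "{r *\<^sub>R x, (-r) *\<^sub>R x} = span {x} \<inter> frontier K"
  proof (rule card_seteq)
    show "finite (span {x} \<inter> frontier K)" using card2 by (metis card.infinite zero_neq_numeral)
    show "{r *\<^sub>R x, (-r) *\<^sub>R x} \<subseteq> span {x} \<inter> frontier K"
      using rF by (intro subsetI) (auto simp only: insert_iff empty_iff Int_iff
        intro: span_scale span_base)
    have "r *\<^sub>R x \<noteq> (-r) *\<^sub>R x"
      using r x by (metis neg_equal_zero less_irrefl scaleR_cancel_right)
    then show "card (span {x} \<inter> frontier K) \<le> card {r *\<^sub>R x, (-r) *\<^sub>R x}"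
      using card2 by simp
  qed
  then have only: "t = r" if "t *\<^sub>R x \<in> frontier K" "t \<ge> 0" for t
  proof -
    have "t *\<^sub>R x \<in> {r *\<^sub>R x, (-r) *\<^sub>R x}"
      using that \<open>_ = span {x} \<inter> frontier K\<close> by (auto simp: span_singleton)
    then have "t = r \<or> t = - r" using x by (simp only: insert_iff empty_iff scaleR_cancel_right) simp
    then show ?thesis using that r by auto
  qed
  have cross: "\<exists>t. a \<le> t \<and> t \<le> b \<and> t *\<^sub>R x \<in> frontier K"
    if "a \<le> b" "a *\<^sub>R x \<in> K \<longleftrightarrow> b *\<^sub>R x \<notin> K" for a b
  proof -
    have "connected ((\<lambda>t. t *\<^sub>R x) ` {a..b})"
      by (intro connected_continuous_image continuous_intros) auto
    moreover have "(\<lambda>t. t *\<^sub>R x) ` {a..b} \<inter> K \<noteq> {}" "(\<lambda>t. t *\<^sub>R x) ` {a..b} - K \<noteq> {}"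
      using that by fastforce+
    ultimately have "(\<lambda>t. t *\<^sub>R x) ` {a..b} \<inter> frontier K \<noteq> {}"
      by (rule connected_Int_frontier)
    then show ?thesis by auto
  qed
  have iff: "t *\<^sub>R x \<in> K \<longleftrightarrow> t \<le> r" if t: "t \<ge> 0" for t
  proof (cases t r rule: linorder_cases)
    case equal
    then show ?thesis
      using rF comp frontier_subset_closed[of K] compact_imp_closed by auto
  next
    case less
    have "t *\<^sub>R x \<in> K"
    proof (rule ccontr)
      assume "t *\<^sub>R x \<notin> K"
      moreover have "0 *\<^sub>R x \<in> K" using int0 interior_subset by auto
      ultimately obtain u where "0 \<le> u" "u \<le> t" "u *\<^sub>R x \<in> frontier K"
        using cross[of 0 t] t by blast
      then show False using only less by force
    qed
    then show ?thesis using less by simp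
  next
    case greater
    have "t *\<^sub>R x \<notin> K"
    proof
      assume tK: "t *\<^sub>R x \<in> K"
      obtain B where B: "\<And>y. y \<in> K \<Longrightarrow> norm y \<le> B"
        using comp compact_imp_bounded bounded_iff by metis
      define T where "T = max t ((B + 1) / norm x)"
      have "norm (T *\<^sub>R x) \<ge> B + 1"
      proof -
        have "(B + 1) / norm x \<le> \<bar>T\<bar>" unfolding T_def by linarith
        then show ?thesis using x by (simp add: field_simps)
      qed
      then have "T *\<^sub>R x \<notin> K" using B by fastforce
      then obtain u where "t \<le> u" "u *\<^sub>R x \<in> frontier K"
        using cross[of t T] tK by (auto simp: T_def)
      then show False using only[of u] greater t by auto
    qed
    then show ?thesis using greater by simp
  qed
  have "{a. 0 \<le> a \<and> x \<in> (\<lambda>y. a *\<^sub>R y) ` K} = {1 / r..}"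
  proof (intro set_eqI)
    fix a
    show "a \<in> {a. 0 \<le> a \<and> x \<in> (\<lambda>y. a *\<^sub>R y) ` K} \<longleftrightarrow> a \<in> {1 / r..}"
    proof (cases "a > 0")
      case True
      then have "x \<in> (\<lambda>y. a *\<^sub>R y) ` K \<longleftrightarrow> (1 / a) *\<^sub>R x \<in> K"
        by (force simp: image_iff)
      then show ?thesis using True r iff[of "1 / a"] by (auto simp: field_simps)
    next
      case False
      moreover have "1 / r > 0" using r by simp
      ultimately have "a \<notin> {1 / r..}" unfolding atLeast_iff by linarith
      then show ?thesis using False x by (cases "a = 0") auto
    qed
  qed
  then have "minkowski_functional K x = 1 / r"
    by (simp add: minkowski_functional_def)
  then show ?thesis using that r iff by blast
qed

lemma minkowski_functional_zero:
  assumes "symmetric_star_body K"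
  shows "minkowski_functional K 0 = 0"
proof -
  have "0 \<in> K" using assms interior_subset by (auto simp: symmetric_star_body_def)
  then have "{a::real. 0 \<le> a \<and> 0 \<in> (\<lambda>y. a *\<^sub>R y) ` K} = {0..}"
    by (force simp: image_iff)
  then show ?thesis by (simp add: minkowski_functional_def)
qed

lemma minkowski_functional_pos:
  "symmetric_star_body K \<Longrightarrow> x \<noteq> 0 \<Longrightarrow> minkowski_functional K x > 0"
  by (metis symmetric_star_body_ray zero_less_divide_1_iff)

lemma minkowski_functional_le_1_iff:
  assumes "symmetric_star_body K"
  shows "minkowski_functional K x \<le> 1 \<longleftrightarrow> x \<in> K"
proof (cases "x = 0")
  case True
  then show ?thesis
    using assms interior_subset minkowski_functional_zero[OF assms]
    by (auto simp: symmetric_star_body_def)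
next
  case False
  obtain r where r: "r > 0" "\<And>t. t \<ge> 0 \<Longrightarrow> t *\<^sub>R x \<in> K \<longleftrightarrow> t \<le> r"
    "minkowski_functional K x = 1 / r"
    using symmetric_star_body_ray[OF assms False] by blast
  then show ?thesis using r(2)[of 1] by simp
qed

lemma minkowski_functional_scaleR:
  fixes K :: "'a::euclidean_space set"
  assumes K: "symmetric_star_body K"
  shows "minkowski_functional K (t *\<^sub>R x) = \<bar>t\<bar> * minkowski_functional K x"
proof (cases "t = 0 \<or> x = 0")
  case True
  then show ?thesis using minkowski_functional_zero[OF K] by auto
next
  case False
  then have nz: "x \<noteq> 0" "t *\<^sub>R x \<noteq> 0" and t: "\<bar>t\<bar> > 0" by auto
  obtain r where r: "r > 0" "\<And>s. s \<ge> 0 \<Longrightarrow> s *\<^sub>R x \<in> K \<longleftrightarrow> s \<le> r"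
    "minkowski_functional K x = 1 / r"
    using symmetric_star_body_ray[OF K nz(1)] by blast
  obtain q where q: "q > 0" "\<And>s. s \<ge> 0 \<Longrightarrow> s *\<^sub>R (t *\<^sub>R x) \<in> K \<longleftrightarrow> s \<le> q"
    "minkowski_functional K (t *\<^sub>R x) = 1 / q"
    using symmetric_star_body_ray[OF K nz(2)] by blast
  have sym: "- y \<in> K \<longleftrightarrow> y \<in> K" for y
    using K by (metis symmetric_star_body_def origin_symmetric_def minus_minus)
  have "s *\<^sub>R (t *\<^sub>R x) \<in> K \<longleftrightarrow> (s * \<bar>t\<bar>) *\<^sub>R x \<in> K" for s
    using sym[of "(s * t) *\<^sub>R x"] by (auto simp: abs_if)
  then have *: "s \<le> q \<longleftrightarrow> s * \<bar>t\<bar> \<le> r" if "s \<ge> 0" for s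
    using q(2)[OF that] r(2)[of "s * \<bar>t\<bar>"] that by simp
  have "q = r / \<bar>t\<bar>"
  proof (rule antisym)
    show "q \<le> r / \<bar>t\<bar>" using *[of q] q(1) t by (simp add: field_simps)
    show "r / \<bar>t\<bar> \<le> q" using *[of "r / \<bar>t\<bar>"] r(1) t by simp
  qed
  then show ?thesis using r q by simp
qed

lemma continuous_on_minkowski_functional:
  fixes K :: "'a::euclidean_space set"
  assumes K: "symmetric_star_body K"
  shows "continuous_on UNIV (minkowski_functional K)"
proof -
  let ?p = "minkowski_functional K"
  have "continuous_on (sphere 0 1) (\<lambda>x. inverse (radial_function K x))"
  proof (rule continuous_on_inverse)
    show "continuous_on (sphere 0 1) (radial_function K)"
      using K by (simp add: symmetric_star_body_def)
    show "\<forall>x\<in>sphere 0 1. radial_function K x \<noteq> 0"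
    proof
      fix x :: 'a assume "x \<in> sphere 0 1"
      then have "x \<noteq> 0" by auto
      then show "radial_function K x \<noteq> 0"
        using minkowski_functional_pos[OF K] by (fastforce simp: radial_function_def)
    qed
  qed
  then have sph: "continuous_on (sphere 0 1) ?p" by (simp add: radial_function_def)
  have hom: "?p x = norm x * ?p (sgn x)" for x
    using minkowski_functional_scaleR[OF K, of "norm x" "sgn x"]
    by (cases "x = 0") (simp_all add: sgn_div_norm minkowski_functional_zero[OF K])
  have "continuous_on (- {0}) (\<lambda>x. norm x * ?p (sgn x))"
    by (intro continuous_intros continuous_on_compose2[OF sph]) (auto simp: norm_sgn split: if_splits)
  then have off0: "continuous_on (- {0}) ?p" by (simp only: hom[symmetric])
  have "compact (?p ` sphere 0 1)" using sph by (intro compact_continuous_image) auto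
  then obtain B where B: "\<And>x. norm x = 1 \<Longrightarrow> \<bar>?p x\<bar> \<le> B"
    using compact_imp_bounded[of "?p ` sphere 0 1"] by (fastforce simp: bounded_iff)
  have "\<bar>?p x\<bar> \<le> norm x * B" for x
  proof (cases "x = 0")
    case False
    then have "norm x * \<bar>?p (sgn x)\<bar> \<le> norm x * B"
      using B[of "sgn x"] by (intro mult_left_mono) (simp_all add: norm_sgn)
    then show ?thesis by (subst hom) (simp add: abs_mult)
  qed (simp add: minkowski_functional_zero[OF K])
  then have "\<forall>\<^sub>F x in at 0. norm (?p x) \<le> norm x * B" by simp
  moreover have "((\<lambda>x. norm x * B) \<longlongrightarrow> 0) (at (0::'a))"
    by (rule tendsto_eq_intros refl | simp)+
  ultimately have "(?p \<longlongrightarrow> 0) (at 0)" by (rule Lim_null_comparison)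
  then have at0: "isCont ?p 0"
    by (simp add: isCont_def minkowski_functional_zero[OF K])
  have "isCont ?p x" for x
    using at0 off0 continuous_on_eq_continuous_at[of "- {0::'a}" ?p]
    by (cases "x = 0") auto
  then show ?thesis by (simp add: continuous_at_imp_continuous_on)
qed

lemma unit_ball_of_functional:
  fixes p :: "'a::euclidean_space \<Rightarrow> real"
  assumes cont: "continuous_on UNIV p"
    and hom: "\<And>t x. p (t *\<^sub>R x) = \<bar>t\<bar> * p x"
    and pos: "\<And>x. x \<noteq> 0 \<Longrightarrow> p x > 0"
  shows "symmetric_star_body {x. p x \<le> 1}" and "minkowski_functional {x. p x \<le> 1} = p"
proof -
  let ?D = "{x. p x \<le> 1}"
  have p0: "p 0 = 0" using hom[of 0 0] by simp
  show mink: "minkowski_functional ?D = p"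
  proof
    fix x
    have "{a. 0 \<le> a \<and> x \<in> (\<lambda>y. a *\<^sub>R y) ` ?D} = {p x..}"
    proof (intro set_eqI)
      fix a
      show "a \<in> {a. 0 \<le> a \<and> x \<in> (\<lambda>y. a *\<^sub>R y) ` ?D} \<longleftrightarrow> a \<in> {p x..}"
      proof (cases "a > 0")
        case True
        then have "x \<in> (\<lambda>y. a *\<^sub>R y) ` ?D \<longleftrightarrow> (1 / a) *\<^sub>R x \<in> ?D"
          by (force simp: image_iff)
        then show ?thesis using True by (auto simp: hom field_simps)
      next
        case False
        have "p x \<le> 0 \<longleftrightarrow> x = 0" "p x \<ge> 0"
          using pos[of x] p0 by (cases "x = 0"; simp)+
        moreover have "0 \<in> ?D" using p0 by simp
        ultimately show ?thesis using False
          by (cases "a = 0") (force simp: image_iff)+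
      qed
    qed
    then show "minkowski_functional ?D x = p x" by (simp add: minkowski_functional_def)
  qed
  have "closed ?D" by (intro closed_Collect_le cont continuous_intros)
  moreover have "bounded ?D"
  proof -
    obtain z where z: "norm z = 1" "\<And>y. norm y = 1 \<Longrightarrow> p z \<le> p y"
      using continuous_attains_inf[of "sphere 0 1" p] continuous_on_subset[OF cont]
      by auto
    have "z \<noteq> 0" using z(1) by auto
    then have pz: "p z > 0" by (rule pos)
    have "norm x \<le> 1 / p z" if "p x \<le> 1" for x
    proof (cases "x = 0")
      case False
      have "norm x * p z \<le> norm x * p (x /\<^sub>R norm x)"
        using z(2)[of "x /\<^sub>R norm x"] False by (intro mult_left_mono) auto
      also have "\<dots> = p x" using hom[of "norm x" "x /\<^sub>R norm x"] False by simp
      finally show ?thesis using that pz by (simp add: field_simps)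
    qed (use pz in simp)
    then show ?thesis by (auto simp: bounded_iff)
  qed
  ultimately have "compact ?D" by (simp add: compact_eq_bounded_closed)
  moreover have "origin_symmetric ?D"
    using hom[of "-1"] by (simp add: origin_symmetric_def)
  moreover have int: "interior ?D = {x. p x < 1}"
  proof
    have "open {x. p x < 1}" by (intro open_Collect_less cont continuous_intros)
    then show "{x. p x < 1} \<subseteq> interior ?D" by (intro interior_maximal) auto
    show "interior ?D \<subseteq> {x. p x < 1}"
    proof
      fix x assume x: "x \<in> interior ?D"
      then obtain e where e: "e > 0" "ball x e \<subseteq> ?D" by (auto simp: mem_interior)
      show "x \<in> {x. p x < 1}"
      proof (cases "x = 0")
        case False
        define d where "d = e / (2 * norm x)"
        have d: "d > 0" using e False by (simp add: d_def)
        have "dist x ((1 + d) *\<^sub>R x) = d * norm x"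
          using d by (simp add: dist_norm algebra_simps)
        also have "\<dots> < e" using e False by (simp add: d_def)
        finally have "p ((1 + d) *\<^sub>R x) \<le> 1" using e(2) by (auto simp: subset_iff)
        then have "(1 + d) * p x \<le> 1" using d by (simp add: hom)
        moreover have "p x < (1 + d) * p x" using d pos[OF False] by simp
        ultimately show ?thesis by simp
      qed (simp add: p0)
    qed
  qed
  moreover have "0 \<in> interior ?D" using int p0 by simp
  moreover have "card (span {u} \<inter> frontier ?D) = 2" if u: "u \<noteq> 0" for u
  proof -
    have pu: "p u > 0" using pos u by simp
    have fr: "frontier ?D = {x. p x = 1}"
      unfolding frontier_def int using \<open>closed ?D\<close> by auto
    have "span {u} \<inter> frontier ?D = (\<lambda>t. t *\<^sub>R u) ` {t. p (t *\<^sub>R u) = 1}"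
      unfolding fr span_singleton by blast
    also have "{t. p (t *\<^sub>R u) = 1} = {t. \<bar>t\<bar> * p u = 1}"
      by (simp only: hom)
    also have "{t. \<bar>t\<bar> * p u = 1} = {t. \<bar>t\<bar> = 1 / p u}"
      using pu by (simp add: eq_divide_eq)
    also have "\<dots> = {1 / p u, - (1 / p u)}"
      using pu by (simp only: abs_eq_iff') auto
    finally have "span {u} \<inter> frontier ?D = {(1 / p u) *\<^sub>R u, (- (1 / p u)) *\<^sub>R u}"
      by (simp only: image_insert image_empty)
    moreover have "1 / p u \<noteq> - (1 / p u)"
      using pu by (metis neg_equal_zero less_irrefl zero_less_divide_1_iff)
    ultimately show ?thesis using u by (simp only: card_2_iff) (metis scaleR_cancel_right)
  qed
  moreover have "continuous_on (sphere 0 1) (radial_function ?D)"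
  proof -
    have "continuous_on (sphere 0 1) (\<lambda>x. inverse (p x))"
    proof (intro continuous_on_inverse continuous_on_subset[OF cont] ballI)
      fix x :: 'a assume "x \<in> sphere 0 1"
      then have "x \<noteq> 0" by auto
      then show "p x \<noteq> 0" using pos by force
    qed simp
    then show ?thesis by (simp add: radial_function_def[abs_def] mink)
  qed
  ultimately show "symmetric_star_body ?D" by (simp add: symmetric_star_body_def)
qed

lemma
  fixes K L :: "'a::euclidean_space set"
  assumes K: "symmetric_star_body K" and L: "symmetric_star_body L"
  shows symmetric_star_body_mult_sum: "symmetric_star_body (mult_sum K L)"
    and minkowski_functional_mult_sum: "minkowski_functional (mult_sum K L) x =
           sqrt (minkowski_functional K x * minkowski_functional L x)"
proof -
  let ?p = "\<lambda>x. sqrt (minkowski_functional K x * minkowski_functional L x)"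
  have 1: "continuous_on UNIV ?p"
    by (intro continuous_intros continuous_on_minkowski_functional K L)
  have 2: "?p (t *\<^sub>R x) = \<bar>t\<bar> * ?p x" for t x
  proof -
    have "minkowski_functional K (t *\<^sub>R x) * minkowski_functional L (t *\<^sub>R x) =
        (\<bar>t\<bar> * \<bar>t\<bar>) * (minkowski_functional K x * minkowski_functional L x)"
      by (simp only: minkowski_functional_scaleR[OF K] minkowski_functional_scaleR[OF L] mult_ac)
    also have "\<bar>t\<bar> * \<bar>t\<bar> = t\<^sup>2" by (simp add: power2_eq_square)
    finally have "?p (t *\<^sub>R x) =
        sqrt (t\<^sup>2 * (minkowski_functional K x * minkowski_functional L x))" by simp
    then show ?thesis by (simp add: real_sqrt_mult)
  qed
  have 3: "?p x > 0" if "x \<noteq> 0" for x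
    using minkowski_functional_pos[OF K that] minkowski_functional_pos[OF L that] by simp
  show "symmetric_star_body (mult_sum K L)"
    unfolding mult_sum_def using 1 2 3 by (rule unit_ball_of_functional(1))
  show "minkowski_functional (mult_sum K L) x = ?p x"
    unfolding mult_sum_def using unit_ball_of_functional(2)[OF 1 2 3] by simp
qed

lemma symmetric_star_body_linear_image:
  fixes K :: "'a::euclidean_space set"
    and f :: "'a \<Rightarrow> 'a"
  assumes K: "symmetric_star_body K" and f: "linear f" "bij f"
  shows "symmetric_star_body (f ` K)"
proof -
  obtain g where g: "linear g" "g \<circ> f = id"
    using linear_injective_left_inverse[OF f(1) bij_is_inj[OF f(2)]] by blast
  have gf: "g (f x) = x" for x
    using g(2) by (metis comp_apply id_apply)
  have fg: "f (g x) = x" for x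
    using gf bij_is_surj[OF f(2)] by (metis surjD)
  let ?p = "\<lambda>x. minkowski_functional K (g x)"
  have "continuous_on UNIV ?p"
    using continuous_on_compose2[OF continuous_on_minkowski_functional[OF K]]
      linear_continuous_on g(1) linear_linear by blast
  moreover have "?p (t *\<^sub>R x) = \<bar>t\<bar> * ?p x" for t x
    using linear_scale[OF g(1)] minkowski_functional_scaleR[OF K] by simp
  moreover have "?p x > 0" if "x \<noteq> 0" for x
    using minkowski_functional_pos[OF K] that fg linear_0[OF f(1)] by metis
  ultimately have "symmetric_star_body {x. ?p x \<le> 1}" by (rule unit_ball_of_functional(1))
  moreover have "{x. ?p x \<le> 1} = f ` K"
    using gf fg by (auto simp: minkowski_functional_le_1_iff[OF K] image_iff) metis
  ultimately show ?thesis by simp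
qed

lemma symmetric_star_body_cball: "symmetric_star_body (cball (0::'a::euclidean_space) 1)"
proof -
  have "cball (0::'a) 1 = {x. norm x \<le> 1}" by auto
  then show ?thesis
    using unit_ball_of_functional(1)[of "norm :: 'a \<Rightarrow> real"] by (simp add: continuous_on_norm_id)
qed

lemma generated_from_ball_imp_star_body:
  "K \<in> generated_from_ball \<Longrightarrow> symmetric_star_body K"
  by (induction rule: generated_from_ball.induct)
     (simp_all add: symmetric_star_body_cball symmetric_star_body_linear_image
        symmetric_star_body_mult_sum)

end

theory Submission
  imports Defs
begin

text \<open>Let \<open>p\<close> be the norm with unit ball \<open>K\<close>. On the unit sphere, \<open>ln (p x)\<close> is, up to an additive constant,
  an average of functions \<open>ln \<bar>x \<bullet> \<xi>\<bar>\<close> with respect to a probability measure in \<open>\<xi>\<close>; as \<open>ln \<bar>x \<bullet> \<xi>\<bar>\<close> is a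
  limit of logarithms of ellipsoidal norms, and multiplicative sums turn into averages of
  logarithms, this places \<open>K\<close> in the generated class. For smooth \<open>K\<close> the density of the measure is
  proportional to minus the second derivative at \<open>0\<close> of the areas of the sections of \<open>K\<close> orthogonal to \<open>\<xi>\<close>, which is
  nonnegative by Brunn's theorem. To avoid derivatives, this density is replaced by an integral
  of the differences \<open>2 * vol (K \<inter> {\<bar>y \<bullet> \<xi>\<bar> \<le> \<tau> / 2}) - vol (K \<inter> {\<bar>y \<bullet> \<xi>\<bar> \<le> \<tau>}) \<ge> 0\<close> over the scales of \<open>\<xi>\<close>
  up to a cutoff \<open>1 / sqrt a\<close>. By Fubini, the average of \<open>ln \<bar>x \<bullet> \<xi>\<bar>\<close> with this weight is the integral
  over \<open>y \<in> K\<close> of explicit averages of the logarithm over ellipsoids; as \<open>a\<close> tends to \<open>0\<close>, its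
  leading term comes from the points \<open>y\<close> close to the line through \<open>x\<close> and is proportional to
  \<open>ln (p x)\<close>, while the other terms are independent of \<open>x\<close> or of smaller order.\<close>

subsection \<open>Linear changes of variables in three dimensions\<close>

text \<open>Why \<open>ln (p x)\<close> appears: write a point of \<open>K\<close> as
  \<open>s\<close> along the line through \<open>x\<close> and \<open>v\<close> across it. Near that
  line the averaged kernel is minus one half of a bump in \<open>v\<close>, divided by
  \<open>\<bar>s\<bar>\<close>, and integrating \<open>1 / \<bar>s\<bar>\<close> up to the boundary,
  at distance \<open>1 / p x\<close>, yields a logarithm. That integral diverges at the origin, so a
  small ball is cut out; by rotation invariance its share is the same for all \<open>x\<close>. The
  obstacle is the narrow margin. The coefficients 2 and -1 cancel the leading parts of the two
  ellipsoid averages, and the surviving main term, \<open>ridge_mass\<close>, is only of order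
  \<open>a * ln (1 / a)\<close>. Errors are either a small fraction of it or of order
  \<open>a\<close>, so it wins merely by a logarithm and every such error has to be shown to be
  truly of order \<open>a\<close>. Moreover one threshold for \<open>a\<close> must serve all
  \<open>x\<close>; the estimates are therefore uniform over all norms with the same bounds
  \<open>r\<close> and \<open>M\<close>. Finally the weight must have total mass at most 1 after
  normalising the main term, and \<open>ridge_mass\<close> turns out to bound this mass as
  well.\<close>

lemma lborel_linear_iso:
  fixes f :: "real^'n::{finite,wellorder} \<Rightarrow> real^'n::_"
  assumes f: "linear f" and d: "det (matrix f) \<noteq> 0"
  shows "lborel = density (distr lborel borel f) (\<lambda>_. ennreal \<bar>det (matrix f)\<bar>)"
proof (rule lborel_eqI)
  obtain g where g: "linear g" "\<And>x. g (f x) = x" "\<And>x. f (g x) = x"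
  proof -
    have "inj f" using d f det_nz_iff_inj by blast
    then show ?thesis using linear_injective_isomorphism[OF f] that by metis
  qed
  have [measurable]: "f \<in> borel_measurable borel"
    using f by (intro borel_measurable_continuous_onI linear_continuous_on) (simp add: linear_linear)
  have mfg: "matrix f ** matrix g = mat 1"
    using matrix_compose[OF g(1) f] g(3) by (simp add: o_def matrix_id_mat_1[unfolded id_def])
  have dg: "\<bar>det (matrix f)\<bar> * \<bar>det (matrix g)\<bar> = 1"
    by (metis abs_mult abs_one det_I det_mul mfg)
  fix l u :: "real^'n::{finite,wellorder}" assume le: "\<And>b. b \<in> Basis \<Longrightarrow> l \<bullet> b \<le> u \<bullet> b"
  have pre: "f -` box l u = g ` box l u"
    using g by (auto simp: image_iff) metis
  have sets: "f -` box l u \<in> sets borel" using measurable_sets_borel[of f borel "box l u"] by simp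
  have meas: "g ` box l u \<in> lmeasurable"
    using measurable_linear_image[OF g(1)] by blast
  have "emeasure lborel (f -` box l u) = emeasure lebesgue (g ` box l u)"
    using sets pre by simp
  also have "\<dots> = ennreal (measure lebesgue (g ` box l u))"
    using meas by (simp add: emeasure_eq_measure2)
  also have "measure lebesgue (g ` box l u) = \<bar>det (matrix g)\<bar> * measure lebesgue (box l u)"
    by (rule measure_linear_image[OF g(1)]) auto
  also have "measure lebesgue (box l u) = (\<Prod>b\<in>Basis. (u - l) \<bullet> b)"
    using le by (simp add: measure_lborel_box_eq inner_diff_left)
  finally have e: "emeasure lborel (f -` box l u) =
     ennreal (\<bar>det (matrix g)\<bar> * (\<Prod>b\<in>Basis. (u - l) \<bullet> b))" .
  have "emeasure (density (distr lborel borel f) (\<lambda>_. ennreal \<bar>det (matrix f)\<bar>)) (box l u) =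
     ennreal \<bar>det (matrix f)\<bar> * emeasure lborel (f -` box l u)"
    by (simp add: emeasure_density nn_integral_cmult emeasure_distr)
  also have "\<dots> = ennreal (\<bar>det (matrix f)\<bar> * (\<bar>det (matrix g)\<bar> * (\<Prod>b\<in>Basis. (u - l) \<bullet> b)))"
    unfolding e by (simp add: ennreal_mult')
  also have "\<dots> = ennreal (\<Prod>b\<in>Basis. (u - l) \<bullet> b)"
    by (simp only: mult.assoc[symmetric] dg mult_1)
  finally show "emeasure (density (distr lborel borel f) (\<lambda>_. ennreal \<bar>det (matrix f)\<bar>)) (box l u) =
    (\<Prod>b\<in>Basis. (u - l) \<bullet> b)" .
qed simp

lemma emeasure_lborel_Times:
  fixes A :: "'a::euclidean_space set" and B :: "'b::euclidean_space set"
  assumes "A \<in> sets borel" "B \<in> sets borel"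
  shows "emeasure lborel (A \<times> B) = emeasure lborel A * emeasure lborel B"
  using lborel.emeasure_pair_measure_Times[of A lborel B] assms by (simp add: lborel_prod)

text \<open>Two models of three-space are in use: determinants live on \<open>real^3\<close>, while
  Fubini needs a product whose first factor is a chosen axis and whose second factor is the plane
  across it.\<close>

definition coords3 :: "real \<times> real \<times> real \<Rightarrow> real^3" where
  "coords3 z = vector [fst z, fst (snd z), snd (snd z)]"

lemma coords3_nth [simp]:
  "coords3 z $ 1 = fst z" "coords3 z $ 2 = fst (snd z)" "coords3 z $ 3 = snd (snd z)"
  by (simp_all add: coords3_def)

lemma linear_coords3: "linear coords3"
  by (intro linearI) (auto simp: vec_eq_iff forall_3)

lemma norm_coords3: "norm (coords3 z) = norm z"
  by (cases z) (simp add: norm_eq_sqrt_inner inner_vec_def sum_3 inner_prod_def)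

lemma bij_coords3: "bij coords3"
proof (rule bijI')
  show "coords3 x = coords3 y \<longleftrightarrow> x = y" for x y
    by (auto simp: vec_eq_iff forall_3 prod_eq_iff)
  show "\<exists>x. y = coords3 x" for y
    by (rule exI[of _ "(y$1, y$2, y$3)"]) (simp add: vec_eq_iff forall_3)
qed

lemma lborel_coords3: "lborel = distr lborel borel coords3"
proof (rule lborel_eqI)
  have [measurable]: "coords3 \<in> borel_measurable borel"
    using linear_coords3
    by (intro borel_measurable_continuous_onI linear_continuous_on) (simp add: linear_linear)
  fix l u :: "real^3" assume le: "\<And>b. b \<in> Basis \<Longrightarrow> l \<bullet> b \<le> u \<bullet> b"
  have l: "l $ i \<le> u $ i" for i
    using le[of "axis i 1"] by (simp add: inner_axis)
  have B: "(Basis :: (real^3) set) = range (\<lambda>i. axis i 1)"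
    unfolding Basis_vec_def Basis_real_def by blast
  have pr: "(\<Prod>b\<in>Basis. f b) = f (axis 1 1) * f (axis 2 1) * f (axis 3 1)"
    for f :: "real^3 \<Rightarrow> real"
  proof -
    have "(\<Prod>b\<in>Basis. f b) = (\<Prod>i\<in>UNIV. f (axis i 1))"
      unfolding B by (subst prod.reindex) (simp_all add: inj_on_def axis_eq_axis)
    then show ?thesis unfolding UNIV_3 by simp
  qed
  have bx: "box (a, b) (c, d) = box a c \<times> box b d"
    for a c :: "'a::euclidean_space" and b d :: "'b::euclidean_space"
    by (auto simp: box_def Basis_prod_def ball_Un)
  have pre: "coords3 -` box l u = box (l$1, l$2, l$3) (u$1, u$2, u$3)"
    by (auto simp: mem_box_cart forall_3 bx)
  have em: "emeasure lborel (box (l$1, l$2, l$3) (u$1, u$2, u$3)) =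
      ennreal ((u$1 - l$1) * ((u$2 - l$2) * (u$3 - l$3)))"
    using l by (simp add: bx emeasure_lborel_Times borel_Times ennreal_mult')
  have "emeasure (distr lborel borel coords3) (box l u) =
     emeasure lborel (box (l$1, l$2, l$3) (u$1, u$2, u$3))"
    by (simp add: emeasure_distr pre)
  also have "\<dots> = ennreal (\<Prod>b\<in>Basis. (u - l) \<bullet> b)"
    unfolding em pr by (simp add: inner_axis mult.assoc)
  finally show "emeasure (distr lborel borel coords3) (box l u) = ennreal (\<Prod>b\<in>Basis. (u - l) \<bullet> b)" .
qed simp

text \<open>Isometric, volume-preserving coordinates on \<open>real^3\<close>. The direction of
  interest is \<open>U (1, 0)\<close>: for \<open>z = (s, v)\<close> the number \<open>s\<close> is
  the component of \<open>U z\<close> along it, and \<open>v\<close> stands for the orthogonal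
  part.\<close>

definition frame :: "(real \<times> real \<times> real \<Rightarrow> real^3) \<Rightarrow> bool" where
  "frame U \<longleftrightarrow> linear U \<and> (\<forall>z. norm (U z) = norm z) \<and> bij U \<and> lborel = distr lborel borel U"

lemma frame_exists:
  assumes "norm (x :: real^3) = 1"
  obtains U where "frame U" "U (1, 0) = x"
proof -
  have "norm (coords3 (1, 0)) = 1" by (simp add: norm_coords3 norm_prod_def)
  then obtain f where f: "orthogonal_transformation f" "f (coords3 (1, 0)) = x"
    using orthogonal_transformation_exists_1 assms by metis
  have lin: "linear f" using f(1) orthogonal_transformation_linear by blast
  have [measurable]: "f \<in> borel_measurable borel" "coords3 \<in> borel_measurable borel"
    using lin linear_coords3
    by (auto intro!: borel_measurable_continuous_onI linear_continuous_on simp: linear_linear)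
  have det: "\<bar>det (matrix f)\<bar> = 1"
    using orthogonal_transformation_det[OF f(1)] by simp
  have "lborel = distr lborel borel f"
    using lborel_linear_iso[OF lin] det by (simp add: density_1)
  also have "\<dots> = distr (distr lborel borel coords3) borel f"
    using lborel_coords3 by simp
  also have "\<dots> = distr lborel borel (f \<circ> coords3)"
    by (rule distr_distr) auto
  finally have l: "lborel = distr lborel borel (f \<circ> coords3)" .
  have "frame (f \<circ> coords3)"
    unfolding frame_def
    using lin linear_coords3 f(1) l bij_coords3
    by (auto simp: linear_compose norm_coords3 orthogonal_transformation_norm
        intro!: bij_comp orthogonal_transformation_bij)
  then show ?thesis using that f(2) by simp
qed

context
  fixes U assumes U: "frame U"
begin

lemma frame_linear: "linear U" and frame_norm: "norm (U z) = norm z" and frame_bij: "bij U"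
  and frame_lborel: "lborel = distr lborel borel U"
  using U by (auto simp only: frame_def)

lemma frame_inner: "U z \<bullet> U w = z \<bullet> w"
  by (simp add: dot_norm linear_add[OF frame_linear, symmetric] frame_norm)

lemma frame_measurable [measurable]: "U \<in> borel_measurable borel"
  using frame_linear
  by (auto intro!: borel_measurable_continuous_onI linear_continuous_on simp: linear_linear)

lemma frame_integral:
  fixes f :: "real^3 \<Rightarrow> real"
  assumes "f \<in> borel_measurable borel"
  shows "integral\<^sup>L lborel f = (\<integral>z. f (U z) \<partial>lborel)"
  by (subst frame_lborel) (rule integral_distr; use assms in simp)

lemma frame_integrable:
  fixes f :: "real^3 \<Rightarrow> real"
  assumes "f \<in> borel_measurable borel"
  shows "integrable lborel f \<longleftrightarrow> integrable lborel (\<lambda>z. f (U z))"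
  by (subst frame_lborel) (rule integrable_distr_eq; use assms in simp)

lemma frame_emeasure:
  assumes "A \<in> sets borel"
  shows "emeasure lborel A = emeasure lborel {z. U z \<in> A}"
  by (subst frame_lborel) (use assms in \<open>simp add: emeasure_distr vimage_def\<close>)

end

subsection \<open>Averages of the logarithm over ellipsoids\<close>

lemma borel_measurable_cball [measurable]: "cball a r \<in> sets (borel :: 'a::metric_space measure)"
  by (rule borel_closed) simp

lemma borel_measurable_fst_snd:
  "fst \<in> borel_measurable (borel :: ('a::topological_space \<times> 'b::topological_space) measure)"
  "snd \<in> borel_measurable (borel :: ('a::topological_space \<times> 'b::topological_space) measure)"
  by (intro borel_measurable_continuous_onI continuous_intros)+

lemma integrable_indicator_cball [simp]:
  "integrable lborel (indicator (cball (a :: 'a::euclidean_space) r) :: _ \<Rightarrow> real)"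
  by (intro integrable_real_indicator) (simp_all only: sets_lborel borel_measurable_cball emeasure_lborel_cball_finite)

text \<open>\<open>T\<close> is the symmetric square root of the identity plus \<open>c\<close>
  times the rank one form of \<open>y\<close>. It stretches \<open>y\<close> by \<open>s\<close> and
  fixes the orthogonal complement, whence the determinant. A negative \<open>c\<close> serves the
  ellipsoids, a positive \<open>c\<close> the smoothed logarithm.\<close>

lemma rank_one_map:
  fixes y :: "real^3" and c :: real
  assumes pos: "1 + c * (norm y)\<^sup>2 > 0"
  obtains T where "linear T" "\<And>x. (norm (T x))\<^sup>2 = (norm x)\<^sup>2 + c * (x \<bullet> y)\<^sup>2"
    "\<And>x z. T x \<bullet> z = x \<bullet> T z" "det (matrix T) = sqrt (1 + c * (norm y)\<^sup>2)"
    "T y = sqrt (1 + c * (norm y)\<^sup>2) *\<^sub>R y"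
proof -
  define s where "s = sqrt (1 + c * (norm y)\<^sup>2)"
  define b where "b = (if y = 0 then 0 else (s - 1) / (norm y)\<^sup>2)"
  have b: "b * (norm y)\<^sup>2 = s - 1"
    by (auto simp: b_def s_def)
  have s2: "s\<^sup>2 = 1 + c * (norm y)\<^sup>2"
    using pos by (simp add: s_def)
  define T where "T x = x + (b * (x \<bullet> y)) *\<^sub>R y" for x
  have "linear T"
    by (intro linearI) (simp_all add: T_def algebra_simps inner_add_left)
  moreover have "T x \<bullet> z = x \<bullet> T z" for x z
    by (simp add: T_def inner_add_left inner_add_right inner_commute[of y z])
  moreover have "(norm (T x))\<^sup>2 = (norm x)\<^sup>2 + c * (x \<bullet> y)\<^sup>2" for x
  proof -
    have "(norm (T x))\<^sup>2 = (norm x)\<^sup>2 + (2 * b + b * (b * (norm y)\<^sup>2)) * (x \<bullet> y)\<^sup>2"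
      unfolding power2_norm_eq_inner
      by (simp add: T_def inner_add_left inner_add_right inner_commute[of y x] power2_eq_square
        ring_distribs mult_ac)
    also have "(2 * b + b * (b * (norm y)\<^sup>2)) * (x \<bullet> y)\<^sup>2 = c * (x \<bullet> y)\<^sup>2"
    proof (cases "y = 0")
      case False
      have "(2 * b + b * (b * (norm y)\<^sup>2)) * (norm y)\<^sup>2 = 2 * (b * (norm y)\<^sup>2) + (b * (norm y)\<^sup>2)\<^sup>2"
        by (simp add: power2_eq_square algebra_simps)
      also have "\<dots> = s\<^sup>2 - 1" unfolding b by (simp add: power2_eq_square algebra_simps)
      also have "\<dots> = c * (norm y)\<^sup>2" using s2 by simp
      finally show ?thesis using False by simp
    qed simp
    finally show ?thesis .
  qed
  moreover have "det (matrix T) = s"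
  proof -
    have "matrix T $ i $ j = (if i = j then 1 else 0) + b * y $ i * y $ j" for i j
      by (simp add: matrix_def T_def inner_axis') (simp add: axis_def)
    then have "det (matrix T) = 1 + b * (y$1 * y$1 + y$2 * y$2 + y$3 * y$3)"
      by (simp add: det_3 algebra_simps)
    also have "y$1 * y$1 + y$2 * y$2 + y$3 * y$3 = (norm y)\<^sup>2"
      by (simp add: power2_norm_eq_inner inner_vec_def sum_3)
    finally show ?thesis using b by simp
  qed
  moreover have "T y = s *\<^sub>R y"
  proof -
    have "T y = (1 + b * (norm y)\<^sup>2) *\<^sub>R y"
      by (simp add: T_def power2_norm_eq_inner scaleR_add_left)
    then show ?thesis using b by simp
  qed
  ultimately show ?thesis using that s_def by metis
qed

lemma integrable_inverse_sqrt:
  assumes "M > 0" shows "set_integrable lborel {0<..<M} (\<lambda>s. 1 / sqrt s)"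
proof -
  have "set_integrable lborel (einterval 0 (ereal M)) (\<lambda>s. 1 / sqrt s)"
  proof (rule interval_integral_FTC_nonneg(1)[where F = "\<lambda>s. 2 * sqrt s" and A = 0 and B = "2 * sqrt M"])
    show "((\<lambda>s. 2 * sqrt s) has_real_derivative 1 / sqrt x) (at x)" if "0 < ereal x" for x
      using that by (auto intro!: derivative_eq_intros simp: field_simps)
    show "isCont (\<lambda>s. 1 / sqrt s) x" if "0 < ereal x" for x
      using that by (intro continuous_intros) auto
    have *: "((\<lambda>s. 2 * sqrt s) \<longlongrightarrow> 2 * sqrt a) (at a within S)" for a S
      by (intro tendsto_intros)
    show "(((\<lambda>s. 2 * sqrt s) \<circ> real_of_ereal) \<longlongrightarrow> 0) (at_right 0)"
      using *[of 0 "{0<..}"] unfolding zero_ereal_def ereal_tendsto_simps by simp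
    show "(((\<lambda>s. 2 * sqrt s) \<circ> real_of_ereal) \<longlongrightarrow> 2 * sqrt M) (at_left (ereal M))"
      using *[of M "{..<M}"] unfolding ereal_tendsto_simps by simp
  qed (use assms in auto)
  moreover have "einterval 0 (ereal M) = {0<..<M}"
    by (auto simp: einterval_def)
  ultimately show ?thesis by simp
qed

text \<open>Follows from \<open>- ln s = 2 * ln (1 / sqrt s)\<close> and
  \<open>ln u \<le> u\<close>. The singularity of the logarithm is traded for an integrable inverse
  square root.\<close>

lemma abs_ln_le:
  assumes s: "s > 0" shows "\<bar>ln s\<bar> \<le> s + 2 / sqrt (s::real)"
proof -
  define u where "u = 1 / sqrt s"
  have "u > 0" "2 / sqrt s = 2 * u" using s by (simp_all add: u_def)
  moreover have "ln u \<le> u" using \<open>u > 0\<close> by (rule ln_bound)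
  moreover have "ln u = - ln s / 2" using s by (simp add: u_def ln_div ln_sqrt)
  moreover have "ln s \<le> s" using s by (rule ln_bound)
  ultimately show ?thesis using s by linarith
qed

lemma integrable_abs_ln:
  "integrable lborel (\<lambda>s::real. indicator {-M..M} s * \<bar>ln \<bar>s\<bar>\<bar>)"
proof -
  define N where "N = max M 1"
  define g where "g s = indicator {0<..<N+1} s * (N + 2 / sqrt s)" for s :: real
  have N: "N \<ge> 1" "M \<le> N" by (auto simp: N_def)
  have "integrable lborel (\<lambda>s. indicator {0<..<N+1} s * (1 / sqrt s))"
    using integrable_inverse_sqrt[of "N+1"] N by (simp add: set_integrable_def)
  then have g: "integrable lborel g"
  proof -
    have "integrable lborel (\<lambda>s. N * indicator {0<..<N+1} s + 2 * (indicator {0<..<N+1} s * (1 / sqrt s)))"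
      using \<open>integrable lborel (\<lambda>s. indicator {0<..<N+1} s * (1 / sqrt s))\<close> N
      by (intro Bochner_Integration.integrable_add integrable_mult_right integrable_real_indicator)
        (auto simp: emeasure_lborel_Ioo)
    then show ?thesis by (simp add: g_def[abs_def] algebra_simps)
  qed
  have g': "integrable lborel (\<lambda>s. g (- s))"
    using lborel_integrable_real_affine[OF g, of "-1" 0] by simp
  have "integrable lborel (\<lambda>s. g s + g (- s))" using g g' by simp
  then show ?thesis
  proof (rule Bochner_Integration.integrable_bound)
    show "AE s in lborel. norm (indicator {-M..M} s * \<bar>ln \<bar>s\<bar>\<bar>) \<le> norm (g s + g (- s))"
    proof (rule AE_I2)
      fix s :: real
      have nn: "g s \<ge> 0" for s using N by (auto simp: g_def indicator_def)
      have *: "\<bar>ln t\<bar> \<le> g t" if "0 < t" "t \<le> M" for t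
        using abs_ln_le[OF that(1)] that N by (simp add: g_def)
      have "indicator {-M..M} s * \<bar>ln \<bar>s\<bar>\<bar> \<le> g s + g (- s)"
        using *[of s] *[of "- s"] nn[of s] nn[of "- s"]
        by (cases s "0 :: real" rule: linorder_cases) (auto simp: indicator_def)
      then show "norm (indicator {-M..M} s * \<bar>ln \<bar>s\<bar>\<bar>) \<le> norm (g s + g (- s))"
        by (simp add: abs_mult)
    qed
  qed simp
qed

lemma integrable_lborel_prod:
  fixes f :: "'a::euclidean_space \<Rightarrow> real" and g :: "'b::euclidean_space \<Rightarrow> real"
  assumes f: "integrable lborel f" and g: "integrable lborel g"
  shows "integrable lborel (\<lambda>z. f (fst z) * g (snd z))"
proof -
  have "integrable (lborel \<Otimes>\<^sub>M lborel) (\<lambda>(x, y). f x * g y)"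
    using f g by (intro lborel_pair.Fubini_integrable) (auto simp: abs_mult)
  then show ?thesis by (simp add: lborel_prod case_prod_beta')
qed

lemma integral_lborel_linear_iso:
  fixes f :: "real^'n::{finite,wellorder} \<Rightarrow> real^'n::_" and g :: "real^'n::_ \<Rightarrow> real"
  assumes f: "linear f" and d: "det (matrix f) \<noteq> 0" and g: "g \<in> borel_measurable borel"
  shows "integral\<^sup>L lborel g = \<bar>det (matrix f)\<bar> * (\<integral>x. g (f x) \<partial>lborel)"
proof -
  have m: "f \<in> borel_measurable borel"
    using f by (intro borel_measurable_continuous_onI linear_continuous_on) (simp add: linear_linear)
  note [measurable] = m g
  show "integral\<^sup>L lborel g = \<bar>det (matrix f)\<bar> * (\<integral>x. g (f x) \<partial>lborel)"
    by (subst lborel_linear_iso[OF f d]) (simp add: integral_density integral_distr)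
qed

text \<open>In a frame with first axis \<open>e\<close> the product \<open>e \<bullet> \<xi>\<close>
  becomes the first coordinate, while the ball and the volume stay the same. Such integrals are
  therefore independent of the direction.\<close>

lemma radial_ridge:
  fixes e :: "real^3" and g :: "real \<Rightarrow> real"
  assumes e: "norm e = 1" and g[measurable]: "g \<in> borel_measurable borel"
  shows "(\<integral>\<xi>. indicator (cball 0 M) \<xi> * g (e \<bullet> \<xi>) \<partial>lborel) =
      (\<integral>z. indicator (cball 0 M) (z :: real \<times> real \<times> real) * g (fst z) \<partial>lborel)"
    and "integrable lborel (\<lambda>\<xi>. indicator (cball 0 M) \<xi> * g (e \<bullet> \<xi>)) \<longleftrightarrow>
      integrable lborel (\<lambda>z. indicator (cball 0 M) (z :: real \<times> real \<times> real) * g (fst z))"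
proof -
  obtain U where U: "frame U" "U (1, 0) = e" using frame_exists[OF e] by blast
  have m: "(\<lambda>\<xi>. indicator (cball 0 M) \<xi> * g (e \<bullet> \<xi>)) \<in> borel_measurable borel"
    by measurable
  have 1: "indicator (cball 0 M) (U z) = (indicator (cball 0 M) z :: real)" for z
    by (simp add: indicator_def frame_norm[OF U(1)])
  have 2: "e \<bullet> U z = fst z" for z
    using frame_inner[OF U(1), of "(1, 0)" z] U(2) by (simp add: inner_prod_def)
  show "(\<integral>\<xi>. indicator (cball 0 M) \<xi> * g (e \<bullet> \<xi>) \<partial>lborel) =
      (\<integral>z. indicator (cball 0 M) (z :: real \<times> real \<times> real) * g (fst z) \<partial>lborel)"
    by (simp add: frame_integral[OF U(1) m] 1 2)
  show "integrable lborel (\<lambda>\<xi>. indicator (cball 0 M) \<xi> * g (e \<bullet> \<xi>)) \<longleftrightarrow>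
      integrable lborel (\<lambda>z. indicator (cball 0 M) (z :: real \<times> real \<times> real) * g (fst z))"
    by (simp add: frame_integrable[OF U(1) m] 1 2)
qed

lemma integrable_ln_fst:
  "integrable lborel (\<lambda>z. indicator (cball 0 M) (z :: real \<times> real \<times> real) * ln \<bar>fst z\<bar>)"
proof -
  have "integrable lborel (\<lambda>z. (indicator {-M..M} (fst z) * \<bar>ln \<bar>fst z\<bar>\<bar>) *
      indicator (cball (0::real \<times> real) M) (snd z))"
    by (intro integrable_lborel_prod integrable_abs_ln integrable_real_indicator)
       (simp_all only: sets_lborel borel_measurable_cball emeasure_lborel_cball_finite)
  then show ?thesis
  proof (rule Bochner_Integration.integrable_bound)
    have "norm (indicator (cball 0 M) z * ln \<bar>fst z\<bar>) \<le>
       norm ((indicator {-M..M} (fst z) * \<bar>ln \<bar>fst z\<bar>\<bar>) * indicator (cball (0::real \<times> real) M) (snd z))"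
      for z :: "real \<times> real \<times> real"
      using norm_fst_le[of "fst z" "snd z"] norm_snd_le[of "snd z" "fst z"]
      by (auto simp: indicator_def abs_le_iff)
    then show "AE z in lborel. norm (indicator (cball 0 M) z * ln \<bar>fst z\<bar>) \<le>
       norm ((indicator {-M..M} (fst z) * \<bar>ln \<bar>fst z\<bar>\<bar>) * indicator (cball (0::real \<times> real) M) (snd z))"
      by simp
    have [measurable]: "(fst :: real \<times> real \<times> real \<Rightarrow> real) \<in> borel_measurable borel"
      by (rule borel_measurable_fst_snd)
    have "(\<lambda>z :: real \<times> real \<times> real. ln \<bar>fst z\<bar>) \<in> borel_measurable borel"
      by (rule measurable_compose[of fst _ borel]) measurable
    then show "(\<lambda>z. indicator (cball 0 M) (z :: real \<times> real \<times> real) * ln \<bar>fst z\<bar>) \<in> borel_measurable lborel"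
      by simp
  qed
qed

lemma AE_inner_nonzero:
  assumes "(e :: 'a::euclidean_space) \<noteq> 0"
  shows "AE \<xi> in lborel. e \<bullet> \<xi> \<noteq> 0"
proof -
  let ?N = "{\<xi>. e \<bullet> \<xi> = 0}"
  have "negligible ?N" by (rule negligible_hyperplane) (use assms in simp)
  then have 1: "?N \<in> null_sets lebesgue" by (simp only: negligible_iff_null_sets)
  have "?N \<in> sets lborel" by (simp add: borel_closed closed_hyperplane)
  from null_sets_completion_iff[OF this] have "?N \<in> null_sets lborel" using 1 by blast
  then show ?thesis by (rule AE_I') blast
qed

lemma det_scale3: "det (k *\<^sub>R A :: real^3^3) = k ^ 3 * det A"
  by (simp add: det_3 power3_eq_cube algebra_simps)

definition ball_ln :: real where
  "ball_ln = (\<integral>z. indicator (cball 0 1) (z :: real \<times> real \<times> real) * ln \<bar>fst z\<bar> \<partial>lborel)"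

abbreviation ball_vol :: real where "ball_vol \<equiv> measure lborel (cball (0 :: real^3) 1)"

text \<open>\<open>S\<close> is the inverse square root of the quadratic form that defines the
  ellipsoid. By the Sherman-Morrison formula the inverse form is \<open>1 / a\<close> times the
  identity minus \<open>1 / (a + R)\<close> times the rank one form of \<open>y\<close>, which
  dictates the value of \<open>c\<close> in the proof.\<close>

lemma ellipsoid_map:
  fixes x y :: "real^3"
  assumes "a > 0"
  obtains S where "linear S" "\<bar>det (matrix S)\<bar> = 1 / (a * sqrt (a + (norm y)\<^sup>2))"
    "\<And>\<eta>. a * (norm (S \<eta>))\<^sup>2 + (y \<bullet> S \<eta>)\<^sup>2 = (norm \<eta>)\<^sup>2"
    "\<And>x \<eta>. x \<bullet> S \<eta> = S x \<bullet> \<eta>"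
    "\<And>x. (norm (S x))\<^sup>2 = (a * (norm x)\<^sup>2 + ((norm x)\<^sup>2 * (norm y)\<^sup>2 - (x \<bullet> y)\<^sup>2)) / (a * (a + (norm y)\<^sup>2))"
proof -
  define R where "R = (norm y)\<^sup>2"
  have R: "R \<ge> 0" "a + R > 0" using assms by (simp_all add: R_def add_pos_nonneg)
  have s: "1 + (- 1 / (a + R)) * R = a / (a + R)" using R by (simp add: field_simps)
  define c where "c = - 1 / (a + R)"
  have c: "1 + c * (norm y)\<^sup>2 = a / (a + R)" using s by (simp add: c_def R_def)
  have "1 + c * (norm y)\<^sup>2 > 0" using R assms by (simp add: c)
  then obtain T where T': "linear T" "\<And>x. (norm (T x))\<^sup>2 = (norm x)\<^sup>2 + c * (x \<bullet> y)\<^sup>2"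
    "\<And>x z. T x \<bullet> z = x \<bullet> T z" "det (matrix T) = sqrt (1 + c * (norm y)\<^sup>2)"
    "T y = sqrt (1 + c * (norm y)\<^sup>2) *\<^sub>R y"
    using rank_one_map[of c y] by blast
  note T = T'[unfolded c, unfolded c_def]
  define S where "S x = (1 / sqrt a) *\<^sub>R T x" for x
  have lS: "linear S" unfolding S_def using T(1) by (intro linear_compose_scale_right)
  have nS: "(norm (S x))\<^sup>2 = (norm (T x))\<^sup>2 / a" for x
    using assms by (simp add: S_def power_divide)
  have "matrix S = (1 / sqrt a) *\<^sub>R matrix T"
    by (simp add: S_def[abs_def] matrix_def vec_eq_iff)
  then have "det (matrix S) = (1 / sqrt a) ^ 3 * det (matrix T)"
    by (simp only: det_scale3)
  also have "\<dots> = 1 / (a * sqrt (a + R))"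
  proof -
    have "(1 / k) ^ 3 * (k / m) = 1 / ((k * k) * m)" if "k > 0" for k m :: real
      using that by (simp add: power3_eq_cube)
    from this[of "sqrt a" "sqrt (a + R)"] show ?thesis
      using assms T(4) by (simp add: real_sqrt_divide)
  qed
  finally have d: "\<bar>det (matrix S)\<bar> = 1 / (a * sqrt (a + R))" using assms R by simp
  have q: "a * (norm (S \<eta>))\<^sup>2 + (y \<bullet> S \<eta>)\<^sup>2 = (norm \<eta>)\<^sup>2" for \<eta>
  proof -
    have "(y \<bullet> S \<eta>)\<^sup>2 = (y \<bullet> T \<eta>)\<^sup>2 / a" using assms by (simp add: S_def power_divide)
    also have "y \<bullet> T \<eta> = T y \<bullet> \<eta>" using T(3) by simp
    also have "(\<dots>)\<^sup>2 = a / (a + R) * (y \<bullet> \<eta>)\<^sup>2"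
      using T(5) R assms by (simp add: power_mult_distrib)
    finally have "(y \<bullet> S \<eta>)\<^sup>2 = (y \<bullet> \<eta>)\<^sup>2 / (a + R)" using assms by simp
    moreover have "a * (norm (S \<eta>))\<^sup>2 = (norm \<eta>)\<^sup>2 - (y \<bullet> \<eta>)\<^sup>2 / (a + R)"
      using assms by (simp add: nS T(2) inner_commute)
    ultimately show ?thesis by simp
  qed
  have x: "x \<bullet> S \<eta> = S x \<bullet> \<eta>" for x \<eta>
    by (simp add: S_def T(3))
  have n: "(norm (S x))\<^sup>2 = (a * (norm x)\<^sup>2 + ((norm x)\<^sup>2 * R - (x \<bullet> y)\<^sup>2)) / (a * (a + R))" for x
  proof -
    have eq: "(X - Y / (a + R)) / a = ((a + R) * X - Y) / (a * (a + R))" for X Y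
    proof -
      have "((a + R) * X - Y) / (a * (a + R)) = ((a + R) * X) / (a * (a + R)) - Y / (a * (a + R))"
        by (rule diff_divide_distrib)
      then show ?thesis using assms R by (simp add: diff_divide_distrib mult.commute)
    qed
    show ?thesis using eq[of "(norm x)\<^sup>2" "(x \<bullet> y)\<^sup>2"]
      by (simp add: nS T(2) algebra_simps)
  qed
  show ?thesis using that lS d q x n by (simp add: R_def)
qed

text \<open>Substituting \<open>\<xi> = S \<eta>\<close> turns \<open>x \<bullet> \<xi>\<close> into
  \<open>c * (e \<bullet> \<eta>)\<close> with \<open>c = norm (S x)\<close> and a unit vector
  \<open>e\<close>. The logarithm splits, and the part with \<open>e\<close> is the constant
  \<open>ball_ln\<close> by rotation invariance. So \<open>x\<close> enters only through
  \<open>ln c\<close>, that is, through the distance of \<open>y\<close> from the line spanned by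
  \<open>x\<close>.\<close>

lemma ellipsoid_ln:
  fixes x y :: "real^3"
  assumes a: "a > 0" and x: "norm x = 1"
  defines "E \<equiv> {\<xi>. a * (norm \<xi>)\<^sup>2 + (y \<bullet> \<xi>)\<^sup>2 \<le> 1}"
  shows "(\<integral>\<xi>. indicator E \<xi> * ln \<bar>x \<bullet> \<xi>\<bar> \<partial>lborel) =
     1 / (a * sqrt (a + (norm y)\<^sup>2)) * (ball_ln + ball_vol *
       ((ln (a + ((norm y)\<^sup>2 - (x \<bullet> y)\<^sup>2)) - ln (a + (norm y)\<^sup>2) - ln a) / 2))"
    and "measure lborel E = 1 / (a * sqrt (a + (norm y)\<^sup>2)) * ball_vol"
proof -
  obtain S where S: "linear S" "\<bar>det (matrix S)\<bar> = 1 / (a * sqrt (a + (norm y)\<^sup>2))"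
    "\<And>\<eta>. a * (norm (S \<eta>))\<^sup>2 + (y \<bullet> S \<eta>)\<^sup>2 = (norm \<eta>)\<^sup>2"
    "\<And>x \<eta>. x \<bullet> S \<eta> = S x \<bullet> \<eta>"
    "\<And>x. (norm (S x))\<^sup>2 = (a * (norm x)\<^sup>2 + ((norm x)\<^sup>2 * (norm y)\<^sup>2 - (x \<bullet> y)\<^sup>2)) / (a * (a + (norm y)\<^sup>2))"
    using ellipsoid_map[OF a, of y] by blast
  have E[measurable]: "E \<in> sets borel" unfolding E_def by measurable
  have aR: "a + (norm y)\<^sup>2 > 0" using a by (simp add: add_pos_nonneg)
  have d: "det (matrix S) \<noteq> 0" using S(2) a aR by auto
  have cs: "(x \<bullet> y)\<^sup>2 \<le> (norm y)\<^sup>2"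
    using Cauchy_Schwarz_ineq[of x y] x by (simp flip: power2_norm_eq_inner)
  define c where "c = norm (S x)"
  have c2: "c\<^sup>2 = (a + ((norm y)\<^sup>2 - (x \<bullet> y)\<^sup>2)) / (a * (a + (norm y)\<^sup>2))"
    using S(5)[of x] x by (simp add: c_def)
  have c2pos: "c\<^sup>2 > 0" unfolding c2 using a aR cs by (intro divide_pos_pos mult_pos_pos) linarith+
  then have c: "c > 0" by (simp add: c_def)
  define e where "e = (1 / c) *\<^sub>R S x"
  have e: "norm e = 1" "S x = c *\<^sub>R e" using c by (simp_all add: e_def c_def)
  have ind: "indicator E (S \<eta>) = (indicator (cball 0 1) \<eta> :: real)" for \<eta>
    using S(3)[of \<eta>] by (simp add: E_def indicator_def power2_le_iff_abs_le abs_square_le_1)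
  have lnc: "ln c = (ln (a + ((norm y)\<^sup>2 - (x \<bullet> y)\<^sup>2)) - ln (a + (norm y)\<^sup>2) - ln a) / 2"
  proof -
    have p: "a + ((norm y)\<^sup>2 - (x \<bullet> y)\<^sup>2) > 0" "a + (norm y)\<^sup>2 > 0" using a cs aR by auto
    have "2 * ln c = ln (c\<^sup>2)" using c by (simp add: ln_realpow)
    then show ?thesis unfolding c2 using p a by (simp add: ln_div ln_mult)
  qed
  have "(\<integral>\<xi>. indicator E \<xi> * ln \<bar>x \<bullet> \<xi>\<bar> \<partial>lborel) =
     \<bar>det (matrix S)\<bar> * (\<integral>\<eta>. indicator (cball 0 1) \<eta> * ln \<bar>c * (e \<bullet> \<eta>)\<bar> \<partial>lborel)"
    by (subst integral_lborel_linear_iso[OF S(1) d], measurable) (simp add: ind S(4) e(2))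
  also have "(\<integral>\<eta>. indicator (cball 0 1) \<eta> * ln \<bar>c * (e \<bullet> \<eta>)\<bar> \<partial>lborel) =
     (\<integral>\<eta>. indicator (cball 0 1) \<eta> * ln \<bar>e \<bullet> \<eta>\<bar> + ln c * indicator (cball 0 1) \<eta> \<partial>lborel)"
  proof (rule integral_cong_AE)
    \<comment> \<open>Since \<open>ln 0 = 0\<close>, the logarithm of the product splits only off
      the hyperplane orthogonal to \<open>e\<close>, a null set.\<close>
    have "e \<noteq> 0" using e by auto
    from AE_inner_nonzero[OF this]
    show "AE \<eta> in lborel. indicator (cball 0 1) \<eta> * ln \<bar>c * (e \<bullet> \<eta>)\<bar> =
       indicator (cball 0 1) \<eta> * ln \<bar>e \<bullet> \<eta>\<bar> + ln c * indicator (cball 0 1) \<eta>"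
      by eventually_elim (use c in \<open>simp add: abs_mult ln_mult algebra_simps\<close>)
  qed measurable
  also have "\<dots> = ball_ln + ln c * ball_vol"
    using radial_ridge[OF e(1), of "\<lambda>t. ln \<bar>t\<bar>" 1] integrable_ln_fst[of 1]
    by (subst Bochner_Integration.integral_add)
       (auto simp: ball_ln_def emeasure_lborel_cball_finite)
  finally show "(\<integral>\<xi>. indicator E \<xi> * ln \<bar>x \<bullet> \<xi>\<bar> \<partial>lborel) =
     1 / (a * sqrt (a + (norm y)\<^sup>2)) * (ball_ln + ball_vol *
       ((ln (a + ((norm y)\<^sup>2 - (x \<bullet> y)\<^sup>2)) - ln (a + (norm y)\<^sup>2) - ln a) / 2))"
    unfolding S(2) lnc by (simp add: mult.commute)
  have "(\<integral>\<xi>. indicator E \<xi> \<partial>lborel) = \<bar>det (matrix S)\<bar> * (\<integral>\<eta>. indicator (cball 0 1) (\<eta> :: real^3) \<partial>lborel)"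
    by (subst integral_lborel_linear_iso[OF S(1) d], measurable) (simp add: ind)
  then show "measure lborel E = 1 / (a * sqrt (a + (norm y)\<^sup>2)) * ball_vol"
    by (simp add: S(2))
qed

subsection \<open>Functions approximable by logarithms of generated gauges\<close>

text \<open>Logarithms linearise the class: the multiplicative sum becomes a midpoint and a dilation
  an additive constant. Gauges are homogeneous, so only values on the sphere count.\<close>

definition approximable :: "('a::euclidean_space \<Rightarrow> real) \<Rightarrow> bool" where
  "approximable u \<longleftrightarrow> (\<forall>\<eta>>0. \<exists>K\<in>generated_from_ball. \<forall>x\<in>sphere 0 1.
     \<bar>ln (minkowski_functional K x) - u x\<bar> \<le> \<eta>)"

lemma approximableE:
  assumes "approximable u" "\<eta> > 0"
  obtains K where "K \<in> generated_from_ball"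
    "\<And>x. norm x = 1 \<Longrightarrow> \<bar>ln (minkowski_functional K x) - u x\<bar> \<le> \<eta>"
  using assms unfolding approximable_def by fastforce

lemma minkowski_functional_linear_image:
  assumes "linear f" "inj f"
  shows "minkowski_functional (f ` K) (f x) = minkowski_functional K x"
proof -
  have "f x \<in> (\<lambda>y. a *\<^sub>R y) ` f ` K \<longleftrightarrow> x \<in> (\<lambda>y. a *\<^sub>R y) ` K" for a
    using assms by (auto simp: image_iff linear_scale[symmetric] inj_eq)
  then show ?thesis by (simp add: minkowski_functional_def)
qed

lemma minkowski_functional_cball: "minkowski_functional (cball 0 1) (x :: 'a::euclidean_space) = norm x"
proof -
  have "cball (0::'a) 1 = {x. norm x \<le> 1}" by auto
  then show ?thesis
    using unit_ball_of_functional(2)[of "norm :: 'a \<Rightarrow> real"] by (simp add: continuous_on_norm_id)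
qed

lemma approximable_ln_norm:
  fixes T :: "'a::euclidean_space \<Rightarrow> 'a"
  assumes T: "linear T" "inj T"
  shows "approximable (\<lambda>x. ln (norm (T x)))"
proof -
  obtain g where g: "linear g" "\<And>x. g (T x) = x" "\<And>x. T (g x) = x"
  proof -
    obtain g where g: "linear g" "g \<circ> T = id"
      using linear_injective_left_inverse[OF T] by blast
    have "g (T x) = x" for x using g(2) by (metis comp_apply id_apply)
    moreover have "surj T" using linear_injective_imp_surjective[OF T] by simp
    ultimately show ?thesis using that g(1) by (metis surjD)
  qed
  have "bij g" using g by (metis bijI')
  have "minkowski_functional (g ` cball 0 1) x = norm (T x)" for x
    using minkowski_functional_linear_image[OF g(1) bij_is_inj[OF \<open>bij g\<close>], of "cball 0 1" "T x"]
    by (simp add: g minkowski_functional_cball)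
  moreover have "g ` cball 0 1 \<in> generated_from_ball"
    by (intro generated_from_ball.ball generated_from_ball.linear_image g \<open>bij g\<close>)
  ultimately show ?thesis
    unfolding approximable_def by (auto intro!: bexI[of _ "g ` cball 0 1"])
qed

lemma approximable_add_const:
  assumes u: "approximable u" shows "approximable (\<lambda>x. u x + c)"
  unfolding approximable_def
proof (intro allI impI)
  fix \<eta> :: real assume "\<eta> > 0"
  then obtain K where K: "K \<in> generated_from_ball"
    "\<And>x. norm x = 1 \<Longrightarrow> \<bar>ln (minkowski_functional K x) - u x\<bar> \<le> \<eta>"
    using approximableE[OF u] by metis
  \<comment> \<open>Shrinking the set by \<open>exp (- c)\<close> multiplies its gauge by
    \<open>exp c\<close>.\<close>
  define f :: "'a \<Rightarrow> 'a" where "f x = exp (- c) *\<^sub>R x" for x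
  have f: "linear f" "inj f" "bij f"
    by (auto simp: f_def[abs_def] inj_on_def linear_scaleR
        intro!: bijI'[of "\<lambda>x. exp (- c) *\<^sub>R x"] exI[of _ "exp c *\<^sub>R (_ :: 'a)"] simp flip: exp_add)
  have "\<bar>ln (minkowski_functional (f ` K) x) - (u x + c)\<bar> \<le> \<eta>" if x: "norm x = 1" for x
  proof -
    have "x \<noteq> 0" using x by auto
    have "f (exp c *\<^sub>R x) = x" by (simp add: f_def flip: exp_add)
    then have "minkowski_functional (f ` K) x = minkowski_functional K (exp c *\<^sub>R x)"
      using minkowski_functional_linear_image[OF f(1,2)] by metis
    also have "\<dots> = exp c * minkowski_functional K x"
      using minkowski_functional_scaleR[OF generated_from_ball_imp_star_body[OF K(1)]] by simp
    finally have "ln (minkowski_functional (f ` K) x) = c + ln (minkowski_functional K x)"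
      using minkowski_functional_pos[OF generated_from_ball_imp_star_body[OF K(1)] \<open>x \<noteq> 0\<close>]
      by (simp add: ln_mult)
    then show ?thesis using K(2)[OF x] by simp
  qed
  moreover have "f ` K \<in> generated_from_ball" by (intro generated_from_ball.linear_image K f)
  ultimately show "\<exists>K\<in>generated_from_ball. \<forall>x\<in>sphere 0 1. \<bar>ln (minkowski_functional K x) - (u x + c)\<bar> \<le> \<eta>"
    by (intro bexI[of _ "f ` K"] ballI) simp_all
qed

lemma approximable_midpoint:
  assumes u: "approximable u" and v: "approximable v"
  shows "approximable (\<lambda>x. (u x + v x) / 2)"
  unfolding approximable_def
proof (intro allI impI)
  fix \<eta> :: real assume \<eta>: "\<eta> > 0"
  obtain K where K: "K \<in> generated_from_ball"
    "\<And>x. norm x = 1 \<Longrightarrow> \<bar>ln (minkowski_functional K x) - u x\<bar> \<le> \<eta>"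
    using approximableE[OF u \<eta>] by metis
  obtain L where L: "L \<in> generated_from_ball"
    "\<And>x. norm x = 1 \<Longrightarrow> \<bar>ln (minkowski_functional L x) - v x\<bar> \<le> \<eta>"
    using approximableE[OF v \<eta>] by metis
  note sK = generated_from_ball_imp_star_body[OF K(1)] and sL = generated_from_ball_imp_star_body[OF L(1)]
  have mid: "\<bar>(a + b) / 2 - (p + q) / 2\<bar> \<le> \<eta>" if "\<bar>a - p\<bar> \<le> \<eta>" "\<bar>b - q\<bar> \<le> \<eta>"
    for a b p q :: real
    using that by (simp add: abs_le_iff field_simps)
  have "\<bar>ln (minkowski_functional (mult_sum K L) x) - (u x + v x) / 2\<bar> \<le> \<eta>" if x: "norm x = 1" for x
  proof -
    have "x \<noteq> 0" using x by auto
    note pos = minkowski_functional_pos[OF sK this] minkowski_functional_pos[OF sL this]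
    have "ln (minkowski_functional (mult_sum K L) x) =
      (ln (minkowski_functional K x) + ln (minkowski_functional L x)) / 2"
      using pos by (simp add: minkowski_functional_mult_sum[OF sK sL] ln_sqrt ln_mult)
    then show ?thesis using mid[OF K(2)[OF x] L(2)[OF x]] by presburger
  qed
  moreover have "mult_sum K L \<in> generated_from_ball" by (intro generated_from_ball.mult_sum K L)
  ultimately show "\<exists>K\<in>generated_from_ball. \<forall>x\<in>sphere 0 1. \<bar>ln (minkowski_functional K x) - (u x + v x) / 2\<bar> \<le> \<eta>"
    by (intro bexI[of _ "mult_sum K L"] ballI) simp_all
qed

lemma approximable_limit:
  assumes "\<And>\<eta>. \<eta> > 0 \<Longrightarrow> \<exists>v. approximable v \<and> (\<forall>x. norm x = 1 \<longrightarrow> \<bar>v x - u x\<bar> \<le> \<eta>)"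
  shows "approximable u"
  unfolding approximable_def
proof (intro allI impI)
  fix \<eta> :: real assume "\<eta> > 0"
  then have \<eta>: "\<eta> / 2 > 0" by simp
  then obtain v where v: "approximable v" "\<And>x. norm x = 1 \<Longrightarrow> \<bar>v x - u x\<bar> \<le> \<eta> / 2"
    using assms by blast
  obtain K where K: "K \<in> generated_from_ball"
    "\<And>x. norm x = 1 \<Longrightarrow> \<bar>ln (minkowski_functional K x) - v x\<bar> \<le> \<eta> / 2"
    using approximableE[OF v(1) \<eta>] by metis
  have "\<bar>ln (minkowski_functional K x) - u x\<bar> \<le> \<eta>" if "norm x = 1" for x
    using v(2)[OF that] K(2)[OF that] by linarith
  then show "\<exists>K\<in>generated_from_ball. \<forall>x\<in>sphere 0 1. \<bar>ln (minkowski_functional K x) - u x\<bar> \<le> \<eta>"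
    using K(1) by (intro bexI[of _ K] ballI) simp_all
qed

lemma approximable_cong:
  assumes "approximable u" "\<And>x. norm x = 1 \<Longrightarrow> v x = u x"
  shows "approximable v"
  using assms by (intro approximable_limit) (auto intro!: exI[of _ u])

lemma approximable_zero: "approximable (\<lambda>x :: 'a::euclidean_space. 0)"
  by (rule approximable_cong[OF approximable_ln_norm[of "\<lambda>x. x"]]) (auto intro: linear_ident)

text \<open>Log gauges are continuous on the compact sphere. The bound controls the effect of
  perturbing a coefficient in \<open>approximable_convex\<close>.\<close>

lemma approximable_bounded:
  assumes "approximable u"
  obtains B where "\<And>x. norm x = 1 \<Longrightarrow> \<bar>u x\<bar> \<le> B"
proof -
  obtain K where K: "K \<in> generated_from_ball"
    "\<And>x. norm x = 1 \<Longrightarrow> \<bar>ln (minkowski_functional K x) - u x\<bar> \<le> 1"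
    using approximableE[OF assms, of 1] by auto
  note sK = generated_from_ball_imp_star_body[OF K(1)]
  have "continuous_on (sphere 0 1) (\<lambda>x. ln (minkowski_functional K x))"
  proof (intro continuous_on_ln continuous_on_subset[OF continuous_on_minkowski_functional[OF sK]] ballI)
    fix x :: 'a assume "x \<in> sphere 0 1"
    then have "x \<noteq> 0" by auto
    then show "minkowski_functional K x \<noteq> 0" using minkowski_functional_pos[OF sK] by force
  qed simp
  then have "compact ((\<lambda>x. ln (minkowski_functional K x)) ` sphere 0 1)"
    by (intro compact_continuous_image) auto
  then obtain B where B: "\<And>x. norm x = 1 \<Longrightarrow> \<bar>ln (minkowski_functional K x)\<bar> \<le> B"
    using compact_imp_bounded by (fastforce simp: bounded_iff)
  have "\<bar>u x\<bar> \<le> B + 1" if "norm x = 1" for x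
    using B[OF that] K(2)[OF that] by linarith
  then show ?thesis using that by blast
qed

text \<open>Midpoints produce all dyadic coefficients, one binary digit at a time:
  \<open>k / 2 ^ (n + 1)\<close> is half of \<open>k / 2 ^ n\<close> in the lower half of the range
  (midpoint with \<open>v\<close>), and half of \<open>1 + (k - 2 ^ n) / 2 ^ n\<close> in the upper
  half (midpoint with \<open>u\<close>).\<close>

lemma approximable_dyadic:
  assumes u: "approximable u" and v: "approximable v" and "k \<le> 2 ^ n"
  shows "approximable (\<lambda>x. real k / 2 ^ n * u x + (1 - real k / 2 ^ n) * v x)"
  using assms(3)
proof (induction n arbitrary: k)
  case 0
  then have "k = 0 \<or> k = 1" by auto
  then show ?case using u v by auto
next
  case (Suc n)
  show ?case
  proof (cases "k \<le> 2 ^ n")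
    case True
    from approximable_midpoint[OF Suc.IH[OF True] v] show ?thesis
      by (rule approximable_cong) (simp add: field_simps)
  next
    case False
    then have "k - 2 ^ n \<le> 2 ^ n" using Suc.prems by simp
    have "real (k - 2 ^ n) / 2 ^ n = real k / 2 ^ n - 1"
      using False by (simp add: of_nat_diff diff_divide_distrib)
    from approximable_midpoint[OF Suc.IH[OF \<open>k - 2 ^ n \<le> 2 ^ n\<close>, unfolded this] u] show ?thesis
      by (rule approximable_cong) (simp add: field_simps)
  qed
qed

lemma approximable_convex:
  assumes u: "approximable u" and v: "approximable v" and t: "0 \<le> t" "t \<le> 1"
  shows "approximable (\<lambda>x. t * u x + (1 - t) * v x)"
proof (rule approximable_limit)
  fix \<eta> :: real assume \<eta>: "\<eta> > 0"
  obtain A where A: "\<And>x. norm x = 1 \<Longrightarrow> \<bar>u x\<bar> \<le> A" using approximable_bounded[OF u] by metis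
  obtain B where B: "\<And>x. norm x = 1 \<Longrightarrow> \<bar>v x\<bar> \<le> B" using approximable_bounded[OF v] by metis
  define C where "C = max (A + B) 1"
  obtain n where n: "C / \<eta> < 2 ^ n" using real_arch_pow[of 2 "C / \<eta>"] by auto
  \<comment> \<open>Round \<open>t\<close> down to the dyadic number \<open>s = k / 2 ^ n\<close>.
    The rounding error gets multiplied by \<open>u x - v x\<close>, which \<open>C\<close> bounds on
    the sphere.\<close>
  define k where "k = nat \<lfloor>t * 2 ^ n\<rfloor>"
  have k: "real k \<le> t * 2 ^ n" "t * 2 ^ n \<le> real k + 1"
    using t by (simp_all add: k_def)
  have "real k \<le> 1 * 2 ^ n" using k(1) t by (meson mult_right_mono order_trans zero_le_numeral zero_le_power)
  then have "k \<le> 2 ^ n" by (metis mult_1 numeral_power_le_of_nat_cancel_iff of_nat_le_iff of_nat_numeral of_nat_power)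
  define s where "s = real k / 2 ^ n"
  have s: "\<bar>t - s\<bar> \<le> 1 / 2 ^ n"
  proof -
    have "t * 2 ^ n - real k = (t - s) * 2 ^ n" by (simp add: s_def left_diff_distrib)
    then have "0 \<le> (t - s) * 2 ^ n" "(t - s) * 2 ^ n \<le> 1" using k by linarith+
    then have "\<bar>t - s\<bar> * 2 ^ n \<le> 1" by (metis abs_mult abs_numeral abs_of_nonneg power_abs)
    then show ?thesis by (simp add: pos_le_divide_eq)
  qed
  have "approximable (\<lambda>x. s * u x + (1 - s) * v x)"
    using approximable_dyadic[OF u v \<open>k \<le> 2 ^ n\<close>] by (simp add: s_def)
  moreover have "\<bar>s * u x + (1 - s) * v x - (t * u x + (1 - t) * v x)\<bar> \<le> \<eta>" if x: "norm x = 1" for x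
  proof -
    have "s * u x + (1 - s) * v x - (t * u x + (1 - t) * v x) = (s - t) * (u x - v x)"
      by (simp add: algebra_simps)
    also have "\<bar>\<dots>\<bar> \<le> 1 / 2 ^ n * C"
      unfolding abs_mult using s A[OF x] B[OF x] by (intro mult_mono) (auto simp: C_def)
    also have "\<dots> \<le> \<eta>" using n \<eta> by (simp add: field_simps)
    finally show ?thesis .
  qed
  ultimately show "\<exists>w. approximable w \<and> (\<forall>x. norm x = 1 \<longrightarrow> \<bar>w x - (t * u x + (1 - t) * v x)\<bar> \<le> \<eta>)"
    by blast
qed

text \<open>The total may fall short of 1 because the missing mass goes to the zero function, the
  logarithm of the Euclidean norm on the sphere. Peeling off \<open>c j\<close> and dividing the
  other coefficients by \<open>1 - c j\<close> keeps their total at most 1.\<close>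

lemma approximable_sum:
  assumes "finite I" "\<And>i. i \<in> I \<Longrightarrow> 0 \<le> c i" "\<And>i. i \<in> I \<Longrightarrow> approximable (u i)" "sum c I \<le> 1"
  shows "approximable (\<lambda>x. \<Sum>i\<in>I. c i * u i x)"
  using assms
proof (induction I arbitrary: c rule: finite_induct)
  case empty
  then show ?case by (simp add: approximable_zero)
next
  case (insert j I)
  have j: "0 \<le> c j" "c j \<le> 1" "sum c I \<ge> 0"
    using insert sum_nonneg[of I c] by auto
  show ?case
  proof (cases "c j = 1")
    case True
    then have "sum c I = 0" using insert j by simp
    then have "\<And>i. i \<in> I \<Longrightarrow> c i = 0" using insert by (simp add: sum_nonneg_eq_0_iff)
    then show ?thesis using insert True by simp
  next
    case False
    define d where "d i = c i / (1 - c j)" for i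
    have "sum d I \<le> 1" using insert j False by (simp add: d_def sum_divide_distrib[symmetric])
    then have "approximable (\<lambda>x. \<Sum>i\<in>I. d i * u i x)"
      using insert j False by (intro insert.IH) (auto simp: d_def)
    from approximable_convex[OF insert.prems(2)[of j] this j(1,2)]
    have "approximable (\<lambda>x. c j * u j x + (1 - c j) * (\<Sum>i\<in>I. d i * u i x))" by simp
    moreover have "(1 - c j) * (\<Sum>i\<in>I. d i * u i x) = (\<Sum>i\<in>I. c i * u i x)" for x
      using False by (simp add: sum_distrib_left d_def)
    ultimately show ?thesis using insert by simp
  qed
qed

text \<open>An error \<open>s\<close> in the logarithm is a factor \<open>exp s\<close> between
  radial functions. As the radial function of \<open>K\<close> is bounded on the sphere, uniform
  approximation of logarithms gives convergence in the radial metric.\<close>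

lemma generated_of_approximable:
  fixes K :: "'a::euclidean_space set"
  assumes K: "symmetric_star_body K" and appr: "approximable (\<lambda>x. ln (minkowski_functional K x))"
  shows "K \<in> generated_from_ball"
proof -
  have "\<forall>i. \<exists>L\<in>generated_from_ball. \<forall>x\<in>sphere 0 1.
     \<bar>ln (minkowski_functional L x) - ln (minkowski_functional K x)\<bar> \<le> inverse (real (Suc i))"
    using appr unfolding approximable_def by simp
  then obtain L where L: "\<And>i. L i \<in> generated_from_ball"
    "\<And>i x. norm x = 1 \<Longrightarrow> \<bar>ln (minkowski_functional (L i) x) - ln (minkowski_functional K x)\<bar> \<le> inverse (real (Suc i))"
    by (metis mem_sphere_0)
  have "compact (radial_function K ` sphere 0 1)"
    using K by (intro compact_continuous_image) (auto simp: symmetric_star_body_def)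
  then obtain B where B: "\<And>x. norm x = 1 \<Longrightarrow> \<bar>radial_function K x\<bar> \<le> B"
    using compact_imp_bounded by (fastforce simp: bounded_iff)
  define r where "r i = B * (exp (inverse (real (Suc i))) - 1)" for i
  have le: "\<bar>radial_function (L i) x - radial_function K x\<bar> \<le> r i" if x: "norm x = 1" for i x
  proof -
    have "x \<noteq> 0" using x by auto
    note pos = minkowski_functional_pos[OF K this]
      minkowski_functional_pos[OF generated_from_ball_imp_star_body[OF L(1)] this, of i]
    define s where "s = ln (minkowski_functional K x) - ln (minkowski_functional (L i) x)"
    have "\<bar>s\<bar> \<le> inverse (real (Suc i))" using L(2)[OF x, of i] by (simp add: s_def)
    have "radial_function (L i) x = radial_function K x * exp s"
      using pos by (simp add: radial_function_def s_def exp_diff field_simps)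
    then have "radial_function (L i) x - radial_function K x = radial_function K x * (exp s - 1)"
      by (simp add: algebra_simps)
    also have "\<bar>\<dots>\<bar> \<le> B * (exp \<bar>s\<bar> - 1)"
      unfolding abs_mult
    proof (rule mult_mono)
      show "\<bar>exp s - 1\<bar> \<le> exp \<bar>s\<bar> - 1"
      proof (cases "s \<ge> 0")
        case False
        have "2 \<le> exp s + exp (- s)"
          using exp_ge_add_one_self[of s] exp_ge_add_one_self[of "- s"] by linarith
        then show ?thesis using False by simp
      qed simp
    qed (use B[OF x] in auto)
    also have "\<dots> \<le> r i"
      unfolding r_def using \<open>\<bar>s\<bar> \<le> _\<close> B[OF x] by (intro mult_left_mono) auto
    finally show ?thesis .
  qed
  obtain e :: 'a where e: "norm e = 1" using vector_choose_size[of 1] by auto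
  have "radial_dist (L i) K \<le> r i" for i
    unfolding radial_dist_def using le e by (intro cSUP_least) auto
  moreover have "0 \<le> radial_dist (L i) K" for i
  proof -
    have "\<bar>radial_function (L i) e - radial_function K e\<bar> \<le> radial_dist (L i) K"
      unfolding radial_dist_def using le e
      by (intro cSUP_upper2[of _ _ e] bdd_aboveI2[of _ _ "r i"]) auto
    then show ?thesis by linarith
  qed
  moreover have "r \<longlonglongrightarrow> B * (exp 0 - 1)"
    unfolding r_def by (intro tendsto_intros LIMSEQ_inverse_real_of_nat)
  then have "r \<longlonglongrightarrow> 0" by simp
  ultimately have "(\<lambda>i. radial_dist (L i) K) \<longlonglongrightarrow> 0"
    by (rule_tac tendsto_sandwich[of "\<lambda>_. 0" _ sequentially r]) auto
  with L(1) K show ?thesis by (rule generated_from_ball.limit[of L])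
qed

subsection \<open>Volumes of slabs\<close>

text \<open>A Riemann sum with \<open>w\<close> absorbed into the coefficients. On cells of small
  diameter \<open>\<phi> x\<close> is nearly constant, uniformly in \<open>x\<close> because the
  sphere times the ball is compact; the masses of the cells are the coefficients for
  \<open>approximable_sum\<close>.\<close>

lemma approximable_integral:
  fixes \<phi> :: "'a::euclidean_space \<Rightarrow> 'b::euclidean_space \<Rightarrow> real" and w :: "'b \<Rightarrow> real"
  assumes cont: "continuous_on (sphere 0 1 \<times> UNIV) (\<lambda>z. \<phi> (fst z) (snd z))"
    and appr: "\<And>\<xi>. approximable (\<lambda>x. \<phi> x \<xi>)"
    and w: "integrable lborel w" "\<And>\<xi>. 0 \<le> w \<xi>" "\<And>\<xi>. norm \<xi> > M \<Longrightarrow> w \<xi> = 0"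
      "integral\<^sup>L lborel w \<le> 1"
  shows "approximable (\<lambda>x. \<integral>\<xi>. w \<xi> * \<phi> x \<xi> \<partial>lborel)"
proof (rule approximable_limit)
  fix \<eta> :: real assume \<eta>: "\<eta> > 0"
  let ?f = "\<lambda>z. \<phi> (fst z) (snd z)"
  have "uniformly_continuous_on (sphere 0 1 \<times> cball 0 M) ?f"
    by (rule compact_uniformly_continuous[OF continuous_on_subset[OF cont]])
       (auto intro: compact_Times)
  then obtain d where d: "d > 0" "\<And>z z'. z \<in> sphere 0 1 \<times> cball 0 M \<Longrightarrow> z' \<in> sphere 0 1 \<times> cball 0 M \<Longrightarrow>
      dist z' z < d \<Longrightarrow> dist (?f z') (?f z) < \<eta>"
    using \<eta> unfolding uniformly_continuous_on_def by metis
  have close: "\<bar>\<phi> x q - \<phi> x \<xi>\<bar> \<le> \<eta>"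
    if "norm x = 1" "norm q \<le> M" "norm \<xi> \<le> M" "dist q \<xi> < d" for x q \<xi>
    using d(2)[of "(x, \<xi>)" "(x, q)"] that by (simp add: dist_Pair_Pair dist_real_def)
  obtain P where P: "P \<subseteq> cball (0::'b) M" "finite P" "cball 0 M \<subseteq> (\<Union>q\<in>P. ball q d)"
  proof -
    have "open (ball q d)" for q :: 'b by simp
    moreover have "cball 0 M \<subseteq> (\<Union>q\<in>cball (0::'b) M. ball q d)" using d(1) by (auto intro!: bexI)
    ultimately obtain P where "P \<subseteq> cball (0::'b) M" "finite P" "cball 0 M \<subseteq> (\<Union>q\<in>P. ball q d)"
      by (rule compactE_image[OF compact_cball])
    then show ?thesis by (rule that)
  qed
  obtain n :: nat and f where f: "P = f ` {i. i < n}"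
    using finite_imp_nat_seg_image_inj_on[OF P(2)] by blast
  \<comment> \<open>Deleting the earlier balls makes the cells disjoint: a point of the large ball
    belongs to the cell of the first ball that contains it.\<close>
  define A where "A i = cball 0 M \<inter> (ball (f i) d - (\<Union>j<i. ball (f j) d))" for i
  have A: "A i \<in> sets borel" for i
    unfolding A_def by (intro sets.Int sets.Diff sets.finite_UN) auto
  have ind: "\<exists>i<n. \<forall>j. indicator (A j) \<xi> = (if j = i then 1 else 0 :: real)" if \<xi>: "norm \<xi> \<le> M" for \<xi>
  proof -
    have ex: "\<exists>i<n. \<xi> \<in> ball (f i) d" proof -
      have "\<xi> \<in> cball 0 M" using \<xi> by simp
      then have "\<xi> \<in> (\<Union>q\<in>P. ball q d)" using P(3) by blast
      then show ?thesis unfolding f by auto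
    qed
    define i where "i = (LEAST i. \<xi> \<in> ball (f i) d)"
    have 1: "\<xi> \<in> ball (f i) d" unfolding i_def by (rule LeastI_ex) (use ex in blast)
    have 2: "\<xi> \<notin> ball (f j) d" if "j < i" for j using not_less_Least[OF that[unfolded i_def]] .
    have "i < n" using ex 2 by (meson linorder_not_less order_le_less_trans)
    moreover have "indicator (A j) \<xi> = (if j = i then 1 else 0 :: real)" for j
      using 1 2 \<xi> by (cases j i rule: linorder_cases) (auto simp: A_def indicator_def)
    ultimately show ?thesis by blast
  qed
  have split: "(\<Sum>i<n. indicator (A i) \<xi> * w \<xi> * h i) = w \<xi> * h i0"
    if "i0 < n" "\<And>j. indicator (A j) \<xi> = (if j = i0 then 1 else 0 :: real)" for \<xi> i0 and h :: "nat \<Rightarrow> real"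
  proof -
    have "(\<Sum>i<n. indicator (A i) \<xi> * w \<xi> * h i) = (\<Sum>i<n. if i = i0 then w \<xi> * h i else 0)"
      by (rule sum.cong) (auto simp: that(2))
    then show ?thesis using that(1) by simp
  qed
  define g where "g i = (\<integral>\<xi>. indicator (A i) \<xi> * w \<xi> \<partial>lborel)" for i
  have gi: "integrable lborel (\<lambda>\<xi>. indicator (A i) \<xi> * w \<xi>)" for i
    using integrable_mult_indicator[OF _ w(1), of "A i"] A by simp
  have g0: "g i \<ge> 0" for i unfolding g_def using w(2) by (intro integral_nonneg_AE) auto
  have "sum g {..<n} = (\<integral>\<xi>. (\<Sum>i<n. indicator (A i) \<xi> * w \<xi>) \<partial>lborel)"
    unfolding g_def by (subst Bochner_Integration.integral_sum) (use gi in auto)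
  also have "(\<lambda>\<xi>. \<Sum>i<n. indicator (A i) \<xi> * w \<xi>) = w"
  proof
    fix \<xi>
    show "(\<Sum>i<n. indicator (A i) \<xi> * w \<xi>) = w \<xi>"
    proof (cases "norm \<xi> \<le> M")
      case True
      then obtain i where "i < n" "\<And>j. indicator (A j) \<xi> = (if j = i then 1 else 0 :: real)" using ind by blast
      from split[OF this, of "\<lambda>_. 1"] show ?thesis by simp
    qed (simp add: w(3))
  qed
  finally have gsum: "sum g {..<n} \<le> 1" using w(4) by simp
  define v where "v x = (\<Sum>i\<in>{..<n}. g i * \<phi> x (f i))" for x
  have "approximable v"
    unfolding v_def by (rule approximable_sum) (use g0 gsum appr in auto)
  moreover have "\<bar>v x - (\<integral>\<xi>. w \<xi> * \<phi> x \<xi> \<partial>lborel)\<bar> \<le> \<eta>" if x: "norm x = 1" for x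
  proof -
    have c: "continuous_on UNIV (\<phi> x)"
    proof -
      have "continuous_on UNIV (\<lambda>\<xi>. ?f (x, \<xi>))"
        by (rule continuous_on_compose2[OF cont]) (use x in \<open>auto intro!: continuous_intros\<close>)
      then show ?thesis by simp
    qed
    then have [measurable]: "\<phi> x \<in> borel_measurable borel" by (rule borel_measurable_continuous_onI)
    have [measurable]: "w \<in> borel_measurable borel" using w(1) by simp
    have "compact (\<phi> x ` cball 0 M)"
      using c by (intro compact_continuous_image) (auto intro: continuous_on_subset)
    then obtain B where B: "\<And>\<xi>. norm \<xi> \<le> M \<Longrightarrow> \<bar>\<phi> x \<xi>\<bar> \<le> B"
      using compact_imp_bounded by (fastforce simp: bounded_iff)
    have i2: "integrable lborel (\<lambda>\<xi>. w \<xi> * \<phi> x \<xi>)"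
    proof (rule Bochner_Integration.integrable_bound)
      show "integrable lborel (\<lambda>\<xi>. B * w \<xi>)" using w(1) by simp
      show "AE \<xi> in lborel. norm (w \<xi> * \<phi> x \<xi>) \<le> norm (B * w \<xi>)"
      proof (rule AE_I2)
        fix \<xi>
        show "norm (w \<xi> * \<phi> x \<xi>) \<le> norm (B * w \<xi>)"
        proof (cases "norm \<xi> \<le> M")
          case True
          then have "\<bar>\<phi> x \<xi>\<bar> \<le> \<bar>B\<bar>" using B[OF True] by linarith
          then show ?thesis using w(2)[of \<xi>]
            by (simp add: abs_mult mult.commute[of "w \<xi>"] mult_right_mono)
        qed (simp add: w(3))
      qed
    qed simp
    have i1: "integrable lborel (\<lambda>\<xi>. \<Sum>i<n. indicator (A i) \<xi> * w \<xi> * \<phi> x (f i))"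
      by (intro Bochner_Integration.integrable_sum integrable_mult_left gi)
    have "v x = (\<integral>\<xi>. (\<Sum>i<n. indicator (A i) \<xi> * w \<xi> * \<phi> x (f i)) \<partial>lborel)"
      unfolding v_def g_def
      by (subst Bochner_Integration.integral_sum) (use gi in auto)
    then have "v x - (\<integral>\<xi>. w \<xi> * \<phi> x \<xi> \<partial>lborel) =
       (\<integral>\<xi>. (\<Sum>i<n. indicator (A i) \<xi> * w \<xi> * \<phi> x (f i)) - w \<xi> * \<phi> x \<xi> \<partial>lborel)"
      using i1 i2 by simp
    also have "\<bar>\<dots>\<bar> \<le> (\<integral>\<xi>. \<eta> * w \<xi> \<partial>lborel)"
    proof (rule integral_abs_bound[THEN order_trans], rule integral_mono)
      show "integrable lborel (\<lambda>\<xi>. \<bar>(\<Sum>i<n. indicator (A i) \<xi> * w \<xi> * \<phi> x (f i)) - w \<xi> * \<phi> x \<xi>\<bar>)"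
        using i1 i2 by simp
      show "integrable lborel (\<lambda>\<xi>. \<eta> * w \<xi>)" using w(1) by simp
      fix \<xi>
      show "\<bar>(\<Sum>i<n. indicator (A i) \<xi> * w \<xi> * \<phi> x (f i)) - w \<xi> * \<phi> x \<xi>\<bar> \<le> \<eta> * w \<xi>"
      proof (cases "norm \<xi> \<le> M")
        case True
        then obtain i where i: "i < n" "\<And>j. indicator (A j) \<xi> = (if j = i then 1 else 0 :: real)"
          using ind by blast
        have "\<xi> \<in> A i" using i(2)[of i] by (simp add: indicator_def split: if_splits)
        then have "dist (f i) \<xi> < d" by (simp add: A_def)
        moreover have "norm (f i) \<le> M" using P(1) i(1) unfolding f by auto
        ultimately have "\<bar>\<phi> x (f i) - \<phi> x \<xi>\<bar> \<le> \<eta>" using close x True by blast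
        moreover have "(\<Sum>i<n. indicator (A i) \<xi> * w \<xi> * \<phi> x (f i)) - w \<xi> * \<phi> x \<xi> =
            w \<xi> * (\<phi> x (f i) - \<phi> x \<xi>)"
          by (simp only: split[OF i, of "\<lambda>i. \<phi> x (f i)"] right_diff_distrib)
        ultimately show ?thesis using w(2)[of \<xi>]
          by (simp add: abs_mult mult.commute[of "w \<xi>"] mult_right_mono)
      qed (simp add: w(3))
    qed
    also have "\<dots> = \<eta> * integral\<^sup>L lborel w" by simp
    also have "\<dots> \<le> \<eta>" using w(4) \<eta> by simp
    finally show ?thesis .
  qed
  ultimately show "\<exists>v. approximable v \<and> (\<forall>x. norm x = 1 \<longrightarrow> \<bar>v x - (\<integral>\<xi>. w \<xi> * \<phi> x \<xi> \<partial>lborel)\<bar> \<le> \<eta>)"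
    by blast
qed

section \<open>Areas of sections and volumes of slabs\<close>

lemma emeasure_lborel_sections:
  fixes C :: "('a::euclidean_space \<times> 'b::euclidean_space) set"
  assumes "C \<in> sets borel"
  shows "emeasure lborel C = (\<integral>\<^sup>+s. emeasure lborel {y. (s, y) \<in> C} \<partial>lborel)"
    and "(\<lambda>s. emeasure lborel {y. (s, y) \<in> C}) \<in> borel_measurable borel"
proof -
  have C: "C \<in> sets (lborel \<Otimes>\<^sub>M lborel)" by (simp only: lborel_prod sets_lborel assms)
  show "emeasure lborel C = (\<integral>\<^sup>+s. emeasure lborel {y. (s, y) \<in> C} \<partial>lborel)"
    using lborel.emeasure_pair_measure_alt[OF C] by (simp add: lborel_prod vimage_def)
  show "(\<lambda>s. emeasure lborel {y. (s, y) \<in> C}) \<in> borel_measurable borel"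
    using lborel.measurable_emeasure_Pair[OF C] by (simp add: vimage_def)
qed

text \<open>A planar case of the Brunn--Minkowski inequality that needs no optimal pairing: pair the section of \<open>C\<close> at \<open>s\<close> with the one at the mirror point of the base interval.\<close>

lemma area_difference_body:
  fixes C C' :: "(real \<times> real) set"
  assumes C: "compact C" "convex C" and C': "closed C'"
    and sub: "\<And>z w. z \<in> C \<Longrightarrow> w \<in> C \<Longrightarrow> (3/4) *\<^sub>R z - (1/4) *\<^sub>R w \<in> C'"
  shows "emeasure lborel C \<le> emeasure lborel C'"
proof (cases "C = {}")
  case False
  have B: "C \<in> sets borel" "C' \<in> sets borel"
    using C(1) C' by (auto intro: borel_closed compact_imp_closed)
  have "compact (fst ` C)" "connected (fst ` C)" "fst ` C \<noteq> {}"
    using C False convex_connected[OF convex_linear_image[OF linear_fst C(2)]]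
    by (auto intro!: compact_continuous_image continuous_intros simp del: image_is_empty)
  then obtain a b where ab: "fst ` C = {a..b}"
    using connected_compact_interval_1[of "fst ` C"] by (metis cbox_interval)
  define m where "m s = emeasure lborel {y. (s, y) \<in> C}" for s
  define m' where "m' s = emeasure lborel {y. (s, y) \<in> C'}" for s
  have [measurable]: "m \<in> borel_measurable borel" "m' \<in> borel_measurable borel"
    unfolding m_def m'_def using B by (auto intro: emeasure_lborel_sections(2))
  have out: "m s = 0" if "s \<notin> {a..b}" for s
  proof -
    have "{y. (s, y) \<in> C} = {}" using that unfolding ab[symmetric] by force
    then show ?thesis by (simp add: m_def)
  qed
  have sect: "\<exists>l u. l \<le> u \<and> {y. (s, y) \<in> C} = {l..u}" if "s \<in> {a..b}" for s
  proof -
    have "convex {y. (s, y) \<in> C}"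
    proof (rule convexI)
      fix y z t r :: real assume *: "y \<in> {y. (s, y) \<in> C}" "z \<in> {y. (s, y) \<in> C}" "0 \<le> t" "0 \<le> r" "t + r = 1"
      then have "t *\<^sub>R (s, y) + r *\<^sub>R (s, z) \<in> C" using C(2) by (intro convexD) auto
      moreover have "t * s + r * s = s" using *(5) by (metis distrib_right mult_1)
      ultimately show "t *\<^sub>R y + r *\<^sub>R z \<in> {y. (s, y) \<in> C}" by simp
    qed
    moreover have "compact {y. (s, y) \<in> C}"
    proof -
      have "{y. (s, y) \<in> C} = snd ` (C \<inter> {s} \<times> UNIV)" by force
      moreover have "compact (C \<inter> {s} \<times> UNIV)"
        by (intro compact_Int_closed C closed_Times) auto
      ultimately show ?thesis by (auto intro!: compact_continuous_image continuous_intros)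
    qed
    ultimately obtain l u where "{y. (s, y) \<in> C} = {l..u}"
      using connected_compact_interval_1[of "{y. (s, y) \<in> C}"] convex_connected by (metis cbox_interval)
    moreover have "{y. (s, y) \<in> C} \<noteq> {}" using that unfolding ab[symmetric] by force
    ultimately show ?thesis by (metis atLeastatMost_empty_iff)
  qed
  \<comment> \<open>Points built from the base points \<open>s\<close> and \<open>a + b - s\<close>
    lie over \<open>s - (a + b) / 4\<close>, because \<open>3/4 + 1/4 = 1\<close>. The pairing thus
    only translates the base, and integrating over it loses nothing. Over each base point, lengths
    of intervals combine with the same coefficients \<open>3/4\<close> and
    \<open>1/4\<close>.\<close>
  have key: "ennreal (3/4) * m s + ennreal (1/4) * m (a + b - s) \<le> m' (- (a + b) / 4 + 1 * s)" for s
  proof (cases "s \<in> {a..b}")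
    case True
    then have "a + b - s \<in> {a..b}" by auto
    obtain l u where lu: "l \<le> u" "{y. (s, y) \<in> C} = {l..u}" using sect[OF True] by blast
    obtain l' u' where lu': "l' \<le> u'" "{y. (a + b - s, y) \<in> C} = {l'..u'}"
      using sect[OF \<open>a + b - s \<in> {a..b}\<close>] by blast
    have "{3/4 * l - 1/4 * u' .. 3/4 * u - 1/4 * l'} \<subseteq> {y. (- (a + b) / 4 + 1 * s, y) \<in> C'}"
    proof
      fix y assume y: "y \<in> {3/4 * l - 1/4 * u' .. 3/4 * u - 1/4 * l'}"
      \<comment> \<open>The interval is swept in two strokes: first \<open>q = u'\<close> is held
        and \<open>p\<close> runs up to \<open>u\<close>, then \<open>p = u\<close> is held and
        \<open>q\<close> runs down to \<open>l'\<close>.\<close>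
      have "\<exists>p q. l \<le> p \<and> p \<le> u \<and> l' \<le> q \<and> q \<le> u' \<and> y = 3/4 * p - 1/4 * q"
      proof (cases "y \<le> 3/4 * u - 1/4 * u'")
        case True
        then show ?thesis using y lu lu' by (intro exI[of _ "(y + 1/4 * u') * (4/3)"] exI[of _ u']) (auto simp: field_simps)
      next
        case False
        then show ?thesis using y lu lu' by (intro exI[of _ u] exI[of _ "(3/4 * u - y) * 4"]) (auto simp: field_simps)
      qed
      then obtain p q where pq: "p \<in> {l..u}" "q \<in> {l'..u'}" "y = 3/4 * p - 1/4 * q" by auto
      then have "(3/4) *\<^sub>R (s, p) - (1/4) *\<^sub>R (a + b - s, q) \<in> C'"
        using lu lu' by (intro sub) auto
      moreover have "3/4 * s - 1/4 * (a + b - s) = - (a + b) / 4 + 1 * s" by (simp add: field_simps)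
      ultimately show "y \<in> {y. (- (a + b) / 4 + 1 * s, y) \<in> C'}" by (simp add: pq(3))
    qed
    moreover have "{y. (- (a + b) / 4 + 1 * s, y) \<in> C'} \<in> sets lborel"
    proof -
      have "{y. (- (a + b) / 4 + 1 * s, y) \<in> C'} = (\<lambda>y. (- (a + b) / 4 + 1 * s, y)) -` C'" by auto
      moreover have "closed \<dots>" by (intro closed_vimage C' continuous_intros)
      ultimately show ?thesis by (simp add: borel_closed)
    qed
    ultimately have "emeasure lborel {3/4 * l - 1/4 * u' .. 3/4 * u - 1/4 * l'} \<le> m' (- (a + b) / 4 + 1 * s)"
      unfolding m'_def by (rule emeasure_mono)
    moreover have "ennreal (3/4) * m s + ennreal (1/4) * m (a + b - s) =
       ennreal (3/4 * (u - l) + 1/4 * (u' - l'))"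
    proof -
      have "ennreal (3/4 * (u - l) + 1/4 * (u' - l')) = ennreal (3/4 * (u - l)) + ennreal (1/4 * (u' - l'))"
        using lu(1) lu'(1) by (intro ennreal_plus) auto
      then show ?thesis unfolding m_def lu(2) lu'(2) using lu(1) lu'(1)
        by (simp only: ennreal_mult' emeasure_lborel_Icc)
    qed
    moreover have "emeasure lborel {3/4 * l - 1/4 * u' .. 3/4 * u - 1/4 * l'} =
       ennreal (3/4 * (u - l) + 1/4 * (u' - l'))"
      using lu(1) lu'(1) by (subst emeasure_lborel_Icc) (auto simp: field_simps)
    ultimately show ?thesis by simp
  next
    case False
    then have "a + b - s \<notin> {a..b}" by auto
    then show ?thesis using out False by simp
  qed
  have m: "emeasure lborel C = (\<integral>\<^sup>+s. m s \<partial>lborel)" "emeasure lborel C' = (\<integral>\<^sup>+s. m' s \<partial>lborel)"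
    unfolding m_def m'_def using emeasure_lborel_sections(1) B by blast+
  have "(\<integral>\<^sup>+s. m s \<partial>lborel) = ennreal (3/4 + 1/4) * (\<integral>\<^sup>+s. m s \<partial>lborel)" by simp
  also have "\<dots> = ennreal (3/4) * (\<integral>\<^sup>+s. m s \<partial>lborel) + ennreal (1/4) * (\<integral>\<^sup>+s. m s \<partial>lborel)"
    by (subst ennreal_plus) (simp_all add: distrib_right)
  also have "\<dots> = ennreal (3/4) * (\<integral>\<^sup>+s. m s \<partial>lborel) + ennreal (1/4) * (\<integral>\<^sup>+s. m (a + b - s) \<partial>lborel)"
    using nn_integral_real_affine[of m "-1" "a + b"] by simp
  also have "ennreal (3/4) * (\<integral>\<^sup>+s. m s \<partial>lborel) + ennreal (1/4) * (\<integral>\<^sup>+s. m (a + b - s) \<partial>lborel) =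
      (\<integral>\<^sup>+s. ennreal (3/4) * m s + ennreal (1/4) * m (a + b - s) \<partial>lborel)"
    by (simp add: nn_integral_add nn_integral_cmult)
  also have "\<dots> \<le> (\<integral>\<^sup>+s. m' (- (a + b) / 4 + 1 * s) \<partial>lborel)"
    by (intro nn_integral_mono key)
  also have "\<dots> = (\<integral>\<^sup>+s. m' s \<partial>lborel)"
    using nn_integral_real_affine[of m' 1 "- (a + b) / 4"] by simp
  finally show ?thesis by (simp add: m)
qed simp

text \<open>Since \<open>t = 3/4 * (2 * t) + 1/4 * (- 2 * t)\<close> and \<open>K\<close> is
  symmetric, \<open>3/4\<close> of one point of the section at height \<open>2 * t\<close> minus
  \<open>1/4\<close> of another lies in the section at height \<open>t\<close>. So areas do not
  increase from \<open>t\<close> to \<open>2 * t\<close>, and substituting \<open>2 * t\<close> in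
  the integral over the heights gives the claim.\<close>

lemma slab_volume_coords:
  fixes K :: "(real \<times> real \<times> real) set"
  assumes K: "compact K" "convex K" and sym: "\<And>z. z \<in> K \<Longrightarrow> - z \<in> K"
  shows "emeasure lborel {z \<in> K. \<bar>fst z\<bar> \<le> \<tau>} \<le> 2 * emeasure lborel {z \<in> K. \<bar>fst z\<bar> \<le> \<tau> / 2}"
proof -
  define A where "A t = emeasure lborel {v. (t, v) \<in> K}" for t
  have Kc: "closed K" using K(1) by (rule compact_imp_closed)
  have A[measurable]: "A \<in> borel_measurable borel"
    unfolding A_def using Kc by (intro emeasure_lborel_sections(2)) (auto intro: borel_closed)
  have cl: "closed {v. (t, v) \<in> K}" for t
  proof -
    have "{v. (t, v) \<in> K} = Pair t -` K" by auto
    then show ?thesis using Kc by (auto intro!: closed_vimage continuous_intros)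
  qed
  have mono: "A (2 * t) \<le> A t" for t
    unfolding A_def
  proof (rule area_difference_body)
    show "compact {v. (2 * t, v) \<in> K}"
    proof -
      have "{v. (2 * t, v) \<in> K} = snd ` (K \<inter> {2 * t} \<times> UNIV)" by force
      moreover have "compact (K \<inter> {2 * t} \<times> UNIV)"
        by (intro compact_Int_closed K closed_Times) auto
      ultimately show ?thesis by (auto intro!: compact_continuous_image continuous_intros)
    qed
    show "convex {v. (2 * t, v) \<in> K}"
    proof (rule convexI)
      fix v w :: "real \<times> real" and a b :: real
      assume *: "v \<in> {v. (2 * t, v) \<in> K}" "w \<in> {v. (2 * t, v) \<in> K}" "0 \<le> a" "0 \<le> b" "a + b = 1"
      then have "a *\<^sub>R (2 * t, v) + b *\<^sub>R (2 * t, w) \<in> K" using K(2) by (intro convexD) auto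
      moreover have "a * (2 * t) + b * (2 * t) = 2 * t" using *(5) by (metis distrib_right mult_1)
      ultimately show "a *\<^sub>R v + b *\<^sub>R w \<in> {v. (2 * t, v) \<in> K}" by simp
    qed
    show "closed {v. (t, v) \<in> K}" by (rule cl)
    fix z w assume "z \<in> {v. (2 * t, v) \<in> K}" "w \<in> {v. (2 * t, v) \<in> K}"
    then have "(3/4) *\<^sub>R (2 * t, z) + (1/4) *\<^sub>R (- (2 * t, w)) \<in> K"
      using K(2) sym[of "(2 * t, w)"] by (intro convexD) auto
    then show "(3/4) *\<^sub>R z - (1/4) *\<^sub>R w \<in> {v. (t, v) \<in> K}" by simp
  qed
  have vol: "emeasure lborel {z \<in> K. \<bar>fst z\<bar> \<le> \<tau>} = (\<integral>\<^sup>+t. indicator {-\<tau>..\<tau>} t * A t \<partial>lborel)" for \<tau>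
  proof -
    have "closed {z \<in> K. \<bar>fst z\<bar> \<le> \<tau>}"
      unfolding Collect_conj_eq Collect_mem_eq
      by (intro closed_Int Kc closed_Collect_le continuous_intros)
    then have "{z \<in> K. \<bar>fst z\<bar> \<le> \<tau>} \<in> sets borel" by (rule borel_closed)
    from emeasure_lborel_sections(1)[OF this] show ?thesis
      by (auto simp: A_def indicator_def abs_le_iff intro!: nn_integral_cong arg_cong[of _ _ "emeasure lborel"])
  qed
  have "(\<integral>\<^sup>+t. indicator {-\<tau>..\<tau>} t * A t \<partial>lborel) =
     2 * (\<integral>\<^sup>+t. indicator {-\<tau>..\<tau>} (2 * t) * A (2 * t) \<partial>lborel)"
    using nn_integral_real_affine[of "\<lambda>t. indicator {-\<tau>..\<tau>} t * A t" 2 0] by simp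
  also have "\<dots> \<le> 2 * (\<integral>\<^sup>+t. indicator {-(\<tau>/2)..\<tau>/2} t * A t \<partial>lborel)"
    using mono by (intro mult_left_mono nn_integral_mono) (auto simp: indicator_def)
  finally show ?thesis unfolding vol .
qed

lemma slab_volume:
  fixes K :: "(real^3) set"
  assumes K: "compact K" "convex K" and sym: "\<And>z. z \<in> K \<Longrightarrow> - z \<in> K" and \<tau>: "\<tau> \<ge> 0"
  shows "emeasure lborel {y \<in> K. \<bar>y \<bullet> \<xi>\<bar> \<le> \<tau>} \<le> 2 * emeasure lborel {y \<in> K. \<bar>y \<bullet> \<xi>\<bar> \<le> \<tau> / 2}"
proof (cases "\<xi> = 0")
  case True
  have "emeasure lborel K \<le> 2 * emeasure lborel K"
    by (simp add: mult_2)
  then show ?thesis using True \<tau> by simp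
next
  case False
  then have "norm ((1 / norm \<xi>) *\<^sub>R \<xi>) = 1" by simp
  then obtain U where U: "frame U" "U (1, 0) = (1 / norm \<xi>) *\<^sub>R \<xi>" by (rule frame_exists)
  note lin = frame_linear[OF U(1)]
  have Kc: "closed K" using K(1) by (rule compact_imp_closed)
  have inn: "U z \<bullet> \<xi> = norm \<xi> * fst z" for z
  proof -
    have "\<xi> = norm \<xi> *\<^sub>R U (1, 0)" using U(2) False by simp
    then have "U z \<bullet> \<xi> = norm \<xi> * (U z \<bullet> U (1, 0))" by (metis inner_scaleR_right)
    then show ?thesis unfolding frame_inner[OF U(1)] by (simp add: inner_prod_def)
  qed
  define K' where "K' = {z. U z \<in> K}"
  have contU: "continuous_on UNIV U" using lin by (simp add: linear_continuous_on linear_linear)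
  have "compact K'"
  proof -
    have "K' = U -` K" by (auto simp: K'_def)
    then have "closed K'" using closed_vimage[OF Kc contU] by simp
    moreover obtain B where "\<And>y. y \<in> K \<Longrightarrow> norm y \<le> B"
      using compact_imp_bounded[OF K(1)] unfolding bounded_iff by blast
    then have "bounded K'" unfolding bounded_iff K'_def using frame_norm[OF U(1)]
      by (metis mem_Collect_eq)
    ultimately show ?thesis by (simp add: compact_eq_bounded_closed)
  qed
  moreover have "convex K'"
    using convex_linear_vimage[OF lin K(2)] by (simp add: K'_def vimage_def)
  moreover have "- z \<in> K'" if "z \<in> K'" for z
    using that sym by (simp add: K'_def linear_neg[OF lin])
  ultimately have *: "emeasure lborel {z \<in> K'. \<bar>fst z\<bar> \<le> \<tau>} \<le> 2 * emeasure lborel {z \<in> K'. \<bar>fst z\<bar> \<le> \<tau> / 2}" for \<tau>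
    by (rule slab_volume_coords)
  have vol: "emeasure lborel {y \<in> K. \<bar>y \<bullet> \<xi>\<bar> \<le> s} = emeasure lborel {z \<in> K'. \<bar>fst z\<bar> \<le> s / norm \<xi>}" for s
  proof -
    have "closed {y \<in> K. \<bar>y \<bullet> \<xi>\<bar> \<le> s}"
      unfolding Collect_conj_eq Collect_mem_eq
      by (intro closed_Int Kc closed_Collect_le continuous_intros)
    then have "{y \<in> K. \<bar>y \<bullet> \<xi>\<bar> \<le> s} \<in> sets borel" by (rule borel_closed)
    from frame_emeasure[OF U(1) this]
    have "emeasure lborel {y \<in> K. \<bar>y \<bullet> \<xi>\<bar> \<le> s} = emeasure lborel {z. U z \<in> K \<and> \<bar>norm \<xi> * fst z\<bar> \<le> s}"
      by (simp add: inn)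
    also have "{z. U z \<in> K \<and> \<bar>norm \<xi> * fst z\<bar> \<le> s} = {z \<in> K'. \<bar>fst z\<bar> \<le> s / norm \<xi>}"
      using False by (auto simp: K'_def abs_mult field_simps)
    finally show ?thesis .
  qed
  show ?thesis using *[of "\<tau> / norm \<xi>"] unfolding vol by (simp add: mult.commute)
qed

subsection \<open>Asymptotics of the kernel\<close>

text \<open>\<open>v\<close> is the part of a body point across the direction \<open>x\<close>. The
  scales \<open>a\<close> and \<open>a / 4\<close> come from the ellipsoids for \<open>y\<close> and
  \<open>2 *\<^sub>R y\<close>, as \<open>a + 4 * t = 4 * (a / 4 + t)\<close>. The profile is a bump
  at \<open>v = 0\<close> whose tail is of order \<open>a / (norm v)\<^sup>2\<close>.\<close>

definition ridge_gap :: "real \<Rightarrow> real \<times> real \<Rightarrow> real" where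
  "ridge_gap a v = ln (a + (norm v)\<^sup>2) - ln (a / 4 + (norm v)\<^sup>2)"

text \<open>The natural size of the main term. The tail of the bump is scale invariant in the plane,
  which makes the mass exceed \<open>a\<close> by a factor growing like
  \<open>ln (1 / a)\<close>.\<close>

definition ridge_mass :: "real \<Rightarrow> real \<Rightarrow> real" where
  "ridge_mass M a = (\<integral>v. indicator (cball 0 M) v * ridge_gap a v \<partial>lborel)"

lemma norm_sq_pos: "a > 0 \<Longrightarrow> a + (norm v)\<^sup>2 > 0" for a :: real
  by (simp add: add_pos_nonneg)

lemma ridge_gap_ge:
  assumes "a > 0" shows "ridge_gap a v \<ge> (3 * a / 4) / (a + (norm v)\<^sup>2)" "ridge_gap a v \<ge> 0"
proof -
  define p where "p = a + (norm v)\<^sup>2"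
  define q where "q = a / 4 + (norm v)\<^sup>2"
  have pq: "p > 0" "q > 0" "p - q = 3 * a / 4"
    using norm_sq_pos[of a v] norm_sq_pos[of "a/4" v] assms by (simp_all add: p_def q_def)
  have "ln (q / p) \<le> q / p - 1" using pq by (intro ln_le_minus_one) simp
  then have "ln p - ln q \<ge> 1 - q / p" using pq by (simp add: ln_div)
  also have "1 - q / p = (3 * a / 4) / p" unfolding pq(3)[symmetric] using pq by (simp add: diff_divide_distrib)
  finally show "ridge_gap a v \<ge> (3 * a / 4) / (a + (norm v)\<^sup>2)"
    by (simp add: ridge_gap_def p_def q_def)
  moreover have "(3 * a / 4) / (a + (norm v)\<^sup>2) \<ge> 0" using assms pq by (simp add: p_def)
  ultimately show "ridge_gap a v \<ge> 0" by linarith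
qed

lemma ridge_gap_le:
  assumes "a > 0" "v \<noteq> 0" shows "ridge_gap a v \<le> a / (norm v)\<^sup>2"
proof -
  define p where "p = a + (norm v)\<^sup>2"
  define q where "q = a / 4 + (norm v)\<^sup>2"
  have pq: "p > 0" "q > 0" "p - q = 3 * a / 4"
    using norm_sq_pos[of a v] norm_sq_pos[of "a/4" v] assms by (simp_all add: p_def q_def)
  have "ln (p / q) \<le> p / q - 1" using pq by (intro ln_le_minus_one) simp
  then have "ln p - ln q \<le> p / q - 1" using pq by (simp add: ln_div)
  also have "p / q - 1 = (3 * a / 4) / q" unfolding pq(3)[symmetric] using pq by (simp add: diff_divide_distrib)
  also have "\<dots> \<le> a / (norm v)\<^sup>2"
    using assms by (intro frac_le) (simp_all add: q_def)
  finally show ?thesis by (simp add: ridge_gap_def p_def q_def)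
qed

lemma ridge_gap_bound:
  assumes "a > 0" shows "ridge_gap a v \<le> 3"
proof -
  define p where "p = a + (norm v)\<^sup>2"
  define q where "q = a / 4 + (norm v)\<^sup>2"
  have pq: "p > 0" "q > 0" "p \<le> 4 * q"
    using norm_sq_pos[of a v] norm_sq_pos[of "a/4" v] assms by (simp_all add: p_def q_def)
  have "ln (p / q) \<le> p / q - 1" using pq by (intro ln_le_minus_one) simp
  also have "p / q \<le> 4" using pq by (simp add: divide_le_eq)
  finally show ?thesis using pq by (simp add: ridge_gap_def ln_div flip: p_def q_def)
qed

lemma borel_measurable_ridge_gap [measurable]: "ridge_gap a \<in> borel_measurable borel"
  unfolding ridge_gap_def[abs_def] by measurable

lemma integrable_indicator_mult:
  fixes f :: "'a::euclidean_space \<Rightarrow> real"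
  assumes S: "S \<in> sets borel" "bounded S" and f: "f \<in> borel_measurable borel" "\<And>x. x \<in> S \<Longrightarrow> \<bar>f x\<bar> \<le> B"
  shows "integrable lborel (\<lambda>x. indicator S x * f x)"
proof -
  obtain R where R: "S \<subseteq> cball 0 R" using S(2) unfolding bounded_iff by (auto simp: subset_iff)
  have "integrable lborel (\<lambda>x :: 'a. \<bar>B\<bar> * indicator (cball 0 R) x)" by simp
  then show ?thesis
  proof (rule Bochner_Integration.integrable_bound)
    have "norm (indicator S x * f x) \<le> norm (\<bar>B\<bar> * indicator (cball 0 R) x)" for x
      using f(2)[of x] R by (cases "x \<in> S") (auto simp: indicator_def)
    then show "AE x in lborel. norm (indicator S x * f x) \<le> norm (\<bar>B\<bar> * indicator (cball 0 R) x)"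
      by simp
    show "(\<lambda>x. indicator S x * f x) \<in> borel_measurable lborel"
      using S(1) f(1) by simp
  qed
qed

lemma integrable_ridge_gap:
  assumes "a > 0" "S \<in> sets borel" "bounded S"
  shows "integrable lborel (\<lambda>v. indicator S v * ridge_gap a v)"
  using assms ridge_gap_ge(2)[of a] ridge_gap_bound[of a]
  by (intro integrable_indicator_mult[where B = 3]) (auto simp: abs_le_iff intro: order_trans[of _ 0])

lemma integral_inverse_hypot:
  assumes "A > 0" "M \<ge> 0"
  shows "has_bochner_integral lborel (\<lambda>s. 1 / sqrt (A + s\<^sup>2) * indicator {-M..M} s)
     (2 * ln (M + sqrt (A + M\<^sup>2)) - ln A)"
proof -
  define F where "F s = ln (s + sqrt (A + s\<^sup>2))" for s
  have pos: "s + sqrt (A + s\<^sup>2) > 0" for s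
  proof -
    have "sqrt (s\<^sup>2) < sqrt (A + s\<^sup>2)" using assms by (intro real_sqrt_less_mono) simp
    then show ?thesis by simp
  qed
  have sq: "sqrt (A + s\<^sup>2) > 0" for s using assms by (simp add: add_pos_nonneg)
  have d: "(F has_real_derivative 1 / sqrt (A + s\<^sup>2)) (at s)" for s
  proof -
    have "(F has_real_derivative (1 + (2 * s) * (inverse (sqrt (A + s\<^sup>2)) / 2)) / (s + sqrt (A + s\<^sup>2))) (at s)"
      unfolding F_def using pos[of s] sq[of s]
      by (auto intro!: derivative_eq_intros)
    moreover have "(1 + (2 * s) * (inverse k / 2)) / (s + k) = 1 / k" if "k > 0" "s + k > 0" for k
      using that by (simp add: divide_simps)
    ultimately show ?thesis using pos sq by metis
  qed
  have "has_bochner_integral lborel (\<lambda>s. 1 / sqrt (A + s\<^sup>2) * indicator {-M..M} s) (F M - F (- M))"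
  proof (rule has_bochner_integral_FTC_Icc_real)
    show "isCont (\<lambda>s. 1 / sqrt (A + s\<^sup>2)) s" for s
      using sq[of s] by (intro continuous_intros) auto
  qed (use assms d in auto)
  also have "F M - F (- M) = 2 * ln (M + sqrt (A + M\<^sup>2)) - ln A"
  proof -
    \<comment> \<open>The primitive is the inverse hyperbolic sine up to a constant. Its arguments
      at the two endpoints have product \<open>A\<close>, so the logarithm at \<open>- M\<close> can
      be expressed by the one at \<open>M\<close> and \<open>ln A\<close>.\<close>
    have "(M + sqrt (A + M\<^sup>2)) * (- M + sqrt (A + M\<^sup>2)) = (sqrt (A + M\<^sup>2))\<^sup>2 - M\<^sup>2"
      by (simp add: power2_eq_square algebra_simps)
    also have "\<dots> = A" using assms by (simp add: add_nonneg_nonneg)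
    finally have "ln (M + sqrt (A + M\<^sup>2)) + ln (- M + sqrt (A + M\<^sup>2)) = ln A"
      using pos[of M] pos[of "- M"] ln_mult[of "M + sqrt (A + M\<^sup>2)" "- M + sqrt (A + M\<^sup>2)"] by simp
    then show ?thesis by (simp add: F_def)
  qed
  finally show ?thesis .
qed

text \<open>Restricting to the triangle \<open>T\<close> replaces polar coordinates: there
  \<open>norm v\<close> is comparable to \<open>fst v\<close>, and the section of \<open>T\<close>
  at \<open>x\<close> has length \<open>x\<close>, the factor that turns the tail into the
  derivative of a logarithm. The condition \<open>2 * m \<le> M\<close> puts \<open>T\<close> inside
  the disc.\<close>

lemma ridge_mass_ge:
  assumes a: "a > 0" and m: "m > 0" "2 * m \<le> M"
  shows "ridge_mass M a \<ge> 3 * a / 16 * (ln (2 * m\<^sup>2) - ln a)"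
proof -
  define h where "h x = 3 * a / 4 / (a + 2 * x\<^sup>2)" for x
  define T where "T = {v :: real \<times> real. 0 \<le> fst v \<and> fst v \<le> m \<and> 0 \<le> snd v \<and> snd v \<le> fst v}"
  have hpos: "a + 2 * x\<^sup>2 > 0" for x using a by (simp add: add_pos_nonneg)
  have Tc: "closed T" unfolding T_def by (intro closed_Collect_conj closed_Collect_le continuous_intros)
  have Tb: "norm v \<le> M" and Th: "(norm v)\<^sup>2 \<le> 2 * (fst v)\<^sup>2" if "v \<in> T" for v
  proof -
    have "norm v \<le> norm (fst v) + norm (snd v)" using norm_Pair_le[of "fst v" "snd v"] by simp
    then show "norm v \<le> M" using that m by (auto simp: T_def)
    have "(snd v)\<^sup>2 \<le> (fst v)\<^sup>2" using that by (intro power_mono) (auto simp: T_def)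
    then show "(norm v)\<^sup>2 \<le> 2 * (fst v)\<^sup>2" by (simp add: norm_prod_def)
  qed
  have bT: "bounded T" using Tb unfolding bounded_iff by blast
  have mT: "T \<in> sets borel" using Tc by (rule borel_closed)
  have hm: "(\<lambda>v. h (fst v)) \<in> borel_measurable (borel :: (real \<times> real) measure)"
    unfolding h_def using hpos
    by (intro borel_measurable_continuous_onI continuous_intros) (auto simp: less_imp_neq[symmetric])
  have hb: "0 \<le> h x" "h x \<le> 3 / 4" for x
    using a hpos[of x] by (simp_all add: h_def divide_simps)
  have iT: "integrable lborel (\<lambda>v. indicator T v * h (fst v))"
    using mT bT hm by (rule integrable_indicator_mult[where B = "3/4"]) (use hb in auto)
  have "(\<integral>v. indicator T v * h (fst v) \<partial>lborel) \<le> ridge_mass M a"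
    unfolding ridge_mass_def
  proof (rule integral_mono)
    show "integrable lborel (\<lambda>v. indicator (cball 0 M) v * ridge_gap a v)"
      by (rule integrable_ridge_gap[OF a]) auto
    fix v :: "real \<times> real"
    show "indicator T v * h (fst v) \<le> indicator (cball 0 M) v * ridge_gap a v"
    proof (cases "v \<in> T")
      case True
      have "h (fst v) \<le> (3 * a / 4) / (a + (norm v)\<^sup>2)"
        unfolding h_def using Th[OF True] a norm_sq_pos[OF a, of v] by (intro divide_left_mono) auto
      then show ?thesis using True Tb[OF True] ridge_gap_ge(1)[OF a, of v] by simp
    next
      case False
      then show ?thesis using ridge_gap_ge(2)[OF a, of v] by (simp add: indicator_def)
    qed
  qed (rule iT)
  moreover have "(\<integral>v. indicator T v * h (fst v) \<partial>lborel) = 3 * a / 16 * (ln (a + 2 * m\<^sup>2) - ln a)"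
  proof -
    have "(\<integral>v. indicator T v * h (fst v) \<partial>lborel) = (\<integral>x. \<integral>y. indicator T (x, y) * h x \<partial>lborel \<partial>lborel)"
      using lborel_pair.integral_fst'[of "\<lambda>v. indicator T v * h (fst v)"] iT by (simp add: lborel_prod)
    also have "\<dots> = (\<integral>x. (x * h x) * indicator {0..m} x \<partial>lborel)"
    proof (rule Bochner_Integration.integral_cong)
      fix x :: real
      have eq: "(\<lambda>y. indicator T (x, y) * h x) = (\<lambda>y. (h x * indicator {0..m} x) * indicator {0..x} y)"
        by (auto simp: T_def indicator_def)
      show "(\<integral>y. indicator T (x, y) * h x \<partial>lborel) = (x * h x) * indicator {0..m} x"
        unfolding eq by (cases "x \<in> {0..m}") simp_all
    qed simp
    also have "\<dots> = 3 * a / 16 * ln (a + 2 * m\<^sup>2) - 3 * a / 16 * ln (a + 2 * 0\<^sup>2)"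
    proof (rule integral_FTC_Icc_real)
      show "((\<lambda>x. 3 * a / 16 * ln (a + 2 * x\<^sup>2)) has_real_derivative x * h x) (at x)" for x
        using hpos[of x] unfolding h_def by (auto intro!: derivative_eq_intros simp: field_simps)
      show "isCont (\<lambda>x. x * h x) x" for x
        using hpos[of x] unfolding h_def by (intro continuous_intros) auto
    qed (use m in auto)
    finally show ?thesis by (simp add: right_diff_distrib)
  qed
  moreover have "ln (2 * m\<^sup>2) \<le> ln (a + 2 * m\<^sup>2)"
    using a m by (subst ln_le_cancel_iff) (auto intro: add_pos_pos)
  then have "3 * a / 16 * (ln (2 * m\<^sup>2) - ln a) \<le> 3 * a / 16 * (ln (a + 2 * m\<^sup>2) - ln a)"
    using a by (intro mult_left_mono) auto
  ultimately show ?thesis by linarith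
qed

text \<open>The logarithmic gain that makes errors of order \<open>a\<close> negligible. The
  threshold \<open>a0\<close> solves
  \<open>3 / 16 * (ln (2 * m\<^sup>2) - ln a0) = C\<close>.\<close>

lemma ridge_mass_dominates:
  assumes M: "M > 0"
  shows "\<exists>a0>0. \<forall>a. 0 < a \<longrightarrow> a < a0 \<longrightarrow> C * a \<le> ridge_mass M a"
proof -
  define m where "m = M / 2"
  have m: "m > 0" "2 * m \<le> M" using M by (simp_all add: m_def)
  define a0 where "a0 = 2 * m\<^sup>2 * exp (- (16 * C / 3))"
  have a0: "a0 > 0" using m by (simp add: a0_def)
  have "C * a \<le> ridge_mass M a" if a: "0 < a" "a < a0" for a
  proof -
    have "ln a \<le> ln a0" using a by simp
    also have "ln a0 = ln (2 * m\<^sup>2) - 16 * C / 3" using m by (simp add: a0_def ln_mult)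
    finally have "16 * C / 3 \<le> ln (2 * m\<^sup>2) - ln a" by simp
    then have "3 * a / 16 * (16 * C / 3) \<le> 3 * a / 16 * (ln (2 * m\<^sup>2) - ln a)"
      using a by (intro mult_left_mono) auto
    also have "\<dots> \<le> ridge_mass M a" by (rule ridge_mass_ge[OF a(1) m])
    finally show ?thesis by (simp add: mult.commute)
  qed
  then show ?thesis using a0 by blast
qed

section \<open>Norms and the kernel away from the origin\<close>

text \<open>The constants are explicit because one threshold for \<open>a\<close> must serve all the
  norms \<open>p \<circ> U\<close> that arise by turning the various directions \<open>x\<close>
  into the first axis. Rotation keeps \<open>r\<close> and \<open>M\<close>.\<close>

definition norm_between :: "real \<Rightarrow> real \<Rightarrow> ('a::real_normed_vector \<Rightarrow> real) \<Rightarrow> bool" where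
  "norm_between r M p \<longleftrightarrow> 0 < r \<and> 0 < M \<and> continuous_on UNIV p \<and>
     (\<forall>z w. p (z + w) \<le> p z + p w) \<and> (\<forall>t z. p (t *\<^sub>R z) = \<bar>t\<bar> * p z) \<and>
     (\<forall>z. r * p z \<le> norm z \<and> norm z \<le> M * p z)"

lemma norm_betweenD:
  assumes "norm_between r M p"
  shows "0 < r" "0 < M" "continuous_on UNIV p" "p (z + w) \<le> p z + p w" "p (t *\<^sub>R z) = \<bar>t\<bar> * p z"
    "r * p z \<le> norm z" "norm z \<le> M * p z"
  using assms by (auto simp: norm_between_def)

text \<open>\<open>R2\<close> is the squared norm of a body point \<open>y\<close> and
  \<open>r2\<close> its squared distance from the line through \<open>x\<close>. The two terms are
  the \<open>x\<close>-dependent parts of \<open>ellipsoid_ln\<close> for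
  \<open>2 *\<^sub>R y\<close> and \<open>y\<close>, up to a common factor.\<close>

definition log_kernel :: "real \<Rightarrow> real \<Rightarrow> real \<Rightarrow> real" where
  "log_kernel a R2 r2 = (ln (a / 4 + r2) / sqrt (a / 4 + R2) - ln (a + r2) / sqrt (a + R2)) / 2"

lemma integral_inverse_abs:
  fixes x y :: real
  assumes "0 < x" "x \<le> y"
  shows "has_bochner_integral lborel (\<lambda>s. indicator {s. x \<le> \<bar>s\<bar> \<and> \<bar>s\<bar> \<le> y} s * (1 / \<bar>s\<bar>)) (2 * (ln y - ln x))"
proof -
  define f where "f s = 1 / s * indicator {x..y} s" for s :: real
  have f: "has_bochner_integral lborel f (ln y - ln x)"
    unfolding f_def
  proof (rule has_bochner_integral_FTC_Icc_real)
    show "(ln has_real_derivative 1 / s) (at s)" if "x \<le> s" for s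
      using that assms by (auto intro!: derivative_eq_intros)
    show "isCont (\<lambda>s. 1 / s) s" if "x \<le> s" for s
      using that assms by (intro continuous_intros) auto
  qed (use assms in auto)
  have f': "has_bochner_integral lborel (\<lambda>s. f (0 + (-1) * s)) (ln y - ln x)"
    using lborel_has_bochner_integral_real_affine_iff[of "-1" f "ln y - ln x" 0] f by simp
  have "(\<lambda>s. indicator {s. x \<le> \<bar>s\<bar> \<and> \<bar>s\<bar> \<le> y} s * (1 / \<bar>s\<bar>)) = (\<lambda>s. f s + f (0 + (-1) * s))"
  proof
    fix s :: real
    show "indicator {s. x \<le> \<bar>s\<bar> \<and> \<bar>s\<bar> \<le> y} s * (1 / \<bar>s\<bar>) = f s + f (0 + (-1) * s)"
      using assms by (cases s "0 :: real" rule: linorder_cases) (auto simp: f_def indicator_def)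
  qed
  then show ?thesis using has_bochner_integral_add[OF f f'] by simp
qed

lemma norm_sq_Pair: "(norm (s, v))\<^sup>2 = s\<^sup>2 + (norm v)\<^sup>2" for s :: real
  by (simp add: norm_prod_def)

context
  fixes r0 M :: real and p :: "real \<times> real \<times> real \<Rightarrow> real"
  assumes p: "norm_between r0 M p"
begin

lemma axis_value: "p (1, 0) > 0" "1 / p (1, 0) \<le> M" "r0 \<le> 1 / p (1, 0)"
proof -
  have n: "norm (1 :: real, 0 :: real \<times> real) = 1" by (simp add: norm_prod_def)
  have 1: "1 \<le> M * p (1, 0)" "r0 * p (1, 0) \<le> 1"
    using norm_betweenD(6,7)[OF p, of "(1, 0)"] n by auto
  then show 2: "p (1, 0) > 0" using norm_betweenD(2)[OF p] by (smt (verit) zero_less_mult_pos)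
  show "1 / p (1, 0) \<le> M" "r0 \<le> 1 / p (1, 0)" using 1 2 by (simp_all add: field_simps)
qed

lemma shell_closed: "closed {z. p z \<le> 1 \<and> r \<le> norm z}"
  by (intro closed_Collect_conj closed_Collect_le continuous_intros norm_betweenD(3)[OF p])

lemma ball_bounded:
  assumes "p z \<le> 1" shows "norm z \<le> M"
proof -
  have "M * p z \<le> M * 1" using assms norm_betweenD(2)[OF p] by (intro mult_left_mono) auto
  then show ?thesis using norm_betweenD(7)[OF p, of z] by simp
qed

text \<open>As \<open>p (0, v) \<le> \<theta>\<close>, the triangle inequality confines the shell on
  this line to \<open>r * (1 - \<theta>) \<le> \<bar>s\<bar> \<le> l * (1 + \<theta>)\<close> and
  makes it contain \<open>r \<le> \<bar>s\<bar> \<le> l * (1 - \<theta>)\<close>. The integrand is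
  at most \<open>1 / \<bar>s\<bar>\<close> on the former set and at least
  \<open>1 / ((1 + 2 * \<theta>) * \<bar>s\<bar>)\<close> on the latter, and both bounds integrate
  to logarithms.\<close>

lemma ray_integral:
  fixes a \<theta> :: real and v :: "real \<times> real"
  defines "r \<equiv> r0 / 2" and "l \<equiv> 1 / p (1, 0)"
  assumes \<theta>: "0 < \<theta>" "\<theta> \<le> 1 / 2" and v: "norm v \<le> \<theta> * r" and a: "0 < a" "a \<le> (\<theta> * r)\<^sup>2"
  shows "\<bar>(\<integral>s. indicator {z. p z \<le> 1 \<and> r \<le> norm z} (s, v) * (1 / sqrt (a + (norm (s, v))\<^sup>2)) \<partial>lborel) -
      2 * (ln l - ln r)\<bar> \<le> \<theta> * (4 * M / r + 6)"
proof -
  have r: "r > 0" using norm_betweenD(1)[OF p] by (simp add: r_def)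
  have l: "l > 0" "l \<le> M" "2 * r \<le> l" using axis_value by (simp_all add: l_def r_def)
  have M: "M > 0" by (rule norm_betweenD(2)[OF p])
  have ps: "p (s, 0) = \<bar>s\<bar> / l" for s
    using norm_betweenD(5)[OF p, of s "(1, 0)"] by (simp add: l_def)
  have pv: "p (0, w) \<le> \<theta>" if "norm w = norm v" for w
  proof -
    have "r0 * p (0, w) \<le> norm v" using norm_betweenD(6)[OF p, of "(0, w)"] that by (simp add: norm_prod_def)
    also have "\<dots> \<le> \<theta> * r0" using v norm_ge_zero[of v] unfolding r_def times_divide_eq_right by linarith
    finally show ?thesis using r by (simp add: r_def mult.commute)
  qed
  let ?f = "\<lambda>s. indicator {z. p z \<le> 1 \<and> r \<le> norm z} (s, v) * (1 / sqrt (a + (norm (s, v))\<^sup>2))"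
  let ?S = "\<lambda>x y. {s :: real. x \<le> \<bar>s\<bar> \<and> \<bar>s\<bar> \<le> y}"
  define g where "g s = indicator (?S (r * (1 - \<theta>)) (l * (1 + \<theta>))) s * (1 / \<bar>s\<bar>)" for s
  define h where "h s = indicator (?S r (l * (1 - \<theta>))) s * (1 / \<bar>s\<bar>)" for s
  have x1: "0 < r * (1 - \<theta>)" "r * (1 - \<theta>) \<le> l * (1 + \<theta>)"
    using r \<theta> l by (auto intro!: mult_mono)
  \<comment> \<open>The reason for cutting at half the inner radius: \<open>2 * r \<le> l\<close>
    leaves room for the factor \<open>1 - \<theta>\<close>, which is at least
    \<open>1 / 2\<close>.\<close>
  have x2: "r \<le> l * (1 - \<theta>)"
  proof -
    have "r = 2 * r * (1 / 2)" by simp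
    also have "\<dots> \<le> l * (1 - \<theta>)" using r \<theta> l by (intro mult_mono) auto
    finally show ?thesis .
  qed
  have g: "has_bochner_integral lborel g (2 * (ln (l * (1 + \<theta>)) - ln (r * (1 - \<theta>))))"
    unfolding g_def by (rule integral_inverse_abs[OF x1])
  have h: "has_bochner_integral lborel h (2 * (ln (l * (1 - \<theta>)) - ln r))"
    unfolding h_def by (rule integral_inverse_abs[OF r x2])
  have pos: "a + (norm (s, v))\<^sup>2 > 0" for s using a by (simp add: add_pos_nonneg)
  have f0: "0 \<le> ?f s" for s
    by (intro mult_nonneg_nonneg divide_nonneg_nonneg real_sqrt_ge_zero less_imp_le[OF pos]) auto
  have fg: "?f s \<le> g s" for s
  proof (cases "p (s, v) \<le> 1 \<and> r \<le> norm (s, v)")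
    case True
    have "\<bar>s\<bar> / l \<le> p (s, v) + p (0, - v)"
      using norm_betweenD(4)[OF p, of "(s, v)" "(0, - v)"] ps[of s] by simp
    also have "\<dots> \<le> 1 + \<theta>" using True pv[of "- v"] by simp
    finally have 1: "\<bar>s\<bar> \<le> l * (1 + \<theta>)" using l by (simp add: divide_le_eq mult.commute)
    have "r \<le> \<bar>s\<bar> + \<theta> * r" using True v norm_Pair_le[of s v] by simp
    then have 2: "r * (1 - \<theta>) \<le> \<bar>s\<bar>" by (simp add: algebra_simps)
    have "s\<^sup>2 \<le> a + (norm (s, v))\<^sup>2" using a by (simp add: norm_sq_Pair)
    then have "\<bar>s\<bar> \<le> sqrt (a + (norm (s, v))\<^sup>2)" by (metis real_sqrt_abs real_sqrt_le_mono)
    then have "1 / sqrt (a + (norm (s, v))\<^sup>2) \<le> 1 / \<bar>s\<bar>"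
      using 2 x1 pos[of s] by (intro divide_left_mono mult_pos_pos) auto
    then show ?thesis using True 1 2 by (simp add: g_def)
  next
    case False
    then have "indicator {z. p z \<le> 1 \<and> r \<le> norm z} (s, v) = (0 :: real)"
      by (intro indicator_simps(2)) simp
    then show ?thesis by (simp add: g_def)
  qed
  have hf: "1 / (1 + 2 * \<theta>) * h s \<le> ?f s" for s
  proof (cases "r \<le> \<bar>s\<bar> \<and> \<bar>s\<bar> \<le> l * (1 - \<theta>)")
    case True
    have "p (s, v) \<le> \<bar>s\<bar> / l + p (0, v)"
      using norm_betweenD(4)[OF p, of "(s, 0)" "(0, v)"] ps[of s] by simp
    also have "\<dots> \<le> (1 - \<theta>) + \<theta>"
      using True l pv[of v] by (intro add_mono) (simp_all add: divide_le_eq mult.commute)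
    finally have 1: "p (s, v) \<le> 1" by simp
    have "norm s \<le> norm (s, v)" using norm_fst_le[of s v] by simp
    then have 2: "r \<le> norm (s, v)" using True by simp
    have "(norm v)\<^sup>2 \<le> (\<theta> * r)\<^sup>2" using v by (intro power_mono) auto
    then have "a + (norm (s, v))\<^sup>2 \<le> s\<^sup>2 + 2 * (\<theta> * r)\<^sup>2"
      using a by (simp add: norm_sq_Pair)
    also have "(\<theta> * r)\<^sup>2 \<le> (\<theta> * \<bar>s\<bar>)\<^sup>2"
      using True \<theta> r by (intro power_mono mult_left_mono) auto
    also have "s\<^sup>2 + 2 * (\<theta> * \<bar>s\<bar>)\<^sup>2 \<le> (\<bar>s\<bar> * (1 + 2 * \<theta>))\<^sup>2"
    proof -
      have "(\<bar>s\<bar> * (1 + 2 * \<theta>))\<^sup>2 - (s\<^sup>2 + 2 * (\<theta> * \<bar>s\<bar>)\<^sup>2) = s\<^sup>2 * (4 * \<theta> + 2 * \<theta>\<^sup>2)"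
        by (simp add: power_mult_distrib power2_eq_square algebra_simps)
      moreover have "s\<^sup>2 * (4 * \<theta> + 2 * \<theta>\<^sup>2) \<ge> 0" using \<theta> by simp
      ultimately show ?thesis by linarith
    qed
    finally have "sqrt (a + (norm (s, v))\<^sup>2) \<le> \<bar>s\<bar> * (1 + 2 * \<theta>)"
      using \<theta> by (intro real_le_lsqrt) auto
    then have "1 / (\<bar>s\<bar> * (1 + 2 * \<theta>)) \<le> 1 / sqrt (a + (norm (s, v))\<^sup>2)"
      using True r \<theta> pos[of s] by (intro divide_left_mono mult_pos_pos) auto
    then show ?thesis using True 1 2 by (simp add: h_def indicator_def mult.commute)
  next
    case False
    then have "h s = 0" by (simp add: h_def)
    then show ?thesis using f0[of s] by simp
  qed
  have fm: "?f \<in> borel_measurable borel"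
  proof -
    have "continuous_on UNIV (\<lambda>s. (s, v))" by (intro continuous_intros)
    from closed_vimage[OF shell_closed this, of r]
    have "(\<lambda>s. (s, v)) -` {z. p z \<le> 1 \<and> r \<le> norm z} \<in> sets borel" by (rule borel_closed)
    then have [measurable]: "{s. p (s, v) \<le> 1 \<and> r \<le> norm (s, v)} \<in> sets borel" by (simp add: vimage_def)
    have "(\<lambda>s. indicator {s. p (s, v) \<le> 1 \<and> r \<le> norm (s, v)} s * (1 / sqrt (a + (s\<^sup>2 + (norm v)\<^sup>2)))) \<in> borel_measurable borel"
      by measurable
    then show ?thesis by (simp add: indicator_def norm_sq_Pair)
  qed
  have g': "integrable lborel g" "integral\<^sup>L lborel g = 2 * (ln (l * (1 + \<theta>)) - ln (r * (1 - \<theta>)))"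
    using g by (simp_all add: has_bochner_integral_iff)
  have h': "integrable lborel h" "integral\<^sup>L lborel h = 2 * (ln (l * (1 - \<theta>)) - ln r)"
    using h by (simp_all add: has_bochner_integral_iff)
  have fi: "integrable lborel ?f"
  proof (rule Bochner_Integration.integrable_bound[OF g'(1)])
    have "norm (?f s) \<le> norm (g s)" for s
      using f0[of s] fg[of s] unfolding real_norm_def by linarith
    then show "AE s in lborel. norm (?f s) \<le> norm (g s)" by simp
    show "?f \<in> borel_measurable lborel" using fm by simp
  qed
  define X where "X = ln l - ln r"
  have X: "0 \<le> X" "X \<le> M / r"
  proof -
    show "0 \<le> X" using l r by (simp add: X_def)
    have "ln (l / r) \<le> l / r" using l r by (intro ln_bound) simp
    also have "\<dots> \<le> M / r" using l r by (simp add: divide_right_mono)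
    finally show "X \<le> M / r" using l r by (simp add: X_def ln_div)
  qed
  have ln1: "ln (1 + \<theta>) \<le> \<theta>" using \<theta> by (intro ln_add_one_self_le_self) simp
  have ln2: "- ln (1 - \<theta>) \<le> 2 * \<theta>"
  proof -
    have "ln (1 / (1 - \<theta>)) \<le> 1 / (1 - \<theta>) - 1" using \<theta> by (intro ln_le_minus_one) simp
    also have "\<dots> \<le> 2 * \<theta>"
    proof -
      have "1 \<le> (1 + 2 * \<theta>) * (1 - \<theta>)"
        using \<theta> mult_left_mono[of \<theta> "1/2" \<theta>] by (simp add: algebra_simps)
      then have "1 / (1 - \<theta>) \<le> 1 + 2 * \<theta>" using \<theta> by (subst pos_divide_le_eq) auto
      then show ?thesis by simp
    qed
    finally show ?thesis using \<theta> by (simp add: ln_div)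
  qed
  have "integral\<^sup>L lborel ?f \<le> integral\<^sup>L lborel g"
    by (rule integral_mono[OF fi g'(1) fg])
  also have "\<dots> = 2 * (X + ln (1 + \<theta>) - ln (1 - \<theta>))"
    unfolding g'(2) X_def using l r \<theta> by (simp add: ln_mult)
  also have "\<dots> \<le> 2 * X + \<theta> * 6" using ln1 ln2 by simp
  finally have up: "integral\<^sup>L lborel ?f - 2 * X \<le> \<theta> * 6" by simp
  have "2 * X - 4 * \<theta> * (1 + X) \<le> 1 / (1 + 2 * \<theta>) * (2 * (X - 2 * \<theta>))"
  proof -
    have "(2 * X - 4 * \<theta> * (1 + X)) * (1 + 2 * \<theta>) = 2 * (X - 2 * \<theta>) - 8 * \<theta> * \<theta> * (1 + X)"
      by (simp add: algebra_simps)
    also have "\<dots> \<le> 2 * (X - 2 * \<theta>)" using X \<theta> by simp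
    finally show ?thesis using \<theta> by (simp add: pos_le_divide_eq)
  qed
  also have "\<dots> \<le> 1 / (1 + 2 * \<theta>) * integral\<^sup>L lborel h"
  proof (rule mult_left_mono)
    have "integral\<^sup>L lborel h = 2 * (X + ln (1 - \<theta>))"
      unfolding h'(2) X_def using l r \<theta> by (simp add: ln_mult)
    then show "2 * (X - 2 * \<theta>) \<le> integral\<^sup>L lborel h" using ln2 by simp
  qed (use \<theta> in simp)
  also have "\<dots> = (\<integral>s. 1 / (1 + 2 * \<theta>) * h s \<partial>lborel)" by simp
  also have "\<dots> \<le> integral\<^sup>L lborel ?f"
    by (rule integral_mono[OF integrable_mult_right[OF h'(1)] fi hf])
  finally have lo: "2 * X - integral\<^sup>L lborel ?f \<le> 4 * \<theta> * (1 + X)" by simp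
  have "4 * \<theta> * (1 + X) \<le> 4 * \<theta> * (1 + M / r)" using X \<theta> by (intro mult_left_mono) auto
  also have "\<dots> \<le> \<theta> * (4 * M / r + 6)" using \<theta> by (simp add: algebra_simps)
  finally have "2 * X - integral\<^sup>L lborel ?f \<le> \<theta> * (4 * M / r + 6)" using lo by linarith
  moreover have "\<theta> * 6 \<le> \<theta> * (4 * M / r + 6)" using \<theta> M r by (intro mult_left_mono) auto
  ultimately show ?thesis using up unfolding X_def[symmetric] by linarith
qed

lemma shell_measurable [measurable]: "{z. p z \<le> 1 \<and> r \<le> norm z} \<in> sets borel"
  by (rule borel_closed[OF shell_closed])

lemma shell_bounded: "bounded {z. p z \<le> 1 \<and> r \<le> norm z}"
  unfolding bounded_iff using ball_bounded by blast

lemma integrable_ridge_part: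
  assumes a: "a > 0"
  shows "integrable lborel (\<lambda>z. indicator {z. p z \<le> 1 \<and> r \<le> norm z} z *
     (ridge_gap a (snd z) / sqrt (a + (norm z)\<^sup>2)))"
proof (rule integrable_indicator_mult[OF shell_measurable shell_bounded, where B = "3 / sqrt a"])
  have "continuous_on UNIV (\<lambda>z :: real \<times> real \<times> real. ridge_gap a (snd z) / sqrt (a + (norm z)\<^sup>2))"
    unfolding ridge_gap_def using a
    by (intro continuous_intros ballI) (auto simp: add_pos_nonneg less_imp_neq[symmetric])
  then show "(\<lambda>z :: real \<times> real \<times> real. ridge_gap a (snd z) / sqrt (a + (norm z)\<^sup>2)) \<in> borel_measurable borel"
    by (rule borel_measurable_continuous_onI)
  fix z :: "real \<times> real \<times> real"
  have "\<bar>ridge_gap a (snd z) / sqrt (a + (norm z)\<^sup>2)\<bar> = ridge_gap a (snd z) / sqrt (a + (norm z)\<^sup>2)"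
    using ridge_gap_ge(2)[OF a, of "snd z"] a by simp
  also have "\<dots> \<le> 3 / sqrt a"
    using ridge_gap_ge(2)[OF a, of "snd z"] ridge_gap_bound[OF a, of "snd z"] a by (intro frac_le) auto
  finally show "\<bar>ridge_gap a (snd z) / sqrt (a + (norm z)\<^sup>2)\<bar> \<le> 3 / sqrt a" .
qed

text \<open>Slice along the axis. For \<open>norm v \<le> \<theta> * r\<close> the slice integral
  \<open>H v\<close> is close to \<open>2 * (ln l - ln r)\<close> by \<open>ray_integral\<close>.
  Further out \<open>H\<close> is bounded and the tail of \<open>ridge_gap\<close> is at most
  \<open>a / (\<theta> * r)\<^sup>2\<close>, so for fixed \<open>\<theta>\<close> the error there is
  of order \<open>a\<close>.\<close>

lemma ridge_part_asymptotics:
  fixes a \<theta> :: real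
  defines "r \<equiv> r0 / 2" and "l \<equiv> 1 / p (1, 0)"
  assumes \<theta>: "0 < \<theta>" "\<theta> \<le> 1 / 2" and a: "0 < a" "a \<le> (\<theta> * r)\<^sup>2"
  shows "\<bar>(\<integral>z. indicator {z. p z \<le> 1 \<and> r \<le> norm z} z * (ridge_gap a (snd z) / sqrt (a + (norm z)\<^sup>2)) \<partial>lborel)
      - 2 * (ln l - ln r) * ridge_mass M a\<bar>
    \<le> \<theta> * (4 * M / r + 6) * ridge_mass M a + 4 * M / r * (a / (\<theta> * r)\<^sup>2) * measure lborel (cball (0 :: real \<times> real) M)"
proof -
  have r: "r > 0" using norm_betweenD(1)[OF p] by (simp add: r_def)
  have l: "l > 0" "l \<le> M" "2 * r \<le> l" using axis_value by (simp_all add: l_def r_def)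
  have M: "M > 0" by (rule norm_betweenD(2)[OF p])
  define K where "K = {z. p z \<le> 1 \<and> r \<le> norm z}"
  define f where "f z = indicator K z * (ridge_gap a (snd z) / sqrt (a + (norm z)\<^sup>2))" for z
  define H where "H v = (\<integral>s. indicator K (s, v) * (1 / sqrt (a + (norm (s, v))\<^sup>2)) \<partial>lborel)" for v
  define X where "X = ln l - ln r"
  have X: "0 \<le> X" "X \<le> M / r"
  proof -
    show "0 \<le> X" using l r by (simp add: X_def)
    have "ln (l / r) \<le> l / r" using l r by (intro ln_bound) simp
    also have "\<dots> \<le> M / r" using l r by (simp add: divide_right_mono)
    finally show "X \<le> M / r" using l r by (simp add: X_def ln_div)
  qed
  have fi: "integrable lborel f" unfolding f_def K_def by (rule integrable_ridge_part[OF a(1)])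
  have fi': "integrable (lborel \<Otimes>\<^sub>M lborel) (case_prod (\<lambda>s v. f (s, v)))"
    using fi by (simp add: lborel_prod)
  have inner: "(\<integral>s. f (s, v) \<partial>lborel) = ridge_gap a v * H v" for v
  proof -
    have "(\<integral>s. f (s, v) \<partial>lborel) = (\<integral>s. ridge_gap a v * (indicator K (s, v) * (1 / sqrt (a + (norm (s, v))\<^sup>2))) \<partial>lborel)"
      by (simp add: f_def mult_ac)
    then show ?thesis by (simp only: H_def integral_mult_right_zero)
  qed
  have Hi: "integrable lborel (\<lambda>v. ridge_gap a v * H v)"
    using lborel_pair.integrable_snd[OF fi'] by (simp add: inner)
  have F: "integral\<^sup>L lborel f = (\<integral>v. ridge_gap a v * H v \<partial>lborel)"
    using lborel_pair.integral_snd[OF fi'] by (simp add: inner lborel_prod)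
  have qi: "integrable lborel (\<lambda>v. indicator (cball 0 M) v * ridge_gap a v)"
    by (rule integrable_ridge_gap[OF a(1)]) auto
  have Kn: "norm v \<le> M" "\<bar>s\<bar> \<le> M" if "(s, v) \<in> K" for s v
    using that ball_bounded[of "(s, v)"] norm_snd_le[of v s] norm_fst_le[of s v] by (auto simp: K_def)
  have H0: "H v = 0" if "norm v > M" for v
  proof -
    have "(s, v) \<notin> K" for s using that Kn[of s v] by linarith
    then show ?thesis by (simp add: H_def)
  qed
  have H1: "0 \<le> H v" "H v \<le> 2 * M / r" for v
  proof -
    have pos: "a + (norm (s, v))\<^sup>2 > 0" for s using a by (simp add: add_pos_nonneg)
    show "0 \<le> H v" unfolding H_def 
      by (intro integral_nonneg_AE AE_I2 mult_nonneg_nonneg divide_nonneg_nonneg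
          real_sqrt_ge_zero less_imp_le[OF pos]) auto
    show "H v \<le> 2 * M / r"
    proof (cases "integrable lborel (\<lambda>s. indicator K (s, v) * (1 / sqrt (a + (norm (s, v))\<^sup>2)))")
      case True
      have "H v \<le> (\<integral>s. (1 / r) * indicator {-M..M} s \<partial>lborel)"
        unfolding H_def
      proof (rule integral_mono[OF True])
        show "integrable lborel (\<lambda>s. (1 / r) * indicator {-M..M} s)" using M by simp
        fix s
        show "indicator K (s, v) * (1 / sqrt (a + (norm (s, v))\<^sup>2)) \<le> (1 / r) * indicator {-M..M} s"
        proof (cases "(s, v) \<in> K")
          case True
          then have "r\<^sup>2 \<le> (norm (s, v))\<^sup>2" using r by (intro power_mono) (auto simp: K_def)
          then have "r \<le> sqrt (a + (norm (s, v))\<^sup>2)" using a by (intro real_le_rsqrt) linarith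
          then have "1 / sqrt (a + (norm (s, v))\<^sup>2) \<le> 1 / r" using r by (intro frac_le) auto
          then show ?thesis using True Kn(2)[OF True] by (simp add: abs_le_iff)
        qed (use r in simp)
      qed
      also have "\<dots> = 2 * M / r" using M by simp
      finally show ?thesis .
    next
      case False
      \<comment> \<open>A Bochner integral that does not exist has the value 0, which obeys the
        bound too.\<close>
      then have "H v = 0" unfolding H_def by (rule not_integrable_integral_eq)
      then show ?thesis using M r by simp
    qed
  qed
  define c where "c = \<theta> * (4 * M / r + 6)"
  define d where "d = 4 * M / r * (a / (\<theta> * r)\<^sup>2)"
  have cd: "c \<ge> 0" "d \<ge> 0" using \<theta> M r a by (simp_all add: c_def d_def)
  have pt: "\<bar>ridge_gap a v * H v - 2 * X * (indicator (cball 0 M) v * ridge_gap a v)\<bar> \<le>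
      c * (indicator (cball 0 M) v * ridge_gap a v) + d * indicator (cball 0 M) v" for v
  proof -
    note q0 = ridge_gap_ge(2)[OF a(1), of v]
    consider "norm v > M" | "norm v \<le> M" "norm v \<le> \<theta> * r" | "norm v \<le> M" "norm v > \<theta> * r" by linarith
    then show ?thesis
    proof cases
      case 1
      then show ?thesis using H0 by simp
    next
      case 2
      have "\<bar>H v - 2 * X\<bar> \<le> c"
        using ray_integral[OF \<theta>, of v a] 2 a unfolding H_def K_def X_def c_def r_def l_def by simp
      then have "ridge_gap a v * \<bar>H v - 2 * X\<bar> \<le> ridge_gap a v * c" using q0 by (intro mult_left_mono)
      moreover have "\<bar>ridge_gap a v * H v - 2 * X * ridge_gap a v\<bar> = ridge_gap a v * \<bar>H v - 2 * X\<bar>"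
      proof -
        have "ridge_gap a v * H v - 2 * X * ridge_gap a v = ridge_gap a v * (H v - 2 * X)"
          by (simp add: algebra_simps)
        then show ?thesis using q0 by (simp add: abs_mult)
      qed
      ultimately show ?thesis using 2 cd by (simp add: mult.commute)
    next
      case 3
      have tr: "\<theta> * r > 0" using \<theta> r by simp
      then have v0: "v \<noteq> 0" using 3 by auto
      have "\<bar>H v - 2 * X\<bar> \<le> 4 * M / r" using H1[of v] X by (simp add: abs_le_iff)
      moreover have "ridge_gap a v \<le> a / (\<theta> * r)\<^sup>2"
      proof -
        have "(\<theta> * r)\<^sup>2 \<le> (norm v)\<^sup>2" using 3 tr by (intro power_mono) auto
        then have "a / (norm v)\<^sup>2 \<le> a / (\<theta> * r)\<^sup>2" using a tr by (intro frac_le) auto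
        then show ?thesis using ridge_gap_le[OF a(1) v0] by linarith
      qed
      ultimately have "\<bar>H v - 2 * X\<bar> * ridge_gap a v \<le> d"
        unfolding d_def using q0 M r by (intro mult_mono) auto
      moreover have "\<bar>ridge_gap a v * H v - 2 * X * ridge_gap a v\<bar> = \<bar>H v - 2 * X\<bar> * ridge_gap a v"
      proof -
        have "ridge_gap a v * H v - 2 * X * ridge_gap a v = (H v - 2 * X) * ridge_gap a v"
          by (simp add: algebra_simps)
        then show ?thesis using q0 by (simp add: abs_mult)
      qed
      moreover have "c * ridge_gap a v \<ge> 0" using cd q0 by simp
      ultimately show ?thesis using 3 by simp
    qed
  qed
  have "integral\<^sup>L lborel f - 2 * X * ridge_mass M a =
      (\<integral>v. ridge_gap a v * H v - 2 * X * (indicator (cball 0 M) v * ridge_gap a v) \<partial>lborel)"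
    unfolding F ridge_mass_def using Hi qi by simp
  also have "\<bar>\<dots>\<bar> \<le> (\<integral>v. c * (indicator (cball 0 M) v * ridge_gap a v) + d * indicator (cball 0 M) v \<partial>lborel)"
  proof (rule integral_abs_bound[THEN order_trans], rule integral_mono)
    show "integrable lborel (\<lambda>v. \<bar>ridge_gap a v * H v - 2 * X * (indicator (cball 0 M) v * ridge_gap a v)\<bar>)"
      using Hi qi by (intro integrable_abs Bochner_Integration.integrable_diff integrable_mult_right)
    show "integrable lborel (\<lambda>v :: real \<times> real. c * (indicator (cball 0 M) v * ridge_gap a v) + d * indicator (cball 0 M) v)"
      using qi by (intro Bochner_Integration.integrable_add integrable_mult_right) simp_all
  qed (rule pt)
  also have "\<dots> = c * ridge_mass M a + d * measure lborel (cball (0 :: real \<times> real) M)"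
    unfolding ridge_mass_def using qi by (subst Bochner_Integration.integral_add) simp_all
  finally show ?thesis unfolding c_def d_def X_def f_def K_def .
qed

text \<open>On the shell the two inverse roots differ by at most \<open>a / r ^ 3\<close>. The
  logarithmic factor tends to a singularity at the axis as \<open>a\<close> tends to 0, but it is
  dominated by the logarithm of a single transverse coordinate, so that the majorant
  \<open>G\<close> is a product of one-variable functions. The result is of order \<open>a\<close>
  with a constant that depends only on \<open>r0\<close> and \<open>M\<close>.\<close>

lemma log_part_bound:
  fixes a :: real
  defines "r \<equiv> r0 / 2" and
    "G \<equiv> (\<lambda>z :: real \<times> real \<times> real. indicator {-M..M} (fst z) *
      ((indicator {-M..M} (fst (snd z)) * (M\<^sup>2 + 2 * \<bar>ln \<bar>fst (snd z)\<bar>\<bar>)) * indicator {-M..M} (snd (snd z))))"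
    and "g \<equiv> (\<lambda>z :: real \<times> real \<times> real. (1 / sqrt (a / 4 + (norm z)\<^sup>2) - 1 / sqrt (a + (norm z)\<^sup>2)) *
      ln (a / 4 + (norm (snd z))\<^sup>2) / 2)"
  assumes a: "0 < a" "a \<le> 1"
  shows "integrable lborel (\<lambda>z. indicator {z. p z \<le> 1 \<and> r \<le> norm z} z * g z)"
    and "\<bar>\<integral>z. indicator {z. p z \<le> 1 \<and> r \<le> norm z} z * g z \<partial>lborel\<bar> \<le> a / r ^ 3 * integral\<^sup>L lborel G"
proof -
  have r: "r > 0" using norm_betweenD(1)[OF p] by (simp add: r_def)
  have M: "M > 0" by (rule norm_betweenD(2)[OF p])
  define K where "K = {z. p z \<le> 1 \<and> r \<le> norm z}"
  have iM: "integrable lborel (indicator {-M..M} :: real \<Rightarrow> real)"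
    using M by (intro integrable_real_indicator) auto
  have "integrable lborel (\<lambda>s :: real. indicator {-M..M} s * (M\<^sup>2 + 2 * \<bar>ln \<bar>s\<bar>\<bar>))"
  proof -
    have "integrable lborel (\<lambda>s :: real. M\<^sup>2 * indicator {-M..M} s + 2 * (indicator {-M..M} s * \<bar>ln \<bar>s\<bar>\<bar>))"
      by (intro Bochner_Integration.integrable_add integrable_mult_right iM integrable_abs_ln)
    then show ?thesis by (simp add: algebra_simps)
  qed
  from integrable_lborel_prod[OF iM integrable_lborel_prod[OF this iM]]
  have Gi: "integrable lborel G" unfolding G_def .
  have pt: "\<bar>indicator K z * g z\<bar> \<le> a / r ^ 3 * G z" if nz: "fst (snd z) \<noteq> 0" for z
  proof (cases "z \<in> K")
    case True
    define b where "b = \<bar>fst (snd z)\<bar>"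
    have b: "b > 0" using nz by (simp add: b_def)
    have nM: "norm z \<le> M" using True by (intro ball_bounded) (simp add: K_def)
    have n1: "norm (snd z) \<le> M" using nM norm_snd_le[of "snd z" "fst z"] by simp
    have bn: "b \<le> norm (snd z)" unfolding b_def using norm_fst_le[of "fst (snd z)" "snd (snd z)"] by simp
    have c: "\<bar>fst z\<bar> \<le> M" "\<bar>fst (snd z)\<bar> \<le> M" "\<bar>snd (snd z)\<bar> \<le> M"
      using nM n1 norm_fst_le[of "fst z" "snd z"] bn norm_snd_le[of "snd (snd z)" "fst (snd z)"]
      by (auto simp: b_def)
    have Gz: "G z = M\<^sup>2 + 2 * \<bar>ln b\<bar>" using c by (simp add: G_def b_def abs_le_iff)
    define A1 where "A1 = sqrt (a / 4 + (norm z)\<^sup>2)"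
    define A2 where "A2 = sqrt (a + (norm z)\<^sup>2)"
    have rz: "r\<^sup>2 \<le> (norm z)\<^sup>2" using True r by (intro power_mono) (auto simp: K_def)
    have A: "r \<le> A1" "r \<le> A2" "A1 \<le> A2"
    proof -
      have "r\<^sup>2 \<le> a / 4 + (norm z)\<^sup>2" "r\<^sup>2 \<le> a + (norm z)\<^sup>2" using rz a by linarith+
      then show "r \<le> A1" "r \<le> A2" unfolding A1_def A2_def by (auto intro: real_le_rsqrt)
      show "A1 \<le> A2" unfolding A1_def A2_def using a by (intro real_sqrt_le_mono) simp
    qed
    have "(A2 - A1) * (A2 + A1) = A2\<^sup>2 - A1\<^sup>2" by (simp add: power2_eq_square algebra_simps)
    also have "\<dots> = 3 * a / 4" using a by (simp add: A1_def A2_def add_nonneg_nonneg)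
    finally have d: "(A2 - A1) * (A2 + A1) = 3 * a / 4" .
    have "(A2 - A1) * r \<le> (A2 - A1) * (A2 + A1)" using A r by (intro mult_left_mono) auto
    then have "(A2 - A1) * r \<le> a" using d a by simp
    then have d2: "A2 - A1 \<le> a / r" using r by (simp add: pos_le_divide_eq)
    have e: "1 / A1 - 1 / A2 = (A2 - A1) / (A1 * A2)" using A r by (simp add: field_simps)
    also have "\<dots> \<le> (a / r) / (r * r)"
      using d2 A r by (intro frac_le mult_mono) auto
    also have "\<dots> = a / r ^ 3" by (simp add: power3_eq_cube)
    finally have f1: "1 / A1 - 1 / A2 \<le> a / r ^ 3" .
    have f0: "0 \<le> 1 / A1 - 1 / A2" unfolding e using A r by simp
    have p1: "a / 4 + (norm (snd z))\<^sup>2 > 0" using norm_sq_pos[of "a / 4"] a by simp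
    have L: "\<bar>ln (a / 4 + (norm (snd z))\<^sup>2)\<bar> \<le> M\<^sup>2 + 2 * \<bar>ln b\<bar>"
    proof -
      have "ln (a / 4 + (norm (snd z))\<^sup>2) \<le> a / 4 + (norm (snd z))\<^sup>2 - 1" using p1 by (rule ln_le_minus_one)
      also have "\<dots> \<le> M\<^sup>2" using a n1 power_mono[OF n1, of 2] by simp
      finally have u: "ln (a / 4 + (norm (snd z))\<^sup>2) \<le> M\<^sup>2" .
      have "b\<^sup>2 \<le> a / 4 + (norm (snd z))\<^sup>2" using power_mono[OF bn, of 2] b a by linarith
      then have "ln (b\<^sup>2) \<le> ln (a / 4 + (norm (snd z))\<^sup>2)" using b p1 by (subst ln_le_cancel_iff) auto
      then have "2 * ln b \<le> ln (a / 4 + (norm (snd z))\<^sup>2)" using b by (simp add: ln_realpow)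
      moreover have "M\<^sup>2 \<ge> 0" by simp
      ultimately show ?thesis using u by linarith
    qed
    have "\<bar>g z\<bar> = (1 / A1 - 1 / A2) * \<bar>ln (a / 4 + (norm (snd z))\<^sup>2)\<bar> / 2"
      using f0 by (simp add: g_def abs_mult flip: A1_def A2_def)
    also have "\<dots> \<le> (1 / A1 - 1 / A2) * \<bar>ln (a / 4 + (norm (snd z))\<^sup>2)\<bar>"
      using f0 by simp
    also have "\<dots> \<le> a / r ^ 3 * (M\<^sup>2 + 2 * \<bar>ln b\<bar>)"
      using f0 f1 L by (intro mult_mono) auto
    finally show ?thesis using True Gz by simp
  next
    case False
    have "G z \<ge> 0" by (simp add: G_def)
    then show ?thesis using False a r by simp
  qed
  \<comment> \<open>The plane on which the chosen coordinate vanishes has to be excluded: there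
    \<open>ln 0 = 0\<close> could spoil the domination.\<close>
  have "(0, 1, 0) \<noteq> (0 :: real \<times> real \<times> real)" by (simp add: zero_prod_def)
  from AE_inner_nonzero[OF this]
  have ae: "AE z in lborel. \<bar>indicator K z * g z\<bar> \<le> a / r ^ 3 * G z"
    by eventually_elim (rule pt, simp add: inner_prod_def)
  have gm: "g \<in> borel_measurable borel"
  proof -
    have "a / 4 + (norm v)\<^sup>2 > 0" "a + (norm v)\<^sup>2 > 0" for v :: "real \<times> real \<times> real" using a by (simp_all add: add_pos_nonneg)
    moreover have "a / 4 + (norm v)\<^sup>2 > 0" for v :: "real \<times> real" using a by (simp add: add_pos_nonneg)
    ultimately have "continuous_on UNIV g"
      unfolding g_def by (intro continuous_intros ballI) (auto simp: less_imp_neq[symmetric])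
    then show ?thesis by (rule borel_measurable_continuous_onI)
  qed
  have G': "integrable lborel (\<lambda>z. a / r ^ 3 * G z)" by (intro integrable_mult_right Gi)
  show i: "integrable lborel (\<lambda>z. indicator {z. p z \<le> 1 \<and> r \<le> norm z} z * g z)"
  proof (rule Bochner_Integration.integrable_bound[OF G'])
    show "(\<lambda>z. indicator {z. p z \<le> 1 \<and> r \<le> norm z} z * g z) \<in> borel_measurable lborel"
      using gm by simp
    show "AE z in lborel. norm (indicator {z. p z \<le> 1 \<and> r \<le> norm z} z * g z) \<le> norm (a / r ^ 3 * G z)"
      using ae unfolding real_norm_def K_def by eventually_elim (rule order_trans[OF _ abs_ge_self])
  qed
  have "\<bar>\<integral>z. indicator K z * g z \<partial>lborel\<bar> \<le> (\<integral>z. a / r ^ 3 * G z \<partial>lborel)"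
    using i G' ae unfolding K_def
    by (intro integral_abs_bound[THEN order_trans] integral_mono_AE integrable_abs)
  then show "\<bar>\<integral>z. indicator {z. p z \<le> 1 \<and> r \<le> norm z} z * g z \<partial>lborel\<bar> \<le> a / r ^ 3 * integral\<^sup>L lborel G"
    unfolding K_def by simp
qed

end

text \<open>The kernel is \<open>g - h / 2\<close> with the ridge part \<open>h\<close> and the
  logarithmic part \<open>g\<close>. First \<open>\<theta>\<close> is fixed so that the relative
  error of \<open>h\<close> is at most \<open>\<eta>\<close>, of which the factor
  \<open>1 / 2\<close> leaves one half. Then \<open>C\<close> is chosen in terms of
  \<open>\<theta>\<close>, and for small \<open>a\<close> all terms of order \<open>a\<close> fit
  into the other half.\<close>

lemma shell_asymptotics:
  assumes "0 < r0" "0 < M" and \<eta>: "0 < \<eta>"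
  shows "\<exists>a0>0. \<forall>a p. 0 < a \<longrightarrow> a < a0 \<longrightarrow> norm_between r0 M p \<longrightarrow>
     integrable lborel (\<lambda>z. indicator {z. p z \<le> 1 \<and> r0 / 2 \<le> norm z} z *
        log_kernel a ((norm z)\<^sup>2) ((norm (snd z))\<^sup>2)) \<and>
     \<bar>(\<integral>z. indicator {z. p z \<le> 1 \<and> r0 / 2 \<le> norm z} z *
        log_kernel a ((norm z)\<^sup>2) ((norm (snd z))\<^sup>2) \<partial>lborel) -
       ridge_mass M a * (ln (p (1 :: real, 0 :: real \<times> real)) + ln (r0 / 2))\<bar> \<le> \<eta> * ridge_mass M a"
proof -
  define r where "r = r0 / 2"
  have r: "r > 0" using assms by (simp add: r_def)
  define G where "G z = indicator {-M..M} (fst z) *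
      ((indicator {-M..M} (fst (snd z)) * (M\<^sup>2 + 2 * \<bar>ln \<bar>fst (snd z)\<bar>\<bar>)) * indicator {-M..M} (snd (snd z)))"
    for z :: "real \<times> real \<times> real"
  define \<theta> where "\<theta> = min (1 / 2) (\<eta> / (4 * M / r + 6))"
  have q: "4 * M / r + 6 > 0" using r assms by (simp add: add_pos_pos)
  have \<theta>: "0 < \<theta>" "\<theta> \<le> 1 / 2"
    using q \<eta> min.cobounded1[of "1 / 2" "\<eta> / (4 * M / r + 6)"] by (simp add: \<theta>_def) (simp only: \<theta>_def)
  have \<theta>2: "\<theta> * (4 * M / r + 6) \<le> \<eta>"
  proof -
    have "\<theta> \<le> \<eta> / (4 * M / r + 6)" by (simp add: \<theta>_def)
    then show ?thesis using q by (simp add: pos_le_divide_eq)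
  qed
  define V where "V = measure lborel (cball (0 :: real \<times> real) M)"
  define C where "C = (2 / \<eta>) * (integral\<^sup>L lborel G / r ^ 3 + 2 * M / r * (1 / (\<theta> * r)\<^sup>2) * V)"
  obtain a1 where a1: "a1 > 0" "\<And>a. 0 < a \<Longrightarrow> a < a1 \<Longrightarrow> C * a \<le> ridge_mass M a"
    using ridge_mass_dominates[OF assms(2), of C] by blast
  define a0 where "a0 = min a1 (min 1 ((\<theta> * r)\<^sup>2))"
  have "a0 > 0" using a1 \<theta> r by (simp add: a0_def)
  moreover have "integrable lborel (\<lambda>z. indicator {z. p z \<le> 1 \<and> r \<le> norm z} z *
        log_kernel a ((norm z)\<^sup>2) ((norm (snd z))\<^sup>2)) \<and>
     \<bar>(\<integral>z. indicator {z. p z \<le> 1 \<and> r \<le> norm z} z *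
        log_kernel a ((norm z)\<^sup>2) ((norm (snd z))\<^sup>2) \<partial>lborel) -
       ridge_mass M a * (ln (p (1 :: real, 0 :: real \<times> real)) + ln r)\<bar> \<le> \<eta> * ridge_mass M a"
    if a: "0 < a" "a < a0" and p: "norm_between r0 M p" for a p
  proof -
    have a': "a \<le> 1" "a \<le> (\<theta> * r)\<^sup>2" "a < a1" using a by (simp_all add: a0_def)
    define K where "K = {z. p z \<le> 1 \<and> r \<le> norm z}"
    define g where "g z = (1 / sqrt (a / 4 + (norm z)\<^sup>2) - 1 / sqrt (a + (norm z)\<^sup>2)) *
      ln (a / 4 + (norm (snd z))\<^sup>2) / 2" for z :: "real \<times> real \<times> real"
    define h where "h z = ridge_gap a (snd z) / sqrt (a + (norm z)\<^sup>2)" for z :: "real \<times> real \<times> real"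
    define X where "X = ln (1 / p (1, 0)) - ln r"
    have gi: "integrable lborel (\<lambda>z. indicator K z * g z)"
      and gb: "\<bar>\<integral>z. indicator K z * g z \<partial>lborel\<bar> \<le> a / r ^ 3 * integral\<^sup>L lborel G"
      using log_part_bound[OF p a(1) a'(1)] unfolding K_def g_def G_def r_def by simp_all
    have hi: "integrable lborel (\<lambda>z. indicator K z * h z)"
      using integrable_ridge_part[OF p a(1)] unfolding K_def h_def .
    have hb: "\<bar>(\<integral>z. indicator K z * h z \<partial>lborel) - 2 * X * ridge_mass M a\<bar>
      \<le> \<theta> * (4 * M / r + 6) * ridge_mass M a + 4 * M / r * (a / (\<theta> * r)\<^sup>2) * V"
      using ridge_part_asymptotics[OF p \<theta> a(1) a'(2)[unfolded r_def]] unfolding K_def h_def X_def V_def r_def .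
    have mass: "ridge_mass M a \<ge> 0"
      unfolding ridge_mass_def using ridge_gap_ge(2)[OF a(1)] by (intro integral_nonneg_AE) simp
    have "log_kernel a ((norm z)\<^sup>2) ((norm (snd z))\<^sup>2) = g z - h z / 2" for z
      by (simp add: log_kernel_def g_def h_def ridge_gap_def algebra_simps diff_divide_distrib)
    note lk = this
    have eq: "(\<lambda>z. indicator K z * log_kernel a ((norm z)\<^sup>2) ((norm (snd z))\<^sup>2)) =
        (\<lambda>z. indicator K z * g z - indicator K z * h z / 2)"
      unfolding lk by (simp add: right_diff_distrib)
    have i: "integrable lborel (\<lambda>z. indicator K z * g z - indicator K z * h z / 2)"
      using gi hi by (intro Bochner_Integration.integrable_diff integrable_divide)
    have I: "(\<integral>z. indicator K z * g z - indicator K z * h z / 2 \<partial>lborel) =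
        (\<integral>z. indicator K z * g z \<partial>lborel) - (\<integral>z. indicator K z * h z \<partial>lborel) / 2"
      using gi hi by simp
    have Xp: "ln (p (1, 0)) + ln r = - X"
      using axis_value(1)[OF p] by (simp add: X_def ln_div)
    have "C * a \<le> ridge_mass M a" by (rule a1(2)[OF a(1) a'(3)])
    then have "(\<eta> / 2) * (C * a) \<le> (\<eta> / 2) * ridge_mass M a" using \<eta> by (intro mult_left_mono) auto
    moreover have "(\<eta> / 2) * (C * a) = a / r ^ 3 * integral\<^sup>L lborel G + 4 * M / r * (a / (\<theta> * r)\<^sup>2) * V / 2"
      using \<eta> by (simp add: C_def algebra_simps)
    ultimately have small: "a / r ^ 3 * integral\<^sup>L lborel G + 4 * M / r * (a / (\<theta> * r)\<^sup>2) * V / 2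
        \<le> (\<eta> / 2) * ridge_mass M a" by metis
    have main: "\<theta> * (4 * M / r + 6) * ridge_mass M a \<le> \<eta> * ridge_mass M a"
      using \<theta>2 mass by (rule mult_right_mono)
    have comb: "\<bar>A - B / 2 - m * (- X)\<bar> \<le> \<eta> * m"
      if "\<bar>A\<bar> \<le> e1" "\<bar>B - 2 * X * m\<bar> \<le> e2 + e3" "e1 + e3 / 2 \<le> (\<eta> / 2) * m" "e2 \<le> \<eta> * m" for A B m e1 e2 e3
    proof -
      have e: "A - B / 2 - m * (- X) = A - (B - 2 * X * m) / 2" by (simp add: diff_divide_distrib)
      have n: "(\<eta> / 2) * m = (\<eta> * m) / 2" by simp
      have "\<bar>A - t / 2\<bar> \<le> n" if "\<bar>t\<bar> \<le> e2 + e3" "e1 + e3 / 2 \<le> n / 2" "e2 \<le> n" for t n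
        using \<open>\<bar>A\<bar> \<le> e1\<close> that by linarith
      from this[OF that(2) that(3)[unfolded n] that(4)] show ?thesis unfolding e .
    qed
    have "\<bar>(\<integral>z. indicator K z * g z \<partial>lborel) - (\<integral>z. indicator K z * h z \<partial>lborel) / 2 -
        ridge_mass M a * (- X)\<bar> \<le> \<eta> * ridge_mass M a"
      by (rule comb[OF gb hb small main])
    then show ?thesis using i unfolding K_def[symmetric] eq I Xp by blast
  qed
  ultimately show ?thesis unfolding r_def by blast
qed

section \<open>From frame coordinates to arbitrary directions, and the total mass\<close>

lemma integrable_indicator_continuous:
  fixes f :: "'a::euclidean_space \<Rightarrow> real"
  assumes S: "S \<in> sets borel" "bounded S" and f: "continuous_on UNIV f"
  shows "integrable lborel (\<lambda>x. indicator S x * f x)"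
proof -
  have "compact (f ` closure S)"
    using S f by (intro compact_continuous_image) (auto intro: continuous_on_subset)
  then obtain B where B: "\<And>x. x \<in> closure S \<Longrightarrow> \<bar>f x\<bar> \<le> B"
    using compact_imp_bounded by (fastforce simp: bounded_iff)
  show ?thesis
    by (rule integrable_indicator_mult[OF S borel_measurable_continuous_onI[OF f], of B])
       (use B closure_subset in blast)
qed

lemma norm_between_frame:
  assumes U: "frame U" and p: "norm_between r M p"
  shows "norm_between r M (\<lambda>z. p (U z))"
proof -
  note lin = frame_linear[OF U]
  have "continuous_on UNIV (\<lambda>z. p (U z))"
    using continuous_on_compose2[OF norm_betweenD(3)[OF p], of UNIV U] lin
    by (simp add: linear_continuous_on linear_linear)
  then show ?thesis
    unfolding norm_between_def
    using norm_betweenD(1,2)[OF p] norm_betweenD(4-7)[OF p] frame_norm[OF U]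
    by (auto simp only: linear_add[OF lin] linear_scale[OF lin] simp flip: frame_norm[OF U])
qed

lemma unit_ball_measurable:
  assumes p: "norm_between r M p"
  shows "{y. p y \<le> 1} \<in> sets borel" "bounded {y :: 'a::euclidean_space. p y \<le> 1}"
proof -
  show "{y. p y \<le> 1} \<in> sets borel"
    by (intro borel_closed closed_Collect_le continuous_intros norm_betweenD(3)[OF p])
  have "norm y \<le> M" if "p y \<le> 1" for y
  proof -
    have "M * p y \<le> M * 1" using that norm_betweenD(2)[OF p] by (intro mult_left_mono) auto
    then show ?thesis using norm_betweenD(7)[OF p, of y] by simp
  qed
  then show "bounded {y. p y \<le> 1}" unfolding bounded_iff by blast
qed

lemma continuous_on_log_kernel:
  assumes a: "a > 0" and f: "continuous_on UNIV f" "\<And>y. f y \<ge> 0"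
  shows "continuous_on UNIV (\<lambda>y :: 'a::euclidean_space. log_kernel a ((norm y)\<^sup>2) (f y))"
proof -
  have "a / 4 + (norm y)\<^sup>2 > 0" "a + (norm y)\<^sup>2 > 0" "a / 4 + f y > 0" "a + f y > 0" for y
    using a f(2)[of y] by (simp_all add: add_pos_nonneg)
  then show ?thesis
    unfolding log_kernel_def by (intro continuous_intros f ballI) (auto simp: less_imp_neq[symmetric])
qed

lemma axis_distance_nonneg:
  fixes x y :: "'a::real_inner"
  assumes "norm x = 1" shows "0 \<le> (norm y)\<^sup>2 - (x \<bullet> y)\<^sup>2"
  using Cauchy_Schwarz_ineq[of x y] assms by (simp flip: power2_norm_eq_inner)

definition ball_kernel :: "real \<Rightarrow> real \<Rightarrow> real" where
  "ball_kernel r a = (\<integral>z. indicator (ball 0 r) z * log_kernel a ((norm z)\<^sup>2) ((norm (snd z))\<^sup>2)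
     \<partial>(lborel :: (real \<times> real \<times> real) measure))"

lemma frame_kernel:
  assumes U: "frame U"
  shows "(norm (U z))\<^sup>2 - (U (1, 0) \<bullet> U z)\<^sup>2 = (norm (snd z))\<^sup>2"
  by (cases z) (simp add: frame_norm[OF U] frame_inner[OF U] inner_prod_def norm_prod_def)

text \<open>A frame with first axis \<open>x\<close> reduces this to
  \<open>shell_asymptotics\<close>, whose threshold depends neither on the rotated norm nor,
  therefore, on \<open>x\<close>. The ball of radius \<open>r0 / 2\<close> lies in the body, and its
  share \<open>ball_kernel\<close> is the same for all \<open>x\<close>.\<close>

lemma kernel_asymptotics:
  assumes r0: "0 < r0" and M: "0 < M" and \<eta>: "0 < \<eta>"
  shows "\<exists>a0>0. \<forall>a p x. 0 < a \<longrightarrow> a < a0 \<longrightarrow> norm_between r0 M (p :: real^3 \<Rightarrow> real) \<longrightarrow> norm x = 1 \<longrightarrow>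
     \<bar>(\<integral>y. indicator {y. p y \<le> 1} y * log_kernel a ((norm y)\<^sup>2) ((norm y)\<^sup>2 - (x \<bullet> y)\<^sup>2) \<partial>lborel) -
       (ball_kernel (r0 / 2) a + ridge_mass M a * (ln (p x) + ln (r0 / 2)))\<bar> \<le> \<eta> * ridge_mass M a"
proof -
  obtain a0 where a0: "a0 > 0" and main: "\<And>a p. 0 < a \<Longrightarrow> a < a0 \<Longrightarrow> norm_between r0 M p \<Longrightarrow>
     integrable lborel (\<lambda>z. indicator {z. p z \<le> 1 \<and> r0 / 2 \<le> norm z} z *
        log_kernel a ((norm z)\<^sup>2) ((norm (snd z))\<^sup>2)) \<and>
     \<bar>(\<integral>z. indicator {z. p z \<le> 1 \<and> r0 / 2 \<le> norm z} z *
        log_kernel a ((norm z)\<^sup>2) ((norm (snd z))\<^sup>2) \<partial>lborel) -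
       ridge_mass M a * (ln (p (1 :: real, 0 :: real \<times> real)) + ln (r0 / 2))\<bar> \<le> \<eta> * ridge_mass M a"
    using shell_asymptotics[OF assms] by blast
  show ?thesis
  proof (intro exI[of _ a0] conjI a0 allI impI)
    fix a and p :: "real^3 \<Rightarrow> real" and x :: "real^3"
    assume a: "0 < a" "a < a0" and p: "norm_between r0 M p" and x: "norm x = 1"
    obtain U where U: "frame U" "U (1, 0) = x" using frame_exists[OF x] .
    define q where "q z = p (U z)" for z
    have q: "norm_between r0 M q" unfolding q_def by (rule norm_between_frame[OF U(1) p])
    let ?k = "\<lambda>z :: real \<times> real \<times> real. log_kernel a ((norm z)\<^sup>2) ((norm (snd z))\<^sup>2)"
    let ?S = "{z. q z \<le> 1 \<and> r0 / 2 \<le> norm z}"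
    have m: "(\<lambda>y. indicator {y. p y \<le> 1} y * log_kernel a ((norm y)\<^sup>2) ((norm y)\<^sup>2 - (x \<bullet> y)\<^sup>2)) \<in> borel_measurable borel"
    proof -
      have "continuous_on UNIV (\<lambda>y. log_kernel a ((norm y)\<^sup>2) ((norm y)\<^sup>2 - (x \<bullet> y)\<^sup>2))"
        using axis_distance_nonneg[OF x] by (intro continuous_on_log_kernel a continuous_intros)
      from borel_measurable_integrable[OF integrable_indicator_continuous[OF unit_ball_measurable[OF p] this]]
      show ?thesis by simp
    qed
    have "(\<integral>y. indicator {y. p y \<le> 1} y * log_kernel a ((norm y)\<^sup>2) ((norm y)\<^sup>2 - (x \<bullet> y)\<^sup>2) \<partial>lborel) =
        (\<integral>z. indicator {z. q z \<le> 1} z * ?k z \<partial>lborel)"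
    proof -
      have k: "(norm (U z))\<^sup>2 - (x \<bullet> U z)\<^sup>2 = (norm (snd z))\<^sup>2" for z
        using frame_kernel[OF U(1), of z] by (simp only: U(2))
      have "log_kernel a ((norm (U z))\<^sup>2) ((norm (U z))\<^sup>2 - (x \<bullet> U z)\<^sup>2) = ?k z" for z
        by (subst k) (simp only: frame_norm[OF U(1)])
      then show ?thesis unfolding frame_integral[OF U(1) m] q_def by (simp add: indicator_def)
    qed
    also have "(\<lambda>z. indicator {z. q z \<le> 1} z * ?k z) = (\<lambda>z. indicator (ball 0 (r0 / 2)) z * ?k z + indicator ?S z * ?k z)"
    proof
      fix z
      have "q z \<le> 1" if "norm z < r0 / 2"
      proof -
        have "r0 * q z \<le> r0 * 1" using norm_betweenD(6)[OF q, of z] that r0 by linarith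
        then show ?thesis using r0 by simp
      qed
      then show "indicator {z. q z \<le> 1} z * ?k z = indicator (ball 0 (r0 / 2)) z * ?k z + indicator ?S z * ?k z"
        by (auto simp: indicator_def)
    qed
    also have "integral\<^sup>L lborel \<dots> = ball_kernel (r0 / 2) a + (\<integral>z. indicator ?S z * ?k z \<partial>lborel)"
      unfolding ball_kernel_def
    proof (rule Bochner_Integration.integral_add)
      show "integrable lborel (\<lambda>z. indicator (ball 0 (r0 / 2)) z * ?k z)"
        by (rule integrable_indicator_continuous) (auto intro!: continuous_on_log_kernel[OF a(1)] continuous_intros)
    qed (use main[OF a q] in blast)
    finally have "(\<integral>y. indicator {y. p y \<le> 1} y * log_kernel a ((norm y)\<^sup>2) ((norm y)\<^sup>2 - (x \<bullet> y)\<^sup>2) \<partial>lborel) =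
      ball_kernel (r0 / 2) a + (\<integral>z. indicator ?S z * ?k z \<partial>lborel)" .
    moreover have "q (1, 0) = p x" by (simp add: q_def U)
    ultimately show "\<bar>(\<integral>y. indicator {y. p y \<le> 1} y * log_kernel a ((norm y)\<^sup>2) ((norm y)\<^sup>2 - (x \<bullet> y)\<^sup>2) \<partial>lborel) -
       (ball_kernel (r0 / 2) a + ridge_mass M a * (ln (p x) + ln (r0 / 2)))\<bar> \<le> \<eta> * ridge_mass M a"
      using main[OF a q] by (simp add: algebra_simps)
  qed
qed

text \<open>This bounds the total weight by the very quantity that normalises the main term. Enlarge
  the body to a cylinder and integrate along its axis first: each line contributes
  \<open>ridge_gap a v\<close> plus a term from the endpoints that is at most 0.\<close>

lemma radial_mass_le:
  assumes a: "a > 0" and p: "norm_between r M (p :: real^3 \<Rightarrow> real)"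
  shows "(\<integral>y. indicator {y. p y \<le> 1} y * (1 / sqrt (a / 4 + (norm y)\<^sup>2) - 1 / sqrt (a + (norm y)\<^sup>2)) \<partial>lborel)
    \<le> ridge_mass M a"
proof -
  have M: "M > 0" by (rule norm_betweenD(2)[OF p])
  have n: "norm (axis 1 1 :: real^3) = 1" by simp
  obtain U where U: "frame U" "U (1, 0) = axis 1 1" using frame_exists[OF n] .
  define k where "k R = 1 / sqrt (a / 4 + R) - 1 / sqrt (a + R)" for R :: real
  have k0: "k R \<ge> 0" if "R \<ge> 0" for R
    using that a by (simp add: k_def frac_le add_nonneg_pos add_pos_nonneg)
  have kc: "continuous_on UNIV (\<lambda>y :: 'b::euclidean_space. k ((norm y)\<^sup>2))"
  proof -
    have "a / 4 + (norm y)\<^sup>2 > 0" "a + (norm y)\<^sup>2 > 0" for y :: 'b using a by (simp_all add: add_pos_nonneg)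
    then show ?thesis unfolding k_def
      by (intro continuous_intros ballI) (auto simp: less_imp_neq[symmetric])
  qed
  let ?C = "{-M..M} \<times> cball (0 :: real \<times> real) M"
  have C: "?C \<in> sets borel" "bounded ?C"
    by (auto intro: borel_closed closed_Times bounded_Times)
  have i1: "integrable lborel (\<lambda>y. indicator {y. p y \<le> 1} y * k ((norm y)\<^sup>2))"
    by (rule integrable_indicator_continuous[OF unit_ball_measurable[OF p] kc])
  have i2: "integrable lborel (\<lambda>z. indicator ?C z * k ((norm z)\<^sup>2))"
    by (rule integrable_indicator_continuous[OF C kc])
  have m1: "(\<lambda>y. indicator {y. p y \<le> 1} y * k ((norm y)\<^sup>2)) \<in> borel_measurable borel" using i1 by simp
  have "(\<integral>y. indicator {y. p y \<le> 1} y * k ((norm y)\<^sup>2) \<partial>lborel) =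
     (\<integral>z. indicator {y. p y \<le> 1} (U z) * k ((norm z)\<^sup>2) \<partial>lborel)"
    by (simp add: frame_integral[OF U(1) m1] frame_norm[OF U(1)])
  also have "\<dots> \<le> (\<integral>z. indicator ?C z * k ((norm z)\<^sup>2) \<partial>lborel)"
  proof (rule integral_mono[OF _ i2])
    show "integrable lborel (\<lambda>z. indicator {y. p y \<le> 1} (U z) * k ((norm z)\<^sup>2))"
      using i1 by (simp add: frame_integrable[OF U(1) m1] frame_norm[OF U(1)])
    fix z
    show "indicator {y. p y \<le> 1} (U z) * k ((norm z)\<^sup>2) \<le> indicator ?C z * k ((norm z)\<^sup>2)"
    proof (cases "p (U z) \<le> 1")
      case True
      then have "M * p (U z) \<le> M * 1" using M by (intro mult_left_mono) auto
      then have "norm z \<le> M" using norm_betweenD(7)[OF p, of "U z"] frame_norm[OF U(1), of z] by simp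
      then have "z \<in> ?C" using norm_fst_le[of "fst z" "snd z"] norm_snd_le[of "snd z" "fst z"]
        by (cases z) (auto simp: abs_le_iff)
      then show ?thesis using True by simp
    qed (use k0 in simp)
  qed
  also have "\<dots> = (\<integral>v. \<integral>s. indicator ?C (s, v) * k ((norm (s, v))\<^sup>2) \<partial>lborel \<partial>lborel)"
  proof -
    have "integrable (lborel \<Otimes>\<^sub>M lborel) (case_prod (\<lambda>s v. indicator ?C (s, v) * k ((norm (s, v))\<^sup>2)))"
      using i2 by (simp add: lborel_prod case_prod_beta')
    from lborel_pair.integral_snd[OF this] show ?thesis by (simp add: lborel_prod case_prod_beta')
  qed
  also have "\<dots> \<le> ridge_mass M a"
    unfolding ridge_mass_def
  proof (rule integral_mono)
    have "integrable (lborel \<Otimes>\<^sub>M lborel) (case_prod (\<lambda>s v. indicator ?C (s, v) * k ((norm (s, v))\<^sup>2)))"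
      using i2 by (simp add: lborel_prod case_prod_beta')
    from lborel_pair.integrable_snd[OF this]
    show "integrable lborel (\<lambda>v. \<integral>s. indicator ?C (s, v) * k ((norm (s, v))\<^sup>2) \<partial>lborel)" .
    show "integrable lborel (\<lambda>v. indicator (cball 0 M) v * ridge_gap a v)"
      by (rule integrable_ridge_gap[OF a]) auto
    fix v :: "real \<times> real"
    define A where "A = a / 4 + (norm v)\<^sup>2"
    define B where "B = a + (norm v)\<^sup>2"
    have AB: "0 < A" "A \<le> B" "0 < B" using a by (simp_all add: A_def B_def add_pos_nonneg)
    have eq: "indicator ?C (s, v) * k ((norm (s, v))\<^sup>2) = indicator (cball 0 M) v *
        (1 / sqrt (A + s\<^sup>2) * indicator {-M..M} s - 1 / sqrt (B + s\<^sup>2) * indicator {-M..M} s)" for s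
      by (simp add: k_def norm_sq_Pair A_def B_def add_ac indicator_def)
    have hb: "has_bochner_integral lborel (\<lambda>s. 1 / sqrt (A + s\<^sup>2) * indicator {-M..M} s - 1 / sqrt (B + s\<^sup>2) * indicator {-M..M} s)
       ((2 * ln (M + sqrt (A + M\<^sup>2)) - ln A) - (2 * ln (M + sqrt (B + M\<^sup>2)) - ln B))"
      using AB M by (intro has_bochner_integral_diff integral_inverse_hypot) auto
    have "(\<integral>s. indicator ?C (s, v) * k ((norm (s, v))\<^sup>2) \<partial>lborel) = indicator (cball 0 M) v *
       ((2 * ln (M + sqrt (A + M\<^sup>2)) - ln A) - (2 * ln (M + sqrt (B + M\<^sup>2)) - ln B))"
      unfolding eq integral_mult_right_zero has_bochner_integral_integral_eq[OF hb] ..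
    also have "\<dots> \<le> indicator (cball 0 M) v * ridge_gap a v"
    proof (rule mult_left_mono)
      have "sqrt (A + M\<^sup>2) \<ge> 0" using AB by simp
      moreover have "sqrt (A + M\<^sup>2) \<le> sqrt (B + M\<^sup>2)" using AB by simp
      ultimately have "ln (M + sqrt (A + M\<^sup>2)) \<le> ln (M + sqrt (B + M\<^sup>2))"
        using M by (subst ln_le_cancel_iff) linarith+
      then show "(2 * ln (M + sqrt (A + M\<^sup>2)) - ln A) - (2 * ln (M + sqrt (B + M\<^sup>2)) - ln B) \<le> ridge_gap a v"
        by (simp add: ridge_gap_def A_def B_def)
    qed simp
    finally show "(\<integral>s. indicator ?C (s, v) * k ((norm (s, v))\<^sup>2) \<partial>lborel) \<le> indicator (cball 0 M) v * ridge_gap a v" .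
  qed
  finally show ?thesis by (simp add: k_def)
qed

subsection \<open>Convex bodies as unit balls of norms\<close>

text \<open>The gauge is studied from its definition as an infimum, since \<open>K\<close> is
  recognised as a star body only by means of this lemma. The constants \<open>r\<close> and
  \<open>M\<close> are radii of balls inside and around \<open>K\<close>.\<close>

lemma symmetric_convex_body_norm:
  fixes K :: "'a::euclidean_space set"
  assumes body: "convex_body K" and sym: "origin_symmetric K"
  obtains r M where "norm_between r M (minkowski_functional K)" "{x. minkowski_functional K x \<le> 1} = K"
proof -
  let ?p = "minkowski_functional K"
  let ?A = "\<lambda>x. {a::real. 0 \<le> a \<and> x \<in> (\<lambda>y. a *\<^sub>R y) ` K}"
  have K: "compact K" "convex K" "interior K \<noteq> {}" using body by (auto simp: convex_body_def)
  have neg: "- x \<in> K" if "x \<in> K" for x using sym that by (simp add: origin_symmetric_def)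
  have negK: "uminus ` K = K" using neg by (metis image_eqI minus_minus subsetI subset_antisym image_subsetI)
  obtain z where z: "z \<in> interior K" using K(3) by blast
  have "uminus ` interior K = interior K" using interior_negations[of K] negK by simp
  then have "- z \<in> interior K" using z by blast
  \<comment> \<open>Averaging an interior point with its mirror image shows that the origin is
    interior.\<close>
  then have "(1/2) *\<^sub>R z + (1/2) *\<^sub>R (- z) \<in> interior K"
    using z convexD[OF convex_interior[OF K(2)], of z "- z" "1/2" "1/2"] by simp
  then have "0 \<in> interior K" by simp
  then obtain r where r: "r > 0" "cball 0 r \<subseteq> K" unfolding mem_interior_cball by blast
  have zero: "0 \<in> K" using r by auto
  obtain M where M: "M > 0" "\<And>x. x \<in> K \<Longrightarrow> norm x \<le> M"
    using compact_imp_bounded[OF K(1)] by (auto simp: bounded_pos)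
  have A_iff: "a \<in> ?A x \<longleftrightarrow> (1 / a) *\<^sub>R x \<in> K" if "a > 0" for a x
    using that by (force simp: image_iff)
  have up: "b \<in> ?A x" if h: "a \<in> ?A x" "a \<le> b" "b > 0" for a b x
  proof -
    obtain y where y: "y \<in> K" "x = a *\<^sub>R y" "0 \<le> a" using h(1) by (auto simp: image_iff)
    have "(a / b) *\<^sub>R y + (1 - a / b) *\<^sub>R 0 \<in> K"
      using y h zero by (intro convexD[OF K(2)]) auto
    then show ?thesis using A_iff[OF h(3)] y by simp
  qed
  have bdd: "bdd_below (?A x)" for x by (rule bdd_belowI[of _ 0]) simp
  have ball: "norm x / r \<in> ?A x" if "x \<noteq> 0" for x
  proof -
    have "(r / norm x) *\<^sub>R x \<in> cball 0 r" using that r by simp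
    then have "(r / norm x) *\<^sub>R x \<in> K" using r by blast
    then show ?thesis using A_iff[of "norm x / r" x] that r by simp
  qed
  have zA: "0 \<in> ?A 0" using zero by force
  have ne: "?A x \<noteq> {}" for x using ball[of x] zA by (cases "x = 0") blast+
  have lower: "?p x \<le> a" if "a \<in> ?A x" for a x
    unfolding minkowski_functional_def using that bdd by (rule cInf_lower)
  have least: "c \<le> ?p x" if "\<And>a. a \<in> ?A x \<Longrightarrow> c \<le> a" for c x
    unfolding minkowski_functional_def using ne that by (rule cInf_greatest)
  have p0: "?p x \<ge> 0" for x by (rule least) simp
  have near: "a \<in> ?A x" if h: "?p x < a" for a x
  proof -
    obtain b where "b \<in> ?A x" "b < a"
      using cInf_lessD[OF ne, of x a] h unfolding minkowski_functional_def by blast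
    then show ?thesis using up[of b x a] p0[of x] h by simp
  qed
  have add: "?p (x + y) \<le> ?p x + ?p y" for x y
  proof (rule field_le_epsilon)
    fix e :: real assume e: "e > 0"
    \<comment> \<open>At this stage the infimum is not known to be attained, hence the slightly
      larger factors.\<close>
    define a where "a = ?p x + e / 2"
    define b where "b = ?p y + e / 2"
    have ab: "a > 0" "b > 0" using p0[of x] p0[of y] e by (simp_all add: a_def b_def add_nonneg_pos)
    have "a \<in> ?A x" "b \<in> ?A y" using e by (auto intro!: near simp: a_def b_def simp del: mem_Collect_eq)
    then have "(1 / a) *\<^sub>R x \<in> K" "(1 / b) *\<^sub>R y \<in> K" using A_iff ab by blast+
    then have "(a / (a + b)) *\<^sub>R ((1 / a) *\<^sub>R x) + (b / (a + b)) *\<^sub>R ((1 / b) *\<^sub>R y) \<in> K"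
      using ab by (intro convexD[OF K(2)]) (auto simp flip: add_divide_distrib)
    then have "(1 / (a + b)) *\<^sub>R (x + y) \<in> K" using ab by (simp add: scaleR_add_right)
    then have "a + b \<in> ?A (x + y)" using A_iff[of "a + b"] ab by simp
    from lower[OF this] show "?p (x + y) \<le> ?p x + ?p y + e" by (simp add: a_def b_def)
  qed
  have hom1: "?p (t *\<^sub>R x) \<le> \<bar>t\<bar> * ?p x" for t x
  proof (cases "t = 0")
    case True
    then show ?thesis using lower[OF zA] by simp
  next
    case False
    show ?thesis
    proof (rule field_le_epsilon)
      fix e :: real assume e: "e > 0"
      define a where "a = ?p x + e / \<bar>t\<bar>"
      have a: "a > 0" "?p x < a" using p0[of x] e False by (simp_all add: a_def add_nonneg_pos)
      then have "(1 / a) *\<^sub>R x \<in> K" using near A_iff by blast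
      then have "sgn t *\<^sub>R ((1 / a) *\<^sub>R x) \<in> K" using neg False by (cases "t > 0") auto
      moreover have "sgn t *\<^sub>R ((1 / a) *\<^sub>R x) = (1 / (\<bar>t\<bar> * a)) *\<^sub>R (t *\<^sub>R x)"
        using False a by (auto simp: sgn_if abs_if)
      ultimately have "(1 / (\<bar>t\<bar> * a)) *\<^sub>R (t *\<^sub>R x) \<in> K" by metis
      moreover have "\<bar>t\<bar> * a > 0" using a False by simp
      ultimately have "\<bar>t\<bar> * a \<in> ?A (t *\<^sub>R x)" using A_iff by blast
      from lower[OF this] show "?p (t *\<^sub>R x) \<le> \<bar>t\<bar> * ?p x + e"
        using False by (simp add: a_def distrib_left)
    qed
  qed
  have hom: "?p (t *\<^sub>R x) = \<bar>t\<bar> * ?p x" for t x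
  proof (cases "t = 0")
    case True
    then show ?thesis using hom1[of 0 x] p0[of 0] by simp
  next
    case False
    have "?p ((1 / t) *\<^sub>R (t *\<^sub>R x)) \<le> \<bar>1 / t\<bar> * ?p (t *\<^sub>R x)" by (rule hom1)
    then have "\<bar>t\<bar> * ?p x \<le> ?p (t *\<^sub>R x)" using False by (simp add: field_simps)
    then show ?thesis using hom1[of t x] by simp
  qed
  have rp: "r * ?p x \<le> norm x" for x
  proof (cases "x = 0")
    case True
    then show ?thesis using hom[of 0 x] by simp
  next
    case False
    show ?thesis using lower[OF ball[OF False]] r by (simp add: field_simps)
  qed
  have Mp: "norm x \<le> M * ?p x" for x
  proof -
    have "norm x / M \<le> ?p x"
    proof (rule least)
      fix a assume "a \<in> ?A x"
      then obtain y where "0 \<le> a" "y \<in> K" "x = a *\<^sub>R y" by (auto simp: image_iff)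
      then have "norm x \<le> a * M" using M by (simp add: mult_left_mono)
      then show "norm x / M \<le> a" using M by (simp add: divide_le_eq)
    qed
    then show ?thesis using M by (simp add: divide_le_eq mult.commute)
  qed
  have lip: "\<bar>?p x - ?p y\<bar> \<le> norm (x - y) / r" for x y
  proof -
    have "?p x \<le> ?p (x - y) + ?p y" using add[of "x - y" y] by simp
    moreover have "?p y \<le> ?p (x - y) + ?p x"
      using add[of "y - x" x] hom[of "-1" "x - y"] by simp
    moreover have "?p (x - y) \<le> norm (x - y) / r" using rp[of "x - y"] r by (simp add: pos_le_divide_eq mult.commute)
    ultimately show ?thesis by linarith
  qed
  have "continuous_on UNIV ?p"
  proof (rule continuous_onI)
    fix x :: 'a and e :: real assume "e > 0"
    have "dist (?p y) (?p x) \<le> e" if "dist y x < e * r" for y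
    proof -
      have "norm (y - x) / r \<le> e" using that r by (simp add: dist_norm pos_divide_le_eq)
      then show ?thesis using lip[of y x] by (simp add: dist_real_def)
    qed
    then show "\<exists>d>0. \<forall>y\<in>UNIV. dist y x < d \<longrightarrow> dist (?p y) (?p x) \<le> e"
      using r \<open>e > 0\<close> by (intro exI[of _ "e * r"]) simp
  qed
  then have "norm_between r M ?p"
    unfolding norm_between_def using r M add hom rp Mp by blast
  moreover have "{x. ?p x \<le> 1} = K"
  proof (intro equalityI subsetI CollectI)
    fix x assume "x \<in> K"
    then have "1 \<in> ?A x" by force
    then show "?p x \<le> 1" by (rule lower)
  next
    fix x assume "x \<in> {x. ?p x \<le> 1}"
    then have "?p x < 1 + inverse (real (Suc n))" for n by (simp add: add_pos_nonneg le_less_trans)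
    then have mem: "(1 / (1 + inverse (real (Suc n)))) *\<^sub>R x \<in> K" for n
      using near A_iff[of "1 + inverse (real (Suc n))" x] by (simp add: add_pos_nonneg)
    have lim: "(\<lambda>n. (1 / (1 + inverse (real (Suc n)))) *\<^sub>R x) \<longlonglongrightarrow> (1 / (1 + 0)) *\<^sub>R x"
      by (intro tendsto_intros LIMSEQ_inverse_real_of_nat) simp
    have "(1 / (1 + 0)) *\<^sub>R x \<in> K"
      by (rule closed_sequentially[OF compact_imp_closed[OF K(1)] mem lim])
    then show "x \<in> K" by simp
  qed
  ultimately show ?thesis using that by blast
qed

lemma symmetric_convex_body_star_body:
  assumes "convex_body K" "origin_symmetric K"
  shows "symmetric_star_body K"
proof -
  obtain r M where p: "norm_between r M (minkowski_functional K)" and K: "{x. minkowski_functional K x \<le> 1} = K"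
    using symmetric_convex_body_norm[OF assms] .
  have "minkowski_functional K x > 0" if "x \<noteq> 0" for x
    using norm_betweenD(2)[OF p] norm_betweenD(7)[OF p, of x] that by (metis less_le_trans zero_less_mult_pos zero_less_norm_iff)
  then show ?thesis
    using unit_ball_of_functional(1)[of "minkowski_functional K"] norm_betweenD(3,5)[OF p] K by auto
qed

subsection \<open>The representing weight\<close>

text \<open>The set on which Fubini acts. For \<open>y\<close> in the body its section is
  \<open>ellipsoid a (c *\<^sub>R y)\<close>; for \<open>\<xi>\<close> within the cutoff and
  \<open>c > 0\<close> it is the slab \<open>\<bar>y \<bullet> \<xi>\<bar> \<le> \<tau> / c\<close>
  with \<open>\<tau> = sqrt (1 - a * (norm \<xi>)\<^sup>2)\<close>. Joining the cutoff and the slab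
  width in one quadratic inequality is what produces ellipsoids, over which the logarithm has an
  explicit average.\<close>

definition plank :: "real \<Rightarrow> (real^3 \<Rightarrow> real) \<Rightarrow> real \<Rightarrow> ((real^3) \<times> (real^3)) set" where
  "plank a p c = {z. p (fst z) \<le> 1 \<and> a * (norm (snd z))\<^sup>2 + ((c *\<^sub>R fst z) \<bullet> snd z)\<^sup>2 \<le> 1}"

definition ellipsoid :: "real \<Rightarrow> real^3 \<Rightarrow> (real^3) set" where
  "ellipsoid a y = {\<xi>. a * (norm \<xi>)\<^sup>2 + (y \<bullet> \<xi>)\<^sup>2 \<le> 1}"

lemma ellipsoid_measurable [measurable]: "ellipsoid a y \<in> sets borel"
  unfolding ellipsoid_def by (intro borel_closed closed_Collect_le continuous_intros)

lemma norm_le_of_quadratic: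
  assumes "a > 0" "a * t\<^sup>2 + s\<^sup>2 \<le> 1" "t \<ge> (0 :: real)" shows "t \<le> 1 / sqrt a"
proof -
  have "a * t\<^sup>2 \<le> 1" using assms(2) zero_le_power2[of s] by linarith
  then have "t\<^sup>2 \<le> 1 / a" using assms(1) by (simp add: pos_le_divide_eq mult.commute)
  then have "sqrt (t\<^sup>2) \<le> sqrt (1 / a)" by (rule real_sqrt_le_mono)
  then show ?thesis using assms by (simp add: real_sqrt_divide)
qed

lemma ellipsoid_bounded: "a > 0 \<Longrightarrow> ellipsoid a y \<subseteq> cball 0 (1 / sqrt a)"
  using norm_le_of_quadratic[of a] by (auto simp: ellipsoid_def)

context
  fixes r M a :: real and p :: "real^3 \<Rightarrow> real"
  assumes p: "norm_between r M p" and a: "a > 0"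
begin

abbreviation (input) body :: "(real^3) set" where "body \<equiv> {y. p y \<le> 1}"

lemma plank_measurable: "plank a p c \<in> sets borel"
  unfolding plank_def
  by (intro borel_closed closed_Collect_conj closed_Collect_le continuous_intros
      continuous_on_compose2[OF norm_betweenD(3)[OF p]]) auto

lemma plank_bounded: "bounded (plank a p c)"
proof -
  obtain B where B: "\<And>y. p y \<le> 1 \<Longrightarrow> norm y \<le> B"
    using unit_ball_measurable(2)[OF p] by (auto simp: bounded_iff)
  have "plank a p c \<subseteq> cball 0 B \<times> cball 0 (1 / sqrt a)"
    using B norm_le_of_quadratic[OF a] by (auto simp: plank_def)
  then show ?thesis by (rule bounded_subset[rotated]) (intro bounded_Times bounded_cball)
qed

definition plank_section :: "real \<Rightarrow> real^3 \<Rightarrow> real" where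
  "plank_section c \<xi> = measure lborel {y. (y, \<xi>) \<in> plank a p c}"

text \<open>Slabs and ellipsoids are the two families of sections of \<open>plank\<close>.
  Integrability comes from continuity of \<open>f\<close> and boundedness of \<open>plank\<close>;
  this is one reason to bring in the logarithm in smoothed form.\<close>

lemma plank_Fubini:
  assumes f: "continuous_on UNIV f"
  shows "(\<integral>\<xi>. plank_section c \<xi> * f \<xi> \<partial>lborel) =
      (\<integral>y. indicator body y * (\<integral>\<xi>. indicator (ellipsoid a (c *\<^sub>R y)) \<xi> * f \<xi> \<partial>lborel) \<partial>lborel)"
    and "integrable lborel (\<lambda>\<xi>. plank_section c \<xi> * f \<xi>)"
    and "integrable lborel (\<lambda>y. indicator body y * (\<integral>\<xi>. indicator (ellipsoid a (c *\<^sub>R y)) \<xi> * f \<xi> \<partial>lborel))"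
proof -
  have "integrable lborel (\<lambda>z. indicator (plank a p c) z * f (snd z))"
    using f by (intro integrable_indicator_continuous plank_measurable plank_bounded
      continuous_on_compose2[OF f] continuous_intros) auto
  then have i: "integrable (lborel \<Otimes>\<^sub>M lborel) (case_prod (\<lambda>y \<xi>. indicator (plank a p c) (y, \<xi>) * f \<xi>))"
    by (simp add: lborel_prod case_prod_beta')
  have 1: "(\<integral>y. indicator (plank a p c) (y, \<xi>) * f \<xi> \<partial>lborel) = plank_section c \<xi> * f \<xi>" for \<xi>
  proof -
    have "(\<lambda>y. indicator (plank a p c) (y, \<xi>)) = (indicator {y. (y, \<xi>) \<in> plank a p c} :: _ \<Rightarrow> real)"
      by (auto simp: indicator_def)
    then show ?thesis unfolding integral_mult_left_zero by (simp add: plank_section_def)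
  qed
  have 2: "(\<integral>\<xi>. indicator (plank a p c) (y, \<xi>) * f \<xi> \<partial>lborel) =
      indicator body y * (\<integral>\<xi>. indicator (ellipsoid a (c *\<^sub>R y)) \<xi> * f \<xi> \<partial>lborel)" for y
  proof -
    have "indicator (plank a p c) (y, \<xi>) * f \<xi> = indicator body y * (indicator (ellipsoid a (c *\<^sub>R y)) \<xi> * f \<xi>)" for \<xi>
      by (simp add: plank_def ellipsoid_def indicator_def)
    then show ?thesis by (simp only: integral_mult_right_zero)
  qed
  show "(\<integral>\<xi>. plank_section c \<xi> * f \<xi> \<partial>lborel) =
      (\<integral>y. indicator body y * (\<integral>\<xi>. indicator (ellipsoid a (c *\<^sub>R y)) \<xi> * f \<xi> \<partial>lborel) \<partial>lborel)"
    using lborel_pair.Fubini_integral[OF i] unfolding 1 2 .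
  show "integrable lborel (\<lambda>\<xi>. plank_section c \<xi> * f \<xi>)"
    using lborel_pair.integrable_snd[OF i] unfolding 1 .
  show "integrable lborel (\<lambda>y. indicator body y * (\<integral>\<xi>. indicator (ellipsoid a (c *\<^sub>R y)) \<xi> * f \<xi> \<partial>lborel))"
    using lborel_pair.integrable_fst[OF i] unfolding 2 .
qed

text \<open>A substitute for minus a second derivative: if the parallel sections had constant area,
  slab volumes would be proportional to the width and the two terms would cancel. Only the decrease
  of the areas away from the centre is recorded.\<close>

definition direction_weight :: "real^3 \<Rightarrow> real" where
  "direction_weight \<xi> = 2 * plank_section 2 \<xi> - plank_section 1 \<xi>"

lemma plank_section_outside:
  assumes "a * (norm \<xi>)\<^sup>2 > 1" shows "plank_section c \<xi> = 0"
proof -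
  have "{y. (y, \<xi>) \<in> plank a p c} = {}"
  proof -
    have "\<not> a * (norm \<xi>)\<^sup>2 + t\<^sup>2 \<le> 1" for t using assms zero_le_power2[of t] by linarith
    then show ?thesis by (simp add: plank_def)
  qed
  then show ?thesis by (simp add: plank_section_def)
qed

text \<open>Convexity of the body enters here, through \<open>slab_volume\<close> with half-width
  \<open>\<tau>\<close>. Beyond the cutoff both sections are empty.\<close>

lemma direction_weight_nonneg: "direction_weight \<xi> \<ge> 0"
proof (cases "a * (norm \<xi>)\<^sup>2 > 1")
  case True
  then show ?thesis by (simp add: direction_weight_def plank_section_outside)
next
  case False
  define \<tau> where "\<tau> = sqrt (1 - a * (norm \<xi>)\<^sup>2)"
  have \<tau>: "\<tau> \<ge> 0" "\<tau>\<^sup>2 = 1 - a * (norm \<xi>)\<^sup>2" using False by (simp_all add: \<tau>_def)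
  have sec: "{y. (y, \<xi>) \<in> plank a p c} = {y \<in> body. \<bar>y \<bullet> \<xi>\<bar> \<le> \<tau> / c}" if "c > 0" for c
  proof -
    have "a * (norm \<xi>)\<^sup>2 + ((c *\<^sub>R y) \<bullet> \<xi>)\<^sup>2 \<le> 1 \<longleftrightarrow> \<bar>y \<bullet> \<xi>\<bar> \<le> \<tau> / c" for y
    proof -
      have "a * (norm \<xi>)\<^sup>2 + ((c *\<^sub>R y) \<bullet> \<xi>)\<^sup>2 \<le> 1 \<longleftrightarrow> (c * (y \<bullet> \<xi>))\<^sup>2 \<le> \<tau>\<^sup>2"
        unfolding \<tau>(2) by auto
      also have "\<dots> \<longleftrightarrow> \<bar>c * (y \<bullet> \<xi>)\<bar> \<le> \<tau>"
        using \<tau>(1) abs_le_square_iff[of "c * (y \<bullet> \<xi>)" \<tau>] by simp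
      also have "\<dots> \<longleftrightarrow> \<bar>y \<bullet> \<xi>\<bar> \<le> \<tau> / c"
        using that by (simp add: abs_mult pos_le_divide_eq mult.commute)
      finally show ?thesis .
    qed
    then show ?thesis by (simp add: plank_def)
  qed
  have "closed body" by (intro closed_Collect_le continuous_intros norm_betweenD(3)[OF p])
  then have cb: "compact body" using unit_ball_measurable(2)[OF p] by (simp add: compact_eq_bounded_closed)
  have conv: "convex body"
  proof (rule convexI)
    fix x y :: "real^3" and u v :: real
    assume *: "x \<in> body" "y \<in> body" "0 \<le> u" "0 \<le> v" "u + v = 1"
    have "p (u *\<^sub>R x + v *\<^sub>R y) \<le> u * p x + v * p y"
      using norm_betweenD(4)[OF p, of "u *\<^sub>R x" "v *\<^sub>R y"] norm_betweenD(5)[OF p] * by simp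
    also have "\<dots> \<le> u * 1 + v * 1" using * by (intro add_mono mult_left_mono) auto
    finally show "u *\<^sub>R x + v *\<^sub>R y \<in> body" using * by simp
  qed
  have sym: "- z \<in> body" if "z \<in> body" for z
    using that norm_betweenD(5)[OF p, of "-1" z] by simp
  have fin: "emeasure lborel {y \<in> body. \<bar>y \<bullet> \<xi>\<bar> \<le> s} = ennreal (measure lborel {y \<in> body. \<bar>y \<bullet> \<xi>\<bar> \<le> s})" for s
  proof (rule emeasure_eq_ennreal_measure)
    have "bounded {y \<in> body. \<bar>y \<bullet> \<xi>\<bar> \<le> s}"
      by (rule bounded_subset[OF unit_ball_measurable(2)[OF p]]) auto
    from less_imp_neq[OF emeasure_bounded_finite[OF this]]
    show "emeasure lborel {y \<in> body. \<bar>y \<bullet> \<xi>\<bar> \<le> s} \<noteq> top" by simp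
  qed
  have "ennreal (measure lborel {y \<in> body. \<bar>y \<bullet> \<xi>\<bar> \<le> \<tau>}) \<le> 2 * ennreal (measure lborel {y \<in> body. \<bar>y \<bullet> \<xi>\<bar> \<le> \<tau> / 2})"
    using slab_volume[OF cb conv sym \<tau>(1), of \<xi>] unfolding fin .
  also have "\<dots> = ennreal (2 * measure lborel {y \<in> body. \<bar>y \<bullet> \<xi>\<bar> \<le> \<tau> / 2})"
    by (simp add: ennreal_mult')
  finally have "measure lborel {y \<in> body. \<bar>y \<bullet> \<xi>\<bar> \<le> \<tau>} \<le> 2 * measure lborel {y \<in> body. \<bar>y \<bullet> \<xi>\<bar> \<le> \<tau> / 2}"
    by (subst (asm) ennreal_le_iff) auto
  then show ?thesis by (simp add: direction_weight_def plank_section_def sec)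
qed

lemma direction_weight_outside:
  assumes "norm \<xi> > 1 / sqrt a" shows "direction_weight \<xi> = 0"
proof -
  have "a * (norm \<xi>)\<^sup>2 > 1"
    using norm_le_of_quadratic[OF a, of "norm \<xi>" 0] assms by (metis add.right_neutral linorder_not_less norm_ge_zero power_zero_numeral)
  then show ?thesis by (simp add: direction_weight_def plank_section_outside)
qed

lemma direction_weight_integral:
  assumes f: "continuous_on UNIV f"
  shows "integrable lborel (\<lambda>\<xi>. direction_weight \<xi> * f \<xi>)"
    and "(\<integral>\<xi>. direction_weight \<xi> * f \<xi> \<partial>lborel) = (\<integral>y. indicator body y *
      (2 * (\<integral>\<xi>. indicator (ellipsoid a (2 *\<^sub>R y)) \<xi> * f \<xi> \<partial>lborel) -
       (\<integral>\<xi>. indicator (ellipsoid a (1 *\<^sub>R y)) \<xi> * f \<xi> \<partial>lborel)) \<partial>lborel)"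
    and "integrable lborel (\<lambda>y. indicator body y *
      (2 * (\<integral>\<xi>. indicator (ellipsoid a (2 *\<^sub>R y)) \<xi> * f \<xi> \<partial>lborel) -
       (\<integral>\<xi>. indicator (ellipsoid a (1 *\<^sub>R y)) \<xi> * f \<xi> \<partial>lborel)))" (is "integrable lborel ?F")
proof -
  have w: "direction_weight \<xi> * f \<xi> = 2 * (plank_section 2 \<xi> * f \<xi>) - plank_section 1 \<xi> * f \<xi>" for \<xi>
    by (simp add: direction_weight_def algebra_simps)
  note F = plank_Fubini[OF f]
  show "integrable lborel (\<lambda>\<xi>. direction_weight \<xi> * f \<xi>)"
    unfolding w by (intro Bochner_Integration.integrable_diff integrable_mult_right F)
  have b: "?F =
     (\<lambda>y. 2 * (indicator body y * (\<integral>\<xi>. indicator (ellipsoid a (2 *\<^sub>R y)) \<xi> * f \<xi> \<partial>lborel)) -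
       indicator body y * (\<integral>\<xi>. indicator (ellipsoid a (1 *\<^sub>R y)) \<xi> * f \<xi> \<partial>lborel))"
    by (rule ext) (simp only: right_diff_distrib mult.left_commute)
  show "integrable lborel ?F"
    unfolding b by (intro Bochner_Integration.integrable_diff integrable_mult_right F)
  show "(\<integral>\<xi>. direction_weight \<xi> * f \<xi> \<partial>lborel) = integral\<^sup>L lborel ?F"
    unfolding b w
    by (subst (1 2) Bochner_Integration.integral_diff)
       (use F in \<open>auto simp only: integrable_mult_right integral_mult_right_zero\<close>)
qed

end

section \<open>Smoothing the logarithm\<close>

text \<open>The integrated error of the smoothed logarithm over a ball. The first axis represents
  all directions, by \<open>radial_ridge\<close>.\<close>

definition smoothing_gap :: "real \<Rightarrow> real \<Rightarrow> real" where
  "smoothing_gap \<rho> \<delta> = (\<integral>z. indicator (cball 0 \<rho>) z * (ln ((fst z)\<^sup>2 + \<delta>\<^sup>2) / 2 - ln \<bar>fst z\<bar>)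
     \<partial>(lborel :: (real \<times> real \<times> real) measure))"

lemma smoothed_ln_ge:
  assumes "t \<noteq> 0" shows "0 \<le> ln (t\<^sup>2 + \<delta>\<^sup>2) / 2 - ln \<bar>t :: real\<bar>"
proof -
  have "ln (t\<^sup>2) \<le> ln (t\<^sup>2 + \<delta>\<^sup>2)" using assms by (subst ln_le_cancel_iff) (auto intro: add_pos_nonneg)
  moreover have "ln (t\<^sup>2) = 2 * ln \<bar>t\<bar>" using assms ln_realpow[of "\<bar>t\<bar>" 2] by simp
  ultimately show ?thesis by simp
qed

lemma continuous_smoothed_ln:
  fixes f :: "'a::topological_space \<Rightarrow> real"
  assumes "continuous_on S f" "\<delta> > 0" shows "continuous_on S (\<lambda>x. ln ((f x)\<^sup>2 + \<delta>\<^sup>2) / 2)"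
proof -
  have "(f x)\<^sup>2 + \<delta>\<^sup>2 > 0" for x using assms by (simp add: add_nonneg_pos)
  then show ?thesis using assms by (intro continuous_intros) (auto simp: less_imp_neq[symmetric])
qed

lemma AE_fst_nonzero: "AE z in lborel. fst (z :: real \<times> real \<times> real) \<noteq> 0"
proof -
  have "(1, 0, 0) \<noteq> (0 :: real \<times> real \<times> real)" by (simp add: zero_prod_def)
  from AE_inner_nonzero[OF this] show ?thesis by eventually_elim (simp add: inner_prod_def)
qed

text \<open>Off a null set the integrand is nonnegative and grows with \<open>\<delta>\<close>, so
  its instance at \<open>\<delta> = 1\<close> dominates the sequence.\<close>

lemma smoothing_gap_tendsto: "(\<lambda>n. smoothing_gap \<rho> (inverse (real (Suc n)))) \<longlonglongrightarrow> 0"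
proof -
  let ?d = "\<lambda>n. inverse (real (Suc n))"
  let ?E = "lborel :: (real \<times> real \<times> real) measure"
  let ?g = "\<lambda>\<delta> z. indicator (cball 0 \<rho>) z * (ln ((fst z)\<^sup>2 + \<delta>\<^sup>2) / 2 - ln \<bar>fst z\<bar>)"
  have cf: "continuous_on UNIV (fst :: real \<times> real \<times> real \<Rightarrow> real)" by (intro continuous_intros)
  have i1: "integrable lborel (\<lambda>z :: real \<times> real \<times> real. indicator (cball 0 \<rho>) z * (ln ((fst z)\<^sup>2 + \<delta>\<^sup>2) / 2))"
    if "\<delta> > 0" for \<delta>
    by (rule integrable_indicator_continuous[OF _ _ continuous_smoothed_ln[OF cf that]]) auto
  have i: "integrable ?E (\<lambda>z. ?g \<delta> z)"
    if "\<delta> > 0" for \<delta>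
    unfolding right_diff_distrib by (intro Bochner_Integration.integrable_diff i1 that integrable_ln_fst)
  have "(\<lambda>n. \<integral>z. ?g (?d n) z
     \<partial>?E) \<longlonglongrightarrow> (\<integral>z. 0 \<partial>?E)"
  proof (rule integral_dominated_convergence)
    show "integrable ?E (\<lambda>z. ?g 1 z)"
      by (rule i) simp
    show "(\<lambda>z. ?g (?d n) z) \<in> borel_measurable ?E" for n
      by (rule borel_measurable_integrable[OF i]) simp
    show "AE z in ?E. (\<lambda>n. ?g (?d n) z) \<longlonglongrightarrow> 0"
      using AE_fst_nonzero
    proof eventually_elim
      fix z :: "real \<times> real \<times> real" assume z: "fst z \<noteq> 0"
      have "(\<lambda>n. ln ((fst z)\<^sup>2 + (?d n)\<^sup>2)) \<longlonglongrightarrow> ln ((fst z)\<^sup>2 + 0\<^sup>2)"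
        using z by (intro tendsto_intros LIMSEQ_inverse_real_of_nat) auto
      then have "(\<lambda>n. ln ((fst z)\<^sup>2 + (?d n)\<^sup>2)) \<longlonglongrightarrow> ln ((fst z)\<^sup>2)" by simp
      then have "(\<lambda>n. ?g (?d n) z) \<longlonglongrightarrow>
          indicator (cball 0 \<rho>) z * (ln ((fst z)\<^sup>2) / 2 - ln \<bar>fst z\<bar>)"
        by (intro tendsto_mult_left tendsto_diff tendsto_divide tendsto_const) simp_all
      moreover have "ln ((fst z)\<^sup>2) = 2 * ln \<bar>fst z\<bar>" using z ln_realpow[of "\<bar>fst z\<bar>" 2] by simp
      ultimately show "(\<lambda>n. ?g (?d n) z) \<longlonglongrightarrow> 0"
        by simp
    qed
    show "AE z in ?E. norm (?g (?d n) z) \<le>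
       ?g 1 z" for n
      using AE_fst_nonzero
    proof eventually_elim
      fix z :: "real \<times> real \<times> real" assume z: "fst z \<noteq> 0"
      have "?d n \<le> 1" by (rule inverse_le_1_iff[THEN iffD2]) simp
      then have "(?d n)\<^sup>2 \<le> 1\<^sup>2" by (intro power_mono) auto
      then have "ln ((fst z)\<^sup>2 + (?d n)\<^sup>2) \<le> ln ((fst z)\<^sup>2 + 1\<^sup>2)"
        using z by (subst ln_le_cancel_iff) (auto intro: add_pos_nonneg)
      then have "\<bar>ln ((fst z)\<^sup>2 + (?d n)\<^sup>2) / 2 - ln \<bar>fst z\<bar>\<bar> \<le> ln ((fst z)\<^sup>2 + 1\<^sup>2) / 2 - ln \<bar>fst z\<bar>"
        using smoothed_ln_ge[OF z, of "?d n"] by linarith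
      then show "norm (?g (?d n) z) \<le>
        ?g 1 z"
        unfolding real_norm_def abs_mult by (simp add: indicator_def)
    qed
  qed simp
  then show ?thesis by (simp add: smoothing_gap_def)
qed

text \<open>The smoothed logarithm is almost everywhere above the true one, so enlarging
  \<open>A\<close> to the ball can only increase the error. The bound involves neither
  \<open>x\<close> nor \<open>A\<close>, which allows \<open>\<delta>\<close> to be chosen before
  them.\<close>

lemma smoothing_error:
  fixes x :: "real^3"
  assumes x: "norm x = 1" and \<delta>: "\<delta> > 0" and A: "A \<in> sets borel" "A \<subseteq> cball 0 \<rho>"
  shows "\<bar>(\<integral>\<xi>. indicator A \<xi> * (ln ((x \<bullet> \<xi>)\<^sup>2 + \<delta>\<^sup>2) / 2) \<partial>lborel) - (\<integral>\<xi>. indicator A \<xi> * ln \<bar>x \<bullet> \<xi>\<bar> \<partial>lborel)\<bar>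
    \<le> smoothing_gap \<rho> \<delta>"
proof -
  define s where "s t = ln (t\<^sup>2 + \<delta>\<^sup>2) / 2" for t
  have sc: "continuous_on UNIV s" unfolding s_def using continuous_smoothed_ln[OF continuous_on_id \<delta>] by simp
  have sm: "s \<in> borel_measurable borel" using sc by (rule borel_measurable_continuous_onI)
  have lm: "(\<lambda>t::real. ln \<bar>t\<bar>) \<in> borel_measurable borel" by measurable
  have dm: "(\<lambda>t. s t - ln \<bar>t\<bar>) \<in> borel_measurable borel" using sm lm by measurable
  have il: "integrable lborel (\<lambda>\<xi>. indicator (cball 0 \<rho>) \<xi> * ln \<bar>x \<bullet> \<xi>\<bar>)"
    using radial_ridge(2)[OF x lm, of \<rho>] integrable_ln_fst by blast
  have "continuous_on UNIV (\<lambda>\<xi>. s (x \<bullet> \<xi>))"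
    by (rule continuous_on_compose2[OF sc]) (auto intro: continuous_intros)
  then have iss: "integrable lborel (\<lambda>\<xi>. indicator (cball 0 \<rho>) \<xi> * s (x \<bullet> \<xi>))"
    by (intro integrable_indicator_continuous) auto
  have "indicator A \<xi> * t = indicator A \<xi> *\<^sub>R (indicator (cball 0 \<rho>) \<xi> * t)" for \<xi> and t :: real
    using A(2) by (auto simp: indicator_def)
  note ind = this
  have A': "A \<in> sets lborel" using A(1) by simp
  have il': "integrable lborel (\<lambda>\<xi>. indicator A \<xi> * ln \<bar>x \<bullet> \<xi>\<bar>)"
    by (subst ind) (rule integrable_mult_indicator[OF A' il])
  have ism: "integrable lborel (\<lambda>\<xi>. indicator A \<xi> * s (x \<bullet> \<xi>))"
    by (subst ind) (rule integrable_mult_indicator[OF A' iss])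
  have id: "integrable lborel (\<lambda>\<xi>. indicator (cball 0 \<rho>) \<xi> * (s (x \<bullet> \<xi>) - ln \<bar>x \<bullet> \<xi>\<bar>))"
    unfolding right_diff_distrib by (intro Bochner_Integration.integrable_diff iss il)
  have "x \<noteq> 0" using x by auto
  have "\<bar>\<integral>\<xi>. indicator A \<xi> * s (x \<bullet> \<xi>) - indicator A \<xi> * ln \<bar>x \<bullet> \<xi>\<bar> \<partial>lborel\<bar> \<le>
     (\<integral>\<xi>. indicator (cball 0 \<rho>) \<xi> * (s (x \<bullet> \<xi>) - ln \<bar>x \<bullet> \<xi>\<bar>) \<partial>lborel)"
  proof (rule integral_abs_bound[THEN order_trans], rule integral_mono_AE)
    show "integrable lborel (\<lambda>\<xi>. \<bar>indicator A \<xi> * s (x \<bullet> \<xi>) - indicator A \<xi> * ln \<bar>x \<bullet> \<xi>\<bar>\<bar>)"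
      by (intro integrable_abs Bochner_Integration.integrable_diff ism il')
    show "AE \<xi> in lborel. \<bar>indicator A \<xi> * s (x \<bullet> \<xi>) - indicator A \<xi> * ln \<bar>x \<bullet> \<xi>\<bar>\<bar> \<le>
        indicator (cball 0 \<rho>) \<xi> * (s (x \<bullet> \<xi>) - ln \<bar>x \<bullet> \<xi>\<bar>)"
      using AE_inner_nonzero[OF \<open>x \<noteq> 0\<close>]
    proof eventually_elim
      fix \<xi> assume "x \<bullet> \<xi> \<noteq> 0"
      from smoothed_ln_ge[OF this, of \<delta>] have "0 \<le> s (x \<bullet> \<xi>) - ln \<bar>x \<bullet> \<xi>\<bar>" by (simp add: s_def)
      then show "\<bar>indicator A \<xi> * s (x \<bullet> \<xi>) - indicator A \<xi> * ln \<bar>x \<bullet> \<xi>\<bar>\<bar> \<le>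
        indicator (cball 0 \<rho>) \<xi> * (s (x \<bullet> \<xi>) - ln \<bar>x \<bullet> \<xi>\<bar>)"
      proof (cases "\<xi> \<in> A")
        case True
        then have "\<xi> \<in> cball 0 \<rho>" using A(2) by blast
        then show ?thesis using True \<open>0 \<le> s (x \<bullet> \<xi>) - ln \<bar>x \<bullet> \<xi>\<bar>\<close>
          by (simp only: indicator_simps mult_1 abs_of_nonneg)
      next
        case False
        have "0 \<le> indicator (cball 0 \<rho>) \<xi> * (s (x \<bullet> \<xi>) - ln \<bar>x \<bullet> \<xi>\<bar>)"
          using \<open>0 \<le> s (x \<bullet> \<xi>) - ln \<bar>x \<bullet> \<xi>\<bar>\<close> by (intro mult_nonneg_nonneg) auto
        moreover have "indicator A \<xi> = (0 :: real)" using False by simp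
        ultimately show ?thesis by (simp only: mult_zero_left diff_0_right abs_zero)
      qed
    qed
  qed (rule id)
  also have "\<dots> = smoothing_gap \<rho> \<delta>"
    using radial_ridge(1)[OF x dm, of \<rho>] by (simp add: smoothing_gap_def s_def)
  finally show ?thesis using ism il' by (simp add: s_def)
qed

section \<open>The difference of two ellipsoid averages\<close>

text \<open>The share of the difference that is free of \<open>x\<close>. Over the body it
  integrates to a constant, which is subtracted in the end.\<close>

definition radial_part :: "real \<Rightarrow> real \<Rightarrow> real" where
  "radial_part a R2 = ((ball_ln - ball_vol * ((ln (a / 4 + R2) + ln a) / 2)) / sqrt (a / 4 + R2) -
     (ball_ln - ball_vol * ((ln (a + R2) + ln a) / 2)) / sqrt (a + R2)) / a"

lemma sqrt_quarter: "sqrt (a + 4 * b) = 2 * sqrt (a / 4 + b)"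
proof -
  have "a + 4 * b = 4 * (a / 4 + b)" by simp
  then show ?thesis by (metis real_sqrt_mult real_sqrt_four)
qed

lemma ln_quarter:
  assumes "a / 4 + b > (0::real)" shows "ln (a + 4 * b) = ln 4 + ln (a / 4 + b)"
proof -
  have eq: "a + 4 * b = 4 * (a / 4 + b)" by simp
  show ?thesis unfolding eq using assms by (subst ln_mult) simp_all
qed

text \<open>Doubling \<open>y\<close> multiplies its squared norm and its squared distance from the
  line by 4. By \<open>a + 4 * t = 4 * (a / 4 + t)\<close> the root yields a factor 2, which the
  coefficient 2 cancels, and the two copies of \<open>ln 4\<close> cancel each other. The same
  expression remains with \<open>a / 4\<close> for \<open>a\<close>, except in the factor
  \<open>1 / a\<close> and the term \<open>ln a\<close>.\<close>

lemma ellipsoid_ln_difference: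
  fixes x y :: "real^3"
  assumes a: "a > 0" and x: "norm x = 1"
  shows "2 * (\<integral>\<xi>. indicator (ellipsoid a (2 *\<^sub>R y)) \<xi> * ln \<bar>x \<bullet> \<xi>\<bar> \<partial>lborel) -
      (\<integral>\<xi>. indicator (ellipsoid a (1 *\<^sub>R y)) \<xi> * ln \<bar>x \<bullet> \<xi>\<bar> \<partial>lborel) =
    ball_vol / a * log_kernel a ((norm y)\<^sup>2) ((norm y)\<^sup>2 - (x \<bullet> y)\<^sup>2) + radial_part a ((norm y)\<^sup>2)"
proof -
  define R where "R = (norm y)\<^sup>2"
  define q where "q = R - (x \<bullet> y)\<^sup>2"
  have Rq: "R \<ge> 0" "q \<ge> 0" using axis_distance_nonneg[OF x] by (simp_all add: R_def q_def)
  have n2: "(norm (2 *\<^sub>R y))\<^sup>2 = 4 * R" "4 * R - (x \<bullet> (2 *\<^sub>R y))\<^sup>2 = 4 * q"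
    by (simp_all add: R_def q_def power_mult_distrib)
  define s t where "s = sqrt (a / 4 + R)" and "t = sqrt (a + R)"
  have st: "s > 0" "t > 0" using a Rq by (simp_all add: s_def t_def add_pos_nonneg)
  have "(\<integral>\<xi>. indicator (ellipsoid a (2 *\<^sub>R y)) \<xi> * ln \<bar>x \<bullet> \<xi>\<bar> \<partial>lborel) =
     1 / (a * (2 * s)) * (ball_ln + ball_vol * ((ln (a / 4 + q) - ln (a / 4 + R) - ln a) / 2))"
    using ellipsoid_ln(1)[OF a x, of "2 *\<^sub>R y"] ln_quarter[of a q] ln_quarter[of a R] a Rq
    unfolding n2 ellipsoid_def[symmetric] sqrt_quarter s_def[symmetric] by (simp add: add_pos_nonneg)
  moreover have "(\<integral>\<xi>. indicator (ellipsoid a (1 *\<^sub>R y)) \<xi> * ln \<bar>x \<bullet> \<xi>\<bar> \<partial>lborel) =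
     1 / (a * t) * (ball_ln + ball_vol * ((ln (a + q) - ln (a + R) - ln a) / 2))"
    using ellipsoid_ln(1)[OF a x, of y] unfolding R_def[symmetric] q_def[symmetric] ellipsoid_def[symmetric] t_def[symmetric]
    by simp
  moreover have "2 * (1 / (a * (2 * s)) * (b + v * ((L1 - l1 - la) / 2))) - 1 / (a * t) * (b + v * ((L2 - l2 - la) / 2)) =
      v / a * ((L1 / s - L2 / t) / 2) + ((b - v * ((l1 + la) / 2)) / s - (b - v * ((l2 + la) / 2)) / t) / a"
    for b v L1 l1 la L2 l2 :: real
  proof -
    have 1: "2 * (1 / (a * (2 * s)) * X) = X / s / a" "1 / (a * t) * X = X / t / a" for X
      by (simp_all add: mult.commute)
    have 2: "b + v * ((L - l - la) / 2) = (b - v * ((l + la) / 2)) + v * L / 2" for L l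
      by (simp add: right_diff_distrib distrib_left add_divide_distrib diff_divide_distrib)
    have 3: "(B1 + v * L1 / 2) / s / a - (B2 + v * L2 / 2) / t / a =
        v / a * ((L1 / s - L2 / t) / 2) + (B1 / s - B2 / t) / a" for B1 B2
      by (simp add: add_divide_distrib diff_divide_distrib right_diff_distrib mult_ac)
    show ?thesis unfolding 1 2 by (rule 3)
  qed
  ultimately show ?thesis
    unfolding R_def[symmetric] q_def[symmetric] log_kernel_def radial_part_def s_def[symmetric] t_def[symmetric] by simp
qed

lemma ellipsoid_measure_difference:
  fixes y :: "real^3"
  assumes a: "a > 0"
  shows "2 * measure lborel (ellipsoid a (2 *\<^sub>R y)) - measure lborel (ellipsoid a (1 *\<^sub>R y)) =
    ball_vol / a * (1 / sqrt (a / 4 + (norm y)\<^sup>2) - 1 / sqrt (a + (norm y)\<^sup>2))"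
proof -
  have n: "norm (axis 1 1 :: real^3) = 1" by simp
  have n2: "(norm (2 *\<^sub>R y))\<^sup>2 = 4 * (norm y)\<^sup>2" by (simp add: power_mult_distrib)
  have "measure lborel (ellipsoid a (2 *\<^sub>R y)) = 1 / (a * (2 * sqrt (a / 4 + (norm y)\<^sup>2))) * ball_vol"
    using ellipsoid_ln(2)[OF a n, of "2 *\<^sub>R y"] unfolding n2 sqrt_quarter ellipsoid_def .
  moreover have "measure lborel (ellipsoid a (1 *\<^sub>R y)) = 1 / (a * sqrt (a + (norm y)\<^sup>2)) * ball_vol"
    using ellipsoid_ln(2)[OF a n, of y] unfolding ellipsoid_def by simp
  moreover have "2 * (1 / (a * (2 * s)) * V) - 1 / (a * t) * V = V / a * (1 / s - 1 / t)" for s t V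
    by (simp add: right_diff_distrib)
  ultimately show ?thesis by simp
qed

text \<open>For unit \<open>x\<close>, \<open>(x \<bullet> \<xi>)\<^sup>2 + \<delta>\<^sup>2\<close>
  is \<open>\<delta>\<^sup>2\<close> times the quadratic form \<open>(norm x)\<^sup>2 + (x \<bullet>
  \<xi>)\<^sup>2 / \<delta>\<^sup>2\<close>, so the function is the logarithm of an ellipsoidal norm
  plus \<open>ln \<delta>\<close>.\<close>

lemma approximable_smoothed_ln:
  fixes \<xi> :: "real^3"
  assumes \<delta>: "\<delta> > 0"
  shows "approximable (\<lambda>x. ln ((x \<bullet> \<xi>)\<^sup>2 + \<delta>\<^sup>2) / 2)"
proof -
  have "1 + (1 / \<delta>\<^sup>2) * (norm \<xi>)\<^sup>2 > 0" using \<delta> by (simp add: add_pos_nonneg)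
  then obtain T :: "real^3 \<Rightarrow> real^3" where T: "linear T" "\<And>x. (norm (T x))\<^sup>2 = (norm x)\<^sup>2 + (1 / \<delta>\<^sup>2) * (x \<bullet> \<xi>)\<^sup>2"
    using rank_one_map by blast
  have "inj T"
    unfolding linear_injective_0[OF T(1)]
  proof (intro allI impI)
    fix x assume "T x = 0"
    then have "(norm x)\<^sup>2 + (1 / \<delta>\<^sup>2) * (x \<bullet> \<xi>)\<^sup>2 = 0" using T(2)[of x] by simp
    moreover have "(1 / \<delta>\<^sup>2) * (x \<bullet> \<xi>)\<^sup>2 \<ge> 0" by simp
    moreover have "(norm x)\<^sup>2 \<ge> 0" by simp
    ultimately have "(norm x)\<^sup>2 = 0" by linarith
    then show "x = 0" by simp
  qed
  from approximable_add_const[OF approximable_ln_norm[OF T(1) this], of "ln \<delta>"]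
  show ?thesis
  proof (rule approximable_cong)
    fix x :: "real^3" assume x: "norm x = 1"
    have Tx: "(norm (T x))\<^sup>2 * \<delta>\<^sup>2 = (x \<bullet> \<xi>)\<^sup>2 + \<delta>\<^sup>2" unfolding T(2) x using \<delta> by (simp add: distrib_right)
    have "(norm (T x))\<^sup>2 \<ge> 1" using T(2)[of x] x by simp
    then have pos: "norm (T x) > 0" by (metis norm_eq_zero not_one_le_zero zero_less_norm_iff zero_power2)
    have "ln ((norm (T x) * \<delta>) ^ 2) = 2 * ln (norm (T x) * \<delta>)" using pos \<delta> by (subst ln_realpow) auto
    also have "\<dots> = 2 * (ln (norm (T x)) + ln \<delta>)" using pos \<delta> by (simp add: ln_mult)
    finally show "ln ((x \<bullet> \<xi>)\<^sup>2 + \<delta>\<^sup>2) / 2 = ln (norm (T x)) + ln \<delta>"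
      by (simp add: power_mult_distrib Tx)
  qed
qed

section \<open>Assembling the approximation\<close>

lemma approximable_ln_norm_dim3:
  fixes p :: "real^3 \<Rightarrow> real"
  assumes p: "norm_between r M p"
  shows "approximable (\<lambda>x. ln (p x))"
proof (rule approximable_limit)
  fix \<eta> :: real assume \<eta>: "\<eta> > 0"
  have r: "r > 0" and M: "M > 0" using norm_betweenD(1,2)[OF p] by auto
  have \<eta>2: "\<eta> / 2 > 0" using \<eta> by simp
  let ?lk = "\<lambda>a x y. indicator {y. p y \<le> 1} y * log_kernel a ((norm y)\<^sup>2) ((norm y)\<^sup>2 - (x \<bullet> y)\<^sup>2)"
  obtain a1 where a1: "a1 > 0" "\<And>a x. 0 < a \<Longrightarrow> a < a1 \<Longrightarrow> norm x = 1 \<Longrightarrow>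
     \<bar>(\<integral>y. ?lk a x y \<partial>lborel) - (ball_kernel (r / 2) a + ridge_mass M a * (ln (p x) + ln (r / 2)))\<bar>
       \<le> \<eta> / 2 * ridge_mass M a"
    using kernel_asymptotics[OF r M \<eta>2] p by blast
  \<comment> \<open>This threshold makes \<open>ridge_mass M a\<close> positive, so that one can
    divide by it.\<close>
  obtain a2 where a2: "a2 > 0" "\<And>a. 0 < a \<Longrightarrow> a < a2 \<Longrightarrow> 1 * a \<le> ridge_mass M a"
    using ridge_mass_dominates[OF M, of 1] by blast
  define a where "a = min a1 a2 / 2"
  have a: "a > 0" "a < a1" "a < a2" using a1(1) a2(1) by (auto simp: a_def)
  define \<alpha> where "\<alpha> = ridge_mass M a"
  have \<alpha>: "\<alpha> > 0" using a2(2)[OF a(1,3)] a(1) by (simp add: \<alpha>_def)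
  define V where "V = ball_vol"
  have V: "V > 0" unfolding V_def by (simp add: content_cball_pos)
  \<comment> \<open>\<open>k\<close> does two things at once: it gives the integral of the log
    kernel the coefficient \<open>1 / \<alpha>\<close>, and by \<open>radial_mass_le\<close> it
    makes the total mass of \<open>k * W\<close> at most 1.\<close>
  define k where "k = a / (V * \<alpha>)"
  have k: "k > 0" using a V \<alpha> by (simp add: k_def)
  define W where "W = direction_weight a p"
  define \<rho> where "\<rho> = 1 / sqrt a"
  define vol where "vol = measure lborel {y. p y \<le> 1}"
  \<comment> \<open>The smoothing parameter is chosen after \<open>a\<close>, because its error is
    multiplied by \<open>k\<close>. The 3 adds up the coefficients 2 and 1 of the two ellipsoids;
    the \<open>+ 1\<close> keeps the denominator positive.\<close>
  obtain n where n: "smoothing_gap \<rho> (inverse (real (Suc n))) < \<eta> / (2 * (3 * vol * k + 1))"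
  proof -
    have "\<eta> / (2 * (3 * vol * k + 1)) > 0"
      using \<eta> k by (intro divide_pos_pos) (auto simp: vol_def add_nonneg_pos)
    from order_tendstoD(2)[OF smoothing_gap_tendsto this, of \<rho>] show ?thesis
      using that by (auto simp: eventually_sequentially)
  qed
  define \<delta> where "\<delta> = inverse (real (Suc n))"
  have \<delta>: "\<delta> > 0" by (simp add: \<delta>_def)
  have gap: "3 * vol * k * smoothing_gap \<rho> \<delta> \<le> \<eta> / 2"
  proof -
    have v0: "vol \<ge> 0" by (simp add: vol_def)
    then have d: "3 * vol * k + 1 > 0" using k by (simp add: add_nonneg_pos)
    have "3 * vol * k * smoothing_gap \<rho> \<delta> \<le> 3 * vol * k * (\<eta> / (2 * (3 * vol * k + 1)))"
      using n k v0 by (intro mult_left_mono) (auto simp: \<delta>_def)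
    also have "\<dots> = (3 * vol * k / (3 * vol * k + 1)) * (\<eta> / 2)" by simp
    also have "\<dots> \<le> 1 * (\<eta> / 2)" using d \<eta> by (intro mult_right_mono) (auto simp: divide_le_eq)
    finally show ?thesis by simp
  qed
  define \<phi> where "\<phi> x \<xi> = ln ((x \<bullet> \<xi>)\<^sup>2 + \<delta>\<^sup>2) / 2" for x \<xi> :: "real^3"
  define C where "C = (\<integral>y. indicator {y. p y \<le> 1} y * radial_part a ((norm y)\<^sup>2) \<partial>lborel)"
  \<comment> \<open>\<open>b\<close> removes everything that does not depend on \<open>x\<close>:
    the radial part, the inner ball and the logarithm of the cut radius.\<close>
  define b where "b = - (k * C) - ball_kernel (r / 2) a / \<alpha> - ln (r / 2)"
  define v where "v x = (\<integral>\<xi>. (k * W \<xi>) * \<phi> x \<xi> \<partial>lborel) + b" for x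
  have mB: "{y. p y \<le> 1} \<in> sets borel" and bB: "bounded {y. p y \<le> 1}"
    using unit_ball_measurable[OF p] by auto
  have "approximable v"
    unfolding v_def
  proof (intro approximable_add_const approximable_integral)
    show "continuous_on (sphere 0 1 \<times> UNIV) (\<lambda>z. \<phi> (fst z) (snd z))"
      unfolding \<phi>_def by (intro continuous_smoothed_ln \<delta> continuous_intros)
    show "approximable (\<lambda>x. \<phi> x \<xi>)" for \<xi>
      unfolding \<phi>_def by (rule approximable_smoothed_ln[OF \<delta>])
    have wi: "integrable lborel W"
      using direction_weight_integral(1)[OF p a(1), of "\<lambda>_. 1"] by (simp add: W_def)
    then show "integrable lborel (\<lambda>\<xi>. k * W \<xi>)" by simp
    show "0 \<le> k * W \<xi>" for \<xi> using direction_weight_nonneg[OF p a(1)] k by (simp add: W_def)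
    show "k * W \<xi> = 0" if "norm \<xi> > \<rho>" for \<xi>
      using direction_weight_outside[OF p a(1)] that by (simp add: W_def \<rho>_def)
    have "integral\<^sup>L lborel W = (\<integral>y. indicator {y. p y \<le> 1} y *
      (2 * measure lborel (ellipsoid a (2 *\<^sub>R y)) - measure lborel (ellipsoid a (1 *\<^sub>R y))) \<partial>lborel)"
      using direction_weight_integral(2)[OF p a(1), of "\<lambda>_. 1"] by (simp add: W_def)
    also have "\<dots> = V / a * (\<integral>y. indicator {y. p y \<le> 1} y *
      (1 / sqrt (a / 4 + (norm y)\<^sup>2) - 1 / sqrt (a + (norm y)\<^sup>2)) \<partial>lborel)"
      unfolding ellipsoid_measure_difference[OF a(1)] V_def mult.left_commute[of "indicator _ _"] integral_mult_right_zero ..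
    also have "\<dots> \<le> V / a * \<alpha>"
      unfolding \<alpha>_def using V a by (intro mult_left_mono radial_mass_le[OF a(1) p]) auto
    finally have "k * integral\<^sup>L lborel W \<le> k * (V / a * \<alpha>)" using k by (intro mult_left_mono) auto
    also have "\<dots> = 1" using a V \<alpha> by (simp add: k_def)
    finally show "(\<integral>\<xi>. k * W \<xi> \<partial>lborel) \<le> 1" by simp
  qed
  moreover have "\<bar>v x - ln (p x)\<bar> \<le> \<eta>" if x: "norm x = 1" for x
  proof -
    let ?I = "\<lambda>c y. \<integral>\<xi>. indicator (ellipsoid a (c *\<^sub>R y)) \<xi> * \<phi> x \<xi> \<partial>lborel"
    let ?J = "\<lambda>c y. \<integral>\<xi>. indicator (ellipsoid a (c *\<^sub>R y)) \<xi> * ln \<bar>x \<bullet> \<xi>\<bar> \<partial>lborel"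
    have fc: "continuous_on UNIV (\<phi> x)"
      unfolding \<phi>_def by (intro continuous_smoothed_ln \<delta> continuous_intros)
    have IJ: "\<bar>?I c y - ?J c y\<bar> \<le> smoothing_gap \<rho> \<delta>" for c y
      unfolding \<phi>_def \<rho>_def
      by (rule smoothing_error[OF x \<delta> ellipsoid_measurable ellipsoid_bounded[OF a(1)]])
    have J: "2 * ?J 2 y - ?J 1 y = V / a * log_kernel a ((norm y)\<^sup>2) ((norm y)\<^sup>2 - (x \<bullet> y)\<^sup>2) + radial_part a ((norm y)\<^sup>2)" for y
      using ellipsoid_ln_difference[OF a(1) x, of y] by (simp add: V_def)
    have pos: "a / 4 + (norm y)\<^sup>2 > 0" "a + (norm y)\<^sup>2 > 0" for y :: "real^3"
      using a by (simp_all add: add_pos_nonneg)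
    have i1: "integrable lborel (?lk a x)"
      using axis_distance_nonneg[OF x]
      by (intro integrable_indicator_continuous mB bB continuous_on_log_kernel a continuous_intros)
    have i2: "integrable lborel (\<lambda>y. indicator {y. p y \<le> 1} y * radial_part a ((norm y)\<^sup>2))"
    proof (rule integrable_indicator_continuous[OF mB bB])
      show "continuous_on UNIV (\<lambda>y :: real^3. radial_part a ((norm y)\<^sup>2))"
        unfolding radial_part_def using pos a
        by (intro continuous_intros ballI) (auto simp: less_imp_neq[symmetric])
    qed
    have Jeq: "(\<lambda>y. indicator {y. p y \<le> 1} y * (2 * ?J 2 y - ?J 1 y)) =
        (\<lambda>y. V / a * ?lk a x y + indicator {y. p y \<le> 1} y * radial_part a ((norm y)\<^sup>2))"
      unfolding J by (rule ext) (simp only: distrib_left mult.left_commute)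
    have Ji: "integrable lborel (\<lambda>y. indicator {y. p y \<le> 1} y * (2 * ?J 2 y - ?J 1 y))"
      unfolding Jeq by (intro Bochner_Integration.integrable_add integrable_mult_right i1 i2)
    have JI: "(\<integral>y. indicator {y. p y \<le> 1} y * (2 * ?J 2 y - ?J 1 y) \<partial>lborel) = V / a * (\<integral>y. ?lk a x y \<partial>lborel) + C"
      unfolding Jeq C_def
      by (subst Bochner_Integration.integral_add) (intro integrable_mult_right i1 i2, rule i2, simp)
    have Ii: "integrable lborel (\<lambda>y. indicator {y. p y \<le> 1} y * (2 * ?I 2 y - ?I 1 y))"
      by (rule direction_weight_integral(3)[OF p a(1) fc])
    have II: "(\<integral>\<xi>. W \<xi> * \<phi> x \<xi> \<partial>lborel) = (\<integral>y. indicator {y. p y \<le> 1} y * (2 * ?I 2 y - ?I 1 y) \<partial>lborel)"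
      unfolding W_def by (rule direction_weight_integral(2)[OF p a(1) fc])
    have "\<bar>\<integral>y. indicator {y. p y \<le> 1} y * (2 * ?I 2 y - ?I 1 y) - indicator {y. p y \<le> 1} y * (2 * ?J 2 y - ?J 1 y) \<partial>lborel\<bar>
        \<le> (\<integral>y. indicator {y. p y \<le> 1} y * (3 * smoothing_gap \<rho> \<delta>) \<partial>lborel)"
    proof (rule integral_abs_bound[THEN order_trans], rule integral_mono)
      show "integrable lborel (\<lambda>y. \<bar>indicator {y. p y \<le> 1} y * (2 * ?I 2 y - ?I 1 y) - indicator {y. p y \<le> 1} y * (2 * ?J 2 y - ?J 1 y)\<bar>)"
        by (intro integrable_abs Bochner_Integration.integrable_diff Ii Ji)
      show "integrable lborel (\<lambda>y. indicator {y. p y \<le> 1} y * (3 * smoothing_gap \<rho> \<delta>))"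
        by (intro integrable_indicator_continuous mB bB continuous_intros)
      fix y
      have "\<bar>(2 * i2 - i1) - (2 * j2 - j1)\<bar> \<le> 3 * g" if "\<bar>i2 - j2\<bar> \<le> g" "\<bar>i1 - j1\<bar> \<le> g" for i1 i2 j1 j2 g :: real
        using that by linarith
      from this[OF IJ IJ] have "\<bar>(2 * ?I 2 y - ?I 1 y) - (2 * ?J 2 y - ?J 1 y)\<bar> \<le> 3 * smoothing_gap \<rho> \<delta>" .
      then show "\<bar>indicator {y. p y \<le> 1} y * (2 * ?I 2 y - ?I 1 y) - indicator {y. p y \<le> 1} y * (2 * ?J 2 y - ?J 1 y)\<bar>
          \<le> indicator {y. p y \<le> 1} y * (3 * smoothing_gap \<rho> \<delta>)"
        by (simp add: indicator_def)
    qed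
    also have "\<dots> = 3 * vol * smoothing_gap \<rho> \<delta>" by (simp add: vol_def)
    finally have "\<bar>(\<integral>\<xi>. W \<xi> * \<phi> x \<xi> \<partial>lborel) - (V / a * (\<integral>y. ?lk a x y \<partial>lborel) + C)\<bar> \<le> 3 * vol * smoothing_gap \<rho> \<delta>"
      unfolding II JI[symmetric] using Ii Ji by simp
    then have "k * \<bar>(\<integral>\<xi>. W \<xi> * \<phi> x \<xi> \<partial>lborel) - (V / a * (\<integral>y. ?lk a x y \<partial>lborel) + C)\<bar> \<le> k * (3 * vol * smoothing_gap \<rho> \<delta>)"
      using k by (intro mult_left_mono) auto
    also have "\<dots> \<le> \<eta> / 2" using gap by (simp add: mult_ac)
    finally have e1: "\<bar>k * (\<integral>\<xi>. W \<xi> * \<phi> x \<xi> \<partial>lborel) - k * (V / a * (\<integral>y. ?lk a x y \<partial>lborel) + C)\<bar> \<le> \<eta> / 2"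
      using k by (simp add: abs_mult right_diff_distrib[symmetric])
    have kV: "k * (V / a * L + C) = L / \<alpha> + k * C" for L
      using a V \<alpha> by (simp add: k_def distrib_left)
    have "\<bar>(\<integral>y. ?lk a x y \<partial>lborel) - (ball_kernel (r / 2) a + \<alpha> * (ln (p x) + ln (r / 2)))\<bar> / \<alpha> \<le> (\<eta> / 2 * \<alpha>) / \<alpha>"
      using a1(2)[OF a(1,2) x] \<alpha> unfolding \<alpha>_def by (intro divide_right_mono) auto
    then have "\<bar>((\<integral>y. ?lk a x y \<partial>lborel) - (ball_kernel (r / 2) a + \<alpha> * (ln (p x) + ln (r / 2)))) / \<alpha>\<bar> \<le> \<eta> / 2"
      using \<alpha> by (simp add: abs_divide)
    also have "((\<integral>y. ?lk a x y \<partial>lborel) - (ball_kernel (r / 2) a + \<alpha> * (ln (p x) + ln (r / 2)))) / \<alpha> =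
        (\<integral>y. ?lk a x y \<partial>lborel) / \<alpha> - ball_kernel (r / 2) a / \<alpha> - ln (p x) - ln (r / 2)"
      using \<alpha> by (simp add: diff_divide_distrib add_divide_distrib)
    finally have e2: "\<bar>(\<integral>y. ?lk a x y \<partial>lborel) / \<alpha> - ball_kernel (r / 2) a / \<alpha> - ln (p x) - ln (r / 2)\<bar> \<le> \<eta> / 2" .
    have vx: "v x = k * (\<integral>\<xi>. W \<xi> * \<phi> x \<xi> \<partial>lborel) + b" by (simp add: v_def mult.assoc)
    show ?thesis using e1 e2 unfolding vx b_def kV by linarith
  qed
  ultimately show "\<exists>v. approximable v \<and> (\<forall>x. norm x = 1 \<longrightarrow> \<bar>v x - ln (p x)\<bar> \<le> \<eta>)" by blast
qed

theorem corollary5p5: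
  fixes K :: "(real^3) set"
  assumes "convex_body K" and "origin_symmetric K"
  shows "K \<in> generated_from_ball"
proof -
  obtain r M where "norm_between r M (minkowski_functional K)"
    using symmetric_convex_body_norm[OF assms] .
  from approximable_ln_norm_dim3[OF this] show ?thesis
    by (rule generated_of_approximable[OF symmetric_convex_body_star_body[OF assms]])
qed

end
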